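(* Let $\mathbb{K}$ be an algebraically closed field of characteristic $0$ and let $n\ge 1$. (a) Any automorphism of $\mathbb{P}^n$ is conjugate in the Cremona group $Bir(\mathbb{P}^n)$ either to a diagonal automorphism or to an almost-diagonal automorphism of $\mathbb{P}^n$, and these two possibilities exclude each other. (b) Two diagonal automorphisms $\tilde\rho(\mu),\tilde\rho(\mu')$ of $\mathbb{P}^n$, with $\mu,\mu'\in(\mathbb{K}^* )^n$, are conjugate in $Bir(\mathbb{P}^n)$ if and only if $\mu'=A\bullet\mu$ for some $A\in GL(n,\mathbb{Z})$, equivalently if and only if they are conjugate by $\tilde T(A)$ for some $A \in GL(n,\mathbb{Z})$. Two almost-diagonal automorphisms $\tilde\theta(\nu),\tilde\theta(\nu')$ of $\mathbb{P}^n$, with $\nu,\nu'\in(\mathbb{K}^* )^{n-1}$, are conjugate in $Bir(\mathbb{P}^n)$ if and only if $\nu'=B\bullet\nu$ for some $B\in GL(n-1,\mathbb{Z})$, equivalently if and only if they are conjugate by $\tilde S(B)$ for some $B\in GL(n-1,\mathbb{Z})$. (c) In particular, if $n>1$, any two automorphisms of $\mathbb{P}^n$ of the same finite order are conjugate in $Bir(\mathbb{P}^n)$.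
   Context: $\mathbb{P}^n$ is projective $n$-space over $\mathbb{K}$; $Bir(\mathbb{P}^n)$ is the group of birational maps of $\mathbb{P}^n$ to itself, and the group of automorphisms of $\mathbb{P}^n$ is $PGL(n+1,\mathbb{K})\subset Bir(\mathbb{P}^n)$. $Bir(\mathbb{P}^n)$ is identified with the group $Bir(\mathbb{K}^n)$ of birational maps of $\mathbb{K}^n$ via the chart $\nu_0:\{x_0\neq0\}\to\mathbb{K}^n$, $(x_0:\dots:x_n)\mapsto(x_1/x_0,\dots,x_n/x_0)$, that is, by $\varphi\mapsto\nu_0\varphi\nu_0^{-1}$. Diagonal automorphism of $\mathbb{P}^n$: for $\mu=(\mu_1,\dots,\mu_n)\in(\mathbb{K}^* )^n$, $\tilde\rho(\mu):(x_0:\dots:x_n)\mapsto(x_0:\mu_1x_1:\dots:\mu_nx_n)$. Almost-diagonal automorphism of $\mathbb{P}^n$: for $\nu=(\nu_2,\dots,\nu_n)\in(\mathbb{K}^* )^{n-1}$, $\tilde\theta(\nu):(x_0:\dots:x_n)\mapsto(x_0:x_0+x_1:\nu_2x_2:\dots:\nu_nx_n)$. For $m\ge0$, $GL(m,\mathbb{Z})$ is the automorphism group of the algebraic torus $(\mathbb{K}^* )^m$ and acts on it by $A\bullet(\mu_1,\dots,\mu_m)=(\mu_1^{a_{11}}\cdots\mu_m^{a_{1m}},\dots,\mu_1^{a_{m1}}\cdots\mu_m^{a_{mm}})$ for $A=(a_{ij})$. $\tilde T(A)$, for $A=(a_{ij})_{i,j=1}^n\in GL(n,\mathbb{Z})$,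 is the birational map of $\mathbb{P}^n$ corresponding, under the chart $\nu_0:(x_0:\dots:x_n)\mapsto(x_1/x_0,\dots,x_n/x_0)$, to the birational map $(x_1,\dots,x_n)\dashrightarrow(x_1^{a_{11}}\cdots x_n^{a_{1n}},\dots,x_1^{a_{n1}}\cdots x_n^{a_{nn}})$ of $\mathbb{K}^n$. $\tilde S(B)$, for $B=(b_{ij})_{i,j=2}^n\in GL(n-1,\mathbb{Z})$, is the birational map of $\mathbb{P}^n$ corresponding, under the chart $\nu_0$, to the birational map $(x_1,\dots,x_n)\dashrightarrow(x_1,x_2^{b_{22}}\cdots x_n^{b_{2n}},\dots,x_2^{b_{n2}}\cdots x_n^{b_{nn}})$ of $\mathbb{K}^n$. *)

theory Defs
  imports
    "HOL-Computational_Algebra.Polynomial"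
    "HOL-Algebra.Multiplicative_Group"
    "Jordan_Normal_Form.Matrix"
begin

text \<open>
  The ground field is an algebraically closed field of characteristic 0, hence infinite, so that
  polynomials in \<open>m\<close> variables are the same thing as polynomial functions on \<open>K^m\<close>.
  A point of \<open>K^m\<close> is a vector of dimension \<open>m\<close>; what a function does to vectors of other
  dimensions is irrelevant. Vector and matrix indices start at 0: the homogeneous coordinates
  \<open>x_0, ..., x_n\<close> on projective \<open>n\<close>-space have the indices \<open>0, ..., n\<close>,
  but the affine coordinates \<open>x_1, ..., x_n\<close> on \<open>K^n\<close> have the indices \<open>0, ..., n - 1\<close>.
\<close>

definition monomial_fun :: "nat \<Rightarrow> (nat \<Rightarrow> nat) \<Rightarrow> 'a::field vec \<Rightarrow> 'a" where
  "monomial_fun m e x = (\<Prod>i<m. x $ i ^ e i)"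

definition poly_fun :: "nat \<Rightarrow> ('a::field vec \<Rightarrow> 'a) \<Rightarrow> bool" where
  "poly_fun m f \<longleftrightarrow>
    (\<exists>(E :: (nat \<Rightarrow> nat) set) c. finite E \<and>
      (\<forall>x\<in>carrier_vec m. f x = (\<Sum>e\<in>E. c e * monomial_fun m e x)))"

definition homogeneous_poly_fun :: "nat \<Rightarrow> nat \<Rightarrow> ('a::field vec \<Rightarrow> 'a) \<Rightarrow> bool" where
  "homogeneous_poly_fun m d f \<longleftrightarrow>
    (\<exists>(E :: (nat \<Rightarrow> nat) set) c. finite E \<and> (\<forall>e\<in>E. (\<Sum>i<m. e i) = d) \<and>
      (\<forall>x\<in>carrier_vec m. f x = (\<Sum>e\<in>E. c e * monomial_fun m e x)))"

text \<open>
  A rational map from projective \<open>n\<close>-space to itself is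
  \<open>(x_0 : ... : x_n) \<mapsto> (F_0(x) : ... : F_n(x))\<close> with homogeneous polynomials \<open>F_i\<close> of the same
  degree that are not all zero; two such tuples give the same map iff they are proportional
  over the function field, that is, iff \<open>F_i G_j = F_j G_i\<close> for all \<open>i, j\<close>.
\<close>

definition homogeneous_tuple :: "nat \<Rightarrow> ('a::field vec \<Rightarrow> 'a vec) \<Rightarrow> bool" where
  "homogeneous_tuple n F \<longleftrightarrow>
    (\<forall>x\<in>carrier_vec (n + 1). F x \<in> carrier_vec (n + 1)) \<and>
    (\<exists>d. \<forall>i\<le>n. homogeneous_poly_fun (n + 1) d (\<lambda>x. F x $ i)) \<and>
    (\<exists>x\<in>carrier_vec (n + 1). F x \<noteq> 0\<^sub>v (n + 1))"

definition same_rational_map ::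
    "nat \<Rightarrow> ('a::field vec \<Rightarrow> 'a vec) \<Rightarrow> ('a vec \<Rightarrow> 'a vec) \<Rightarrow> bool" where
  "same_rational_map n F G \<longleftrightarrow>
    (\<forall>x\<in>carrier_vec (n + 1). \<forall>i\<le>n. \<forall>j\<le>n. F x $ i * G x $ j = F x $ j * G x $ i)"

type_synonym 'a rational_map = "('a vec \<Rightarrow> 'a vec) set"

definition rational_map_of :: "nat \<Rightarrow> ('a::field vec \<Rightarrow> 'a vec) \<Rightarrow> 'a rational_map" where
  "rational_map_of n F = {G. homogeneous_tuple n G \<and> same_rational_map n F G}"

text \<open>
  That \<open>F \<circ> G\<close> is again a homogeneous tuple just says that it does not vanish identically, that
  is, that the two rational maps can be composed.
\<close>

definition birational_tuple :: "nat \<Rightarrow> ('a::field vec \<Rightarrow> 'a vec) \<Rightarrow> bool" where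
  "birational_tuple n F \<longleftrightarrow> homogeneous_tuple n F \<and>
    (\<exists>G. homogeneous_tuple n G \<and>
      homogeneous_tuple n (F \<circ> G) \<and> same_rational_map n (F \<circ> G) id \<and>
      homogeneous_tuple n (G \<circ> F) \<and> same_rational_map n (G \<circ> F) id)"

definition Bir_proj :: "nat \<Rightarrow> 'a::field rational_map monoid" where
  "Bir_proj n =
    \<lparr>carrier = {rational_map_of n F | F. birational_tuple n F},
     monoid.mult = (\<lambda>\<phi> \<psi>. \<Union>F\<in>\<phi>. \<Union>G\<in>\<psi>. rational_map_of n (F \<circ> G)),
     one = rational_map_of n id\<rparr>"

definition conj_by :: "('g, 'm) monoid_scheme \<Rightarrow> 'g \<Rightarrow> 'g \<Rightarrow> 'g \<Rightarrow> bool" where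
  "conj_by G \<phi> g h \<longleftrightarrow> \<phi> \<otimes>\<^bsub>G\<^esub> g \<otimes>\<^bsub>G\<^esub> inv\<^bsub>G\<^esub> \<phi> = h"

definition conjugate_in :: "('g, 'm) monoid_scheme \<Rightarrow> 'g \<Rightarrow> 'g \<Rightarrow> bool" where
  "conjugate_in G g h \<longleftrightarrow> (\<exists>\<phi>\<in>carrier G. conj_by G \<phi> g h)"

definition GL_mat :: "nat \<Rightarrow> 'r::comm_ring_1 mat set" where
  "GL_mat m = {A \<in> carrier_mat m m. invertible_mat A}"

text \<open>The automorphisms of projective \<open>n\<close>-space, that is, the group \<open>PGL(n + 1, K)\<close>.\<close>

definition Aut_proj :: "nat \<Rightarrow> 'a::field rational_map set" where
  "Aut_proj n = {rational_map_of n (\<lambda>x. M *\<^sub>v x) | M. M \<in> GL_mat (n + 1)}"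

definition torus :: "nat \<Rightarrow> 'a::field vec set" where
  "torus m = {\<mu> \<in> carrier_vec m. \<forall>i<m. \<mu> $ i \<noteq> 0}"

definition diagonal_aut :: "nat \<Rightarrow> 'a::field vec \<Rightarrow> 'a rational_map" where
  "diagonal_aut n \<mu> = rational_map_of n
    (\<lambda>x. vec (n + 1) (\<lambda>i. if i = 0 then x $ 0 else \<mu> $ (i - 1) * x $ i))"

text \<open>The parameters \<open>\<nu>_2, ..., \<nu>_n\<close> have the indices \<open>0, ..., n - 2\<close>.\<close>

definition almost_diagonal_aut :: "nat \<Rightarrow> 'a::field vec \<Rightarrow> 'a rational_map" where
  "almost_diagonal_aut n \<nu> = rational_map_of n
    (\<lambda>x. vec (n + 1) (\<lambda>i. if i = 0 then x $ 0
                        else if i = 1 then x $ 0 + x $ 1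
                        else \<nu> $ (i - 2) * x $ i))"

definition monomial_act :: "int mat \<Rightarrow> 'a::field vec \<Rightarrow> 'a vec" where
  "monomial_act A \<mu> = vec (dim_row A) (\<lambda>i. \<Prod>j<dim_col A. \<mu> $ j powi (A $$ (i, j)))"

text \<open>
  The chart \<open>(x_0 : ... : x_n) \<mapsto> (x_1/x_0, ..., x_n/x_0)\<close>, in homogeneous coordinates, and its inverse.
\<close>

definition chart0 :: "nat \<Rightarrow> 'a::field vec \<Rightarrow> 'a vec" where
  "chart0 n x = vec n (\<lambda>i. x $ (i + 1) / x $ 0)"

definition chart0_inv :: "nat \<Rightarrow> 'a::field vec \<Rightarrow> 'a vec" where
  "chart0_inv n y = vec (n + 1) (\<lambda>i. if i = 0 then 1 else y $ (i - 1))"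

text \<open>
  \<open>generically n P\<close>: the property \<open>P\<close> holds on a nonempty (hence dense) Zariski-open subset of
  \<open>K^n\<close>. The sets \<open>{y. p y \<noteq> 0}\<close> form a basis of the Zariski topology.
\<close>

definition generically :: "nat \<Rightarrow> ('a::field vec \<Rightarrow> bool) \<Rightarrow> bool" where
  "generically n P \<longleftrightarrow>
    (\<exists>p. poly_fun n p \<and> (\<exists>y\<in>carrier_vec n. p y \<noteq> 0) \<and>
      (\<forall>y\<in>carrier_vec n. p y \<noteq> 0 \<longrightarrow> P y))"

text \<open>
  The rational map \<open>\<phi>\<close> of projective \<open>n\<close>-space with \<open>\<nu>_0 \<phi> \<nu>_0^{-1} = f\<close>, where the rational map
  \<open>f\<close> of \<open>K^n\<close> is given by its values at the points of some nonempty Zariski-open set.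
\<close>

definition from_chart :: "nat \<Rightarrow> ('a::field vec \<Rightarrow> 'a vec) \<Rightarrow> 'a rational_map" where
  "from_chart n f = {F. homogeneous_tuple n F \<and>
    generically n (\<lambda>y. F (chart0_inv n y) $ 0 \<noteq> 0 \<and> chart0 n (F (chart0_inv n y)) = f y)}"

definition T_map :: "nat \<Rightarrow> int mat \<Rightarrow> 'a::field rational_map" where
  "T_map n A = from_chart n (\<lambda>y. monomial_act A y)"

text \<open>The matrix entries \<open>b_{ij}\<close>, for \<open>2 \<le> i, j \<le> n\<close>, have the indices \<open>(i - 2, j - 2)\<close>.\<close>

definition S_map :: "nat \<Rightarrow> int mat \<Rightarrow> 'a::field rational_map" where
  "S_map n B = from_chart n
    (\<lambda>y. vec n (\<lambda>i. if i = 0 then y $ 0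
                    else monomial_act B (vec (n - 1) (\<lambda>j. y $ (j + 1))) $ (i - 1)))"

end

theory Submission
  imports Defs
    "Jordan_Normal_Form.Jordan_Normal_Form_Existence"
    "HOL-Combinatorics.Transposition"
    "HOL-Number_Theory.Totient"
begin

text \<open>The group generated by the weights is not a complete invariant because a finite cyclic
  group has several generators. A spare weight 1 absorbs the difference: (\<zeta>, 1) becomes
  (\<zeta>, \<zeta>'), then (1, \<zeta>'), then (\<zeta>', 1). For m = r + 1 there is no spare
  weight, integral matrices can change \<zeta> only into its inverse, and the conjugating map itself
  has to be examined. This is also why n > 1 is assumed in (c): finite order forces r = 0 and m = n.

  The density argument uses a power M^K that kills the torsion weights. Its orbits keep the last
  coordinate, while the K-th powers of the free weights stay independent. In the almost-diagonal
  case the additive coordinate moves along a line, and a polynomial in k that vanishes at all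
  naturals vanishes at every parameter; here characteristic 0 enters, as it does in the binomials
  C(-s, l).

  The additive coordinate has weight 1 and adds nothing to the group of weights, so one argument
  with a parameter \<epsilon> in {0, 1} serves both families. If h has order 0 at the origin, then
  \<zeta>' = 1, and \<zeta> = 1 follows because each is a power of the other.\<close>

text \<open>
  Existence. In Jordan coordinates let \<open>x_p \<mapsto> d x_p + x_{p+1}\<close> be the end of a nontrivial block and
  \<open>s = d x_p / x_{p+1}\<close>, so that \<open>s \<mapsto> s + 1\<close>. Replacing the first coordinate \<open>x_i\<close> of any block by
  \<open>\<Sum>\<^sub>l C(-s, l) d^{-l} x_{i+l}\<close> splits it off, until only one off-diagonal entry is left.

  Invariants. If \<open>F\<close> conjugates one normal form \<open>M\<close> to another, each \<open>f = F_i / F_0\<close> satisfies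
  \<open>f \<circ> M = \<lambda> f\<close> or \<open>f \<circ> M = f + 1\<close>. Along an orbit, numerator and denominator of \<open>f\<close> are
  exponential polynomials in the exponent \<open>k\<close> of \<open>M^k\<close>, whose bases are monomials in the weights. As
  exponential polynomials with different bases are independent, \<open>\<lambda>\<close> lies in the group generated
  by the weights of \<open>M\<close>, and the additive equation is impossible for diagonal \<open>M\<close>. So the weights
  of conjugate maps generate the same group.

  Up to \<open>GL(m, Z)\<close>, weights have the form \<open>(\<alpha>_1, ..., \<alpha>_r, \<zeta>, 1, ..., 1)\<close> with independent \<open>\<alpha>_i\<close> and a root of
  unity \<open>\<zeta>\<close>, and two such tuples that generate the same group are equivalent unless \<open>m = r + 1\<close>. In
  that case, density of the orbits in a torus shows that the last component of \<open>F\<close> and that of its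
  inverse depend on the last coordinate only. They are inverse rational functions \<open>h\<close> of one variable, so
  \<open>h\<close> has order \<open>-1\<close>, 0 or 1 at the origin, and \<open>h(\<zeta> y) = \<zeta>' h(y)\<close> gives \<open>\<zeta>' = \<zeta>^{-1}\<close>, 1 or \<open>\<zeta>\<close>.
\<close>

hide_const (open) module.smult up_ring.monom up_ring.coeff Coset.order

subsection \<open>Polynomial functions\<close>

text \<open>The exponents \<open>g i\<close> may coincide for different \<open>i\<close>; collecting
  equal ones here spares sums and products of polynomial functions a canonical form.\<close>

lemma poly_funI:
  fixes f :: "'a::field vec \<Rightarrow> 'a"
  assumes "finite I"
    and "\<And>x. x \<in> carrier_vec m \<Longrightarrow> f x = (\<Sum>i\<in>I. c i * monomial_fun m (g i) x)"
  shows "poly_fun m f"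
  unfolding poly_fun_def
proof (intro exI conjI ballI)
  show "finite (g ` I)" using assms(1) by simp
  fix x :: "'a vec" assume x: "x \<in> carrier_vec m"
  have "f x = (\<Sum>e\<in>g ` I. \<Sum>i\<in>{i\<in>I. g i = e}. c i * monomial_fun m (g i) x)"
    unfolding assms(2)[OF x] by (rule sum.image_gen) fact
  also have "\<dots> = (\<Sum>e\<in>g ` I. (\<Sum>i\<in>{i\<in>I. g i = e}. c i) * monomial_fun m e x)"
    by (intro sum.cong refl) (auto simp: sum_distrib_right)
  finally show "f x = \<dots>" .
qed

lemma poly_funE:
  assumes "poly_fun m f"
  obtains E :: "(nat \<Rightarrow> nat) set" and c where "finite E"
    "\<And>x. x \<in> carrier_vec m \<Longrightarrow> f x = (\<Sum>e\<in>E. c e * monomial_fun m e x)"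
  using assms unfolding poly_fun_def by blast

lemma poly_fun_cong:
  assumes "poly_fun m f" "\<And>x. x \<in> carrier_vec m \<Longrightarrow> f x = g x"
  shows "poly_fun m g"
  using assms unfolding poly_fun_def by auto

lemma poly_fun_const [simp, intro]: "poly_fun m (\<lambda>x. a)"
  by (rule poly_funI[of "{()}" _ _ "\<lambda>_. a" "\<lambda>_ _. 0"]) (auto simp: monomial_fun_def)

lemma poly_fun_coord [intro]:
  assumes "i < m"
  shows "poly_fun m (\<lambda>x. x $ i)"
proof (rule poly_funI[of "{()}" _ _ "\<lambda>_. 1" "\<lambda>_ j. if j = i then 1 else 0"])
  fix x :: "'a vec"
  have "(\<Prod>j<m. x $ j ^ (if j = i then 1 else 0)) = (\<Prod>j<m. if j = i then x $ i else 1)"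
    by (intro prod.cong) auto
  then show "x $ i = (\<Sum>_\<in>{()}. 1 * monomial_fun m (\<lambda>j. if j = i then 1 else 0) x)"
    using assms by (simp add: monomial_fun_def)
qed auto

lemma poly_fun_add [intro]:
  fixes f g :: "'a::field vec \<Rightarrow> 'a"
  assumes "poly_fun m f" "poly_fun m g"
  shows "poly_fun m (\<lambda>x. f x + g x)"
proof -
  obtain E c where E: "finite E" "\<And>x. x \<in> carrier_vec m \<Longrightarrow> f x = (\<Sum>e\<in>E. c e * monomial_fun m e x)"
    using poly_funE[OF assms(1)] by blast
  obtain E' c' where E': "finite E'" "\<And>x. x \<in> carrier_vec m \<Longrightarrow> g x = (\<Sum>e\<in>E'. c' e * monomial_fun m e x)"
    using poly_funE[OF assms(2)] by blast
  show ?thesis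
    by (rule poly_funI[of "E <+> E'" _ _ "case_sum c c'" "case_sum (\<lambda>e. e) (\<lambda>e. e)"])
      (use E E' in \<open>auto simp: sum.Plus\<close>)
qed

lemma poly_fun_mult [intro]:
  fixes f g :: "'a::field vec \<Rightarrow> 'a"
  assumes "poly_fun m f" "poly_fun m g"
  shows "poly_fun m (\<lambda>x. f x * g x)"
proof -
  obtain E c where E: "finite E" "\<And>x. x \<in> carrier_vec m \<Longrightarrow> f x = (\<Sum>e\<in>E. c e * monomial_fun m e x)"
    using poly_funE[OF assms(1)] by blast
  obtain E' c' where E': "finite E'" "\<And>x. x \<in> carrier_vec m \<Longrightarrow> g x = (\<Sum>e\<in>E'. c' e * monomial_fun m e x)"
    using poly_funE[OF assms(2)] by blast
  show ?thesis
  proof (rule poly_funI[of "E \<times> E'" _ _ "\<lambda>i. c (fst i) * c' (snd i)" "\<lambda>i j. fst i j + snd i j"])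
    fix x :: "'a vec" assume x: "x \<in> carrier_vec m"
    have "monomial_fun m (\<lambda>j. e j + e' j) x = monomial_fun m e x * monomial_fun m e' x" for e e'
      by (simp add: monomial_fun_def power_add prod.distrib)
    then show "f x * g x =
      (\<Sum>i\<in>E \<times> E'. c (fst i) * c' (snd i) * monomial_fun m (\<lambda>j. fst i j + snd i j) x)"
      unfolding E(2)[OF x] E'(2)[OF x] sum_product sum.cartesian_product
      by (intro sum.cong) (auto simp: mult_ac)
  qed (use E E' in simp)
qed

lemma poly_fun_sum [intro]:
  assumes "\<And>i. i \<in> I \<Longrightarrow> poly_fun m (f i)"
  shows "poly_fun m (\<lambda>x. \<Sum>i\<in>I. f i x)"
  using assms by (induction I rule: infinite_finite_induct) auto

lemma poly_fun_prod [intro]: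
  assumes "\<And>i. i \<in> I \<Longrightarrow> poly_fun m (f i)"
  shows "poly_fun m (\<lambda>x. \<Prod>i\<in>I. f i x)"
  using assms by (induction I rule: infinite_finite_induct) auto

lemma poly_fun_power [intro]: "poly_fun m f \<Longrightarrow> poly_fun m (\<lambda>x. f x ^ k)"
  by (induction k) auto

lemma poly_fun_diff [intro]:
  assumes "poly_fun m f" "poly_fun m g"
  shows "poly_fun m (\<lambda>x. f x - g x)"
proof -
  have "poly_fun m (\<lambda>x. f x + (-1) * g x)"
    using assms by (intro poly_fun_add poly_fun_mult) auto
  then show ?thesis by simp
qed

lemma poly_fun_compose:
  assumes f: "poly_fun m f" and G: "\<And>i. i < m \<Longrightarrow> poly_fun k (\<lambda>x. G x $ i)"
    and carr: "\<And>x. x \<in> carrier_vec k \<Longrightarrow> G x \<in> carrier_vec m"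
  shows "poly_fun k (\<lambda>x. f (G x))"
proof -
  obtain E c where E: "finite E" "\<And>x. x \<in> carrier_vec m \<Longrightarrow> f x = (\<Sum>e\<in>E. c e * monomial_fun m e x)"
    using poly_funE[OF f] by blast
  have "poly_fun k (\<lambda>x. \<Sum>e\<in>E. c e * monomial_fun m e (G x))"
    unfolding monomial_fun_def
    by (intro poly_fun_sum poly_fun_mult poly_fun_prod poly_fun_power poly_fun_const) (auto intro: G)
  then show ?thesis by (rule poly_fun_cong) (simp add: E carr)
qed

text \<open>Restriction to a curve makes univariate arguments available. It is applied to lines
  joining two points and to coordinate lines through a chosen point.\<close>

lemma poly_fun_on_curve:
  assumes "poly_fun m f"
  obtains p where "\<And>t. poly p t = f (vec m (\<lambda>i. poly (c i) t))"
proof -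
  obtain E b where E: "finite E" "\<And>x. x \<in> carrier_vec m \<Longrightarrow> f x = (\<Sum>e\<in>E. b e * monomial_fun m e x)"
    using poly_funE[OF assms] by blast
  have "poly (\<Sum>e\<in>E. [:b e:] * (\<Prod>i<m. c i ^ e i)) t = f (vec m (\<lambda>i. poly (c i) t))" for t
    using E by (simp add: poly_sum poly_prod monomial_fun_def)
  then show thesis using that by blast
qed

lemma poly_fun_on_line:
  assumes "poly_fun m f" "a \<in> carrier_vec m" "b \<in> carrier_vec m"
  obtains p where "\<And>t. poly p t = f (a + t \<cdot>\<^sub>v b)"
proof -
  obtain p where p: "\<And>t. poly p t = f (vec m (\<lambda>i. poly [:a $ i, b $ i:] t))"
    using poly_fun_on_curve[OF assms(1), of "\<lambda>i. [:a $ i, b $ i:]"] by blast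
  have "vec m (\<lambda>i. poly [:a $ i, b $ i:] t) = a + t \<cdot>\<^sub>v b" for t
    using assms by (intro eq_vecI) auto
  with p that show thesis by metis
qed

lemma poly_eq_0_if_cofinite:
  fixes p q :: "'a::field_char_0 poly"
  assumes "q \<noteq> 0" "\<And>t. poly q t \<noteq> 0 \<Longrightarrow> poly p t = 0"
  shows "p = 0"
proof -
  have "poly (p * q) t = 0" for t using assms by auto
  then have "p * q = 0" using poly_all_0_iff_0 by blast
  then show ?thesis using assms by simp
qed

text \<open>Joining a point where \<open>p\<close> does not vanish to one where \<open>q\<close> does not vanish by a line
  reduces the density of Zariski-open sets to univariate polynomials.\<close>

lemma poly_fun_common_nonzero:
  fixes p q :: "'a::field_char_0 vec \<Rightarrow> 'a"
  assumes p: "poly_fun m p" "\<exists>x\<in>carrier_vec m. p x \<noteq> 0"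
    and q: "poly_fun m q" "\<exists>x\<in>carrier_vec m. q x \<noteq> 0"
  shows "\<exists>x\<in>carrier_vec m. p x \<noteq> 0 \<and> q x \<noteq> 0"
proof (rule ccontr)
  assume none: "\<not> ?thesis"
  obtain a b where ab: "a \<in> carrier_vec m" "p a \<noteq> 0" "b \<in> carrier_vec m" "q b \<noteq> 0"
    using assms by blast
  have ba: "b - a \<in> carrier_vec m" using ab by auto
  obtain P where P: "\<And>t. poly P t = p (a + t \<cdot>\<^sub>v (b - a))"
    using poly_fun_on_line[OF p(1) ab(1) ba] by blast
  obtain Q where Q: "\<And>t. poly Q t = q (a + t \<cdot>\<^sub>v (b - a))"
    using poly_fun_on_line[OF q(1) ab(1) ba] by blast
  have "a + 0 \<cdot>\<^sub>v (b - a) = a" "a + 1 \<cdot>\<^sub>v (b - a) = b"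
    using ab by (auto intro!: eq_vecI)
  then have "P \<noteq> 0" "Q \<noteq> 0" using P[of 0] Q[of 1] ab by auto
  moreover have "poly P t = 0" if "poly Q t \<noteq> 0" for t
  proof -
    have "a + t \<cdot>\<^sub>v (b - a) \<in> carrier_vec m" using ab by auto
    then show ?thesis using none that unfolding P Q by blast
  qed
  ultimately show False using poly_eq_0_if_cofinite by blast
qed

lemma poly_fun_zero_if_generic:
  fixes p q :: "'a::field_char_0 vec \<Rightarrow> 'a"
  assumes "poly_fun m p" "poly_fun m q" "\<exists>x\<in>carrier_vec m. q x \<noteq> 0"
    and "\<And>x. x \<in> carrier_vec m \<Longrightarrow> q x \<noteq> 0 \<Longrightarrow> p x = 0" and "x \<in> carrier_vec m"
  shows "p x = 0"
  using poly_fun_common_nonzero[OF assms(1) _ assms(2,3)] assms(4,5) by blast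

lemma poly_fun_eq_if_generic:
  fixes f g q :: "'a::field_char_0 vec \<Rightarrow> 'a"
  assumes "poly_fun m f" "poly_fun m g" "poly_fun m q" "\<exists>x\<in>carrier_vec m. q x \<noteq> 0"
    and "\<And>x. x \<in> carrier_vec m \<Longrightarrow> q x \<noteq> 0 \<Longrightarrow> f x = g x" and "x \<in> carrier_vec m"
  shows "f x = g x"
  using poly_fun_zero_if_generic[OF poly_fun_diff[OF assms(1,2)] assms(3,4) _ assms(6)] assms(5)
  by simp

lemma prod_coords_nonzero:
  "\<exists>x\<in>carrier_vec m. (\<Prod>i<m. x $ i) \<noteq> (0::'a::field)"
  by (rule bexI[of _ "vec m (\<lambda>_. 1)"]) auto

lemma poly_fun_prod_coords: "poly_fun m (\<lambda>x. \<Prod>i<m. x $ i)"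
  by (intro poly_fun_prod poly_fun_coord) auto

lemma monomial_fun_smult:
  assumes "x \<in> carrier_vec m"
  shows "monomial_fun m e (c \<cdot>\<^sub>v x) = c ^ (\<Sum>i<m. e i) * monomial_fun m e x"
proof -
  have "monomial_fun m e (c \<cdot>\<^sub>v x) = (\<Prod>i<m. c ^ e i * x $ i ^ e i)"
    unfolding monomial_fun_def using assms by (intro prod.cong) (auto simp: power_mult_distrib)
  then show ?thesis by (simp add: prod.distrib power_sum monomial_fun_def)
qed

text \<open>For the converse, compare the coefficients of \<open>t^d\<close> in \<open>f(t x) = t^d f(x)\<close>.\<close>

lemma homogeneous_poly_fun_iff:
  fixes f :: "'a::field_char_0 vec \<Rightarrow> 'a"
  shows "homogeneous_poly_fun m d f \<longleftrightarrow>
    poly_fun m f \<and> (\<forall>x\<in>carrier_vec m. \<forall>c. f (c \<cdot>\<^sub>v x) = c ^ d * f x)"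
proof (intro iffI conjI ballI allI)
  assume "homogeneous_poly_fun m d f"
  then obtain E :: "(nat \<Rightarrow> nat) set" and c where E: "finite E" "\<And>e. e \<in> E \<Longrightarrow> (\<Sum>i<m. e i) = d"
    "\<And>x. x \<in> carrier_vec m \<Longrightarrow> f x = (\<Sum>e\<in>E. c e * monomial_fun m e x)"
    unfolding homogeneous_poly_fun_def by blast
  show "poly_fun m f" using E(1,3) by (rule poly_funI)
  fix x :: "'a vec" and t :: 'a
  assume "x \<in> carrier_vec m"
  then show "f (t \<cdot>\<^sub>v x) = t ^ d * f x"
    by (simp add: E monomial_fun_smult sum_distrib_left mult_ac)
next
  assume *: "poly_fun m f \<and> (\<forall>x\<in>carrier_vec m. \<forall>c. f (c \<cdot>\<^sub>v x) = c ^ d * f x)"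
  obtain E c where E: "finite E" "\<And>x. x \<in> carrier_vec m \<Longrightarrow> f x = (\<Sum>e\<in>E. c e * monomial_fun m e x)"
    using * poly_funE by blast
  have "f x = (\<Sum>e\<in>{e\<in>E. (\<Sum>i<m. e i) = d}. c e * monomial_fun m e x)"
    if x: "x \<in> carrier_vec m" for x
  proof -
    define p where "p = (\<Sum>e\<in>E. monom (c e * monomial_fun m e x) (\<Sum>i<m. e i))"
    have "poly p t = poly (monom (f x) d) t" for t
    proof -
      have "poly p t = f (t \<cdot>\<^sub>v x)"
        using x unfolding p_def by (simp add: poly_sum poly_monom E monomial_fun_smult mult_ac)
      then show ?thesis using * x by (simp add: poly_monom mult_ac)
    qed
    then have "p = monom (f x) d" using poly_eq_poly_eq_iff by blast
    then have "coeff p d = f x" by simp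
    moreover have "coeff p d = (\<Sum>e\<in>{e\<in>E. (\<Sum>i<m. e i) = d}. c e * monomial_fun m e x)"
      unfolding p_def coeff_sum coeff_monom using E(1)
      by (auto simp: sum.inter_filter intro!: sum.cong)
    ultimately show ?thesis by simp
  qed
  then show "homogeneous_poly_fun m d f"
    unfolding homogeneous_poly_fun_def using E(1)
    by (intro exI[of _ "{e\<in>E. (\<Sum>i<m. e i) = d}"] exI[of _ c]) auto
qed

subsection \<open>Rational maps of projective space\<close>

text \<open>The 2x2 minors of (u, v) vanish. The zero vector is parallel to everything, so
  transitivity needs a nonzero middle vector.\<close>

definition parallel :: "nat \<Rightarrow> 'a::field vec \<Rightarrow> 'a vec \<Rightarrow> bool" where
  "parallel n u v \<longleftrightarrow> (\<forall>i\<le>n. \<forall>j\<le>n. u $ i * v $ j = u $ j * v $ i)"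

lemma same_rational_map_iff_parallel:
  "same_rational_map n F G \<longleftrightarrow> (\<forall>x\<in>carrier_vec (n + 1). parallel n (F x) (G x))"
  unfolding same_rational_map_def parallel_def by blast

lemma nonzero_vec_index:
  assumes "v \<in> carrier_vec (n + 1)" "v \<noteq> 0\<^sub>v (n + 1)"
  obtains k where "k \<le> n" "v $ k \<noteq> 0"
  using assms by (metis carrier_vecD eq_vecI index_zero_vec less_Suc_eq_le Suc_eq_plus1)

lemma parallel_trans:
  assumes v: "v \<in> carrier_vec (n + 1)" "v \<noteq> 0\<^sub>v (n + 1)"
    and uv: "parallel n u v" and vw: "parallel n v w"
  shows "parallel n u w"
  unfolding parallel_def
proof (intro allI impI)
  fix i j assume ij: "i \<le> n" "j \<le> n"
  obtain k where k: "k \<le> n" "v $ k \<noteq> 0" using nonzero_vec_index[OF v] .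
  \<comment> \<open>The square of a nonzero coordinate of the middle vector is inserted, so that
    every product can be regrouped into one pairing of u with v and one of v with w.\<close>
  have "v $ k * v $ k * (u $ i * w $ j) = (u $ i * v $ k) * (v $ k * w $ j)" by simp
  also have "\<dots> = (u $ k * v $ i) * (v $ j * w $ k)"
    using uv vw ij k unfolding parallel_def by metis
  also have "\<dots> = (u $ k * v $ j) * (v $ i * w $ k)" by simp
  also have "\<dots> = (u $ j * v $ k) * (v $ k * w $ i)"
    using uv vw ij k unfolding parallel_def by metis
  finally show "u $ i * w $ j = u $ j * w $ i" using k by simp
qed

lemma parallel_sym: "parallel n u v \<Longrightarrow> parallel n v u"
  unfolding parallel_def by (auto simp: mult.commute)

lemma parallel_smult:
  "v \<in> carrier_vec (n + 1) \<Longrightarrow> parallel n (c \<cdot>\<^sub>v v) v"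
  unfolding parallel_def by auto

lemma parallel_iff_smult:
  assumes u: "u \<in> carrier_vec (n + 1)" "u \<noteq> 0\<^sub>v (n + 1)"
    and v: "v \<in> carrier_vec (n + 1)" "v \<noteq> 0\<^sub>v (n + 1)"
  shows "parallel n u v \<longleftrightarrow> (\<exists>c. c \<noteq> 0 \<and> u = c \<cdot>\<^sub>v v)"
proof
  assume par: "parallel n u v"
  obtain k where k: "k \<le> n" "v $ k \<noteq> 0" using nonzero_vec_index[OF v] .
  have "u = (u $ k / v $ k) \<cdot>\<^sub>v v"
  proof (rule eq_vecI)
    fix i assume "i < dim_vec ((u $ k / v $ k) \<cdot>\<^sub>v v)"
    then have "i \<le> n" using v by auto
    then show "u $ i = ((u $ k / v $ k) \<cdot>\<^sub>v v) $ i"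
      using par k v unfolding parallel_def by (auto simp: field_simps)
  qed (use u v in auto)
  moreover have "u $ k / v $ k \<noteq> 0"
  proof
    assume "u $ k / v $ k = 0"
    then have "u = 0 \<cdot>\<^sub>v v" using \<open>u = (u $ k / v $ k) \<cdot>\<^sub>v v\<close> by metis
    then have "u = 0\<^sub>v (n + 1)" using v by auto
    then show False using u by simp
  qed
  ultimately show "\<exists>c. c \<noteq> 0 \<and> u = c \<cdot>\<^sub>v v" by blast
qed (use v parallel_smult in blast)

section \<open>Homogeneous tuples and equality of rational maps\<close>

lemma homogeneous_tupleI:
  fixes F :: "'a::field_char_0 vec \<Rightarrow> 'a vec"
  assumes "\<And>x. x \<in> carrier_vec (n + 1) \<Longrightarrow> F x \<in> carrier_vec (n + 1)"
    and "\<And>i. i \<le> n \<Longrightarrow> poly_fun (n + 1) (\<lambda>x. F x $ i)"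
    and "\<And>x c. x \<in> carrier_vec (n + 1) \<Longrightarrow> F (c \<cdot>\<^sub>v x) = c ^ d \<cdot>\<^sub>v F x"
    and "\<exists>x\<in>carrier_vec (n + 1). F x \<noteq> 0\<^sub>v (n + 1)"
  shows "homogeneous_tuple n F"
  unfolding homogeneous_tuple_def homogeneous_poly_fun_iff
proof (intro conjI ballI exI[of _ d] allI impI)
  fix i and x :: "'a vec" and c :: 'a assume "i \<le> n" and x: "x \<in> carrier_vec (n + 1)"
  then show "F (c \<cdot>\<^sub>v x) $ i = c ^ d * F x $ i"
    using assms(1)[OF x] assms(3)[OF x] by simp
qed (use assms in auto)

lemma homogeneous_tuple_carrier:
  "homogeneous_tuple n F \<Longrightarrow> x \<in> carrier_vec (n + 1) \<Longrightarrow> F x \<in> carrier_vec (n + 1)"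
  unfolding homogeneous_tuple_def by blast

lemma homogeneous_tuple_poly_fun:
  fixes F :: "'a::field_char_0 vec \<Rightarrow> 'a vec"
  shows "homogeneous_tuple n F \<Longrightarrow> i \<le> n \<Longrightarrow> poly_fun (n + 1) (\<lambda>x. F x $ i)"
  unfolding homogeneous_tuple_def homogeneous_poly_fun_iff by blast

lemma homogeneous_tuple_smult:
  fixes F :: "'a::field_char_0 vec \<Rightarrow> 'a vec"
  assumes "homogeneous_tuple n F"
  obtains d where "\<And>x c. x \<in> carrier_vec (n + 1) \<Longrightarrow> F (c \<cdot>\<^sub>v x) = c ^ d \<cdot>\<^sub>v F x"
proof -
  obtain d where d: "\<And>i x c. i \<le> n \<Longrightarrow> x \<in> carrier_vec (n + 1) \<Longrightarrow> F (c \<cdot>\<^sub>v x) $ i = c ^ d * F x $ i"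
    using assms unfolding homogeneous_tuple_def homogeneous_poly_fun_iff by blast
  have "F (c \<cdot>\<^sub>v x) = c ^ d \<cdot>\<^sub>v F x" if x: "x \<in> carrier_vec (n + 1)" for x c
    using d[OF _ x] homogeneous_tuple_carrier[OF assms x]
      homogeneous_tuple_carrier[OF assms, of "c \<cdot>\<^sub>v x"] x
    by (intro eq_vecI) auto
  then show thesis using that by blast
qed

lemma homogeneous_tuple_generic:
  fixes F :: "'a::field_char_0 vec \<Rightarrow> 'a vec"
  assumes "homogeneous_tuple n F"
  obtains q where "poly_fun (n + 1) q" "\<exists>x\<in>carrier_vec (n + 1). q x \<noteq> 0"
    "\<And>x. x \<in> carrier_vec (n + 1) \<Longrightarrow> q x \<noteq> 0 \<Longrightarrow> F x \<noteq> 0\<^sub>v (n + 1)"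
proof -
  obtain x where x: "x \<in> carrier_vec (n + 1)" "F x \<noteq> 0\<^sub>v (n + 1)"
    using assms unfolding homogeneous_tuple_def by blast
  obtain i where i: "i \<le> n" "F x $ i \<noteq> 0"
    using nonzero_vec_index[OF homogeneous_tuple_carrier[OF assms x(1)] x(2)] .
  show thesis
    by (rule that[OF homogeneous_tuple_poly_fun[OF assms i(1)]]) (use x i in auto)
qed

lemma generic_conj:
  fixes p q :: "'a::field_char_0 vec \<Rightarrow> 'a"
  assumes "poly_fun m p" "\<exists>x\<in>carrier_vec m. p x \<noteq> 0"
    and "poly_fun m q" "\<exists>x\<in>carrier_vec m. q x \<noteq> 0"
  shows "poly_fun m (\<lambda>x. p x * q x)" "\<exists>x\<in>carrier_vec m. p x * q x \<noteq> 0"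
  using assms poly_fun_common_nonzero[OF assms] by (auto intro: poly_fun_mult)

text \<open>The minors are polynomial functions, so their vanishing on a dense open set suffices.
  Most identities of rational maps below are checked in this way, at points where the
  representatives do not vanish.\<close>

lemma same_rational_map_generic:
  fixes F G :: "'a::field_char_0 vec \<Rightarrow> 'a vec"
  assumes "\<And>i. i \<le> n \<Longrightarrow> poly_fun (n + 1) (\<lambda>x. F x $ i)"
    and "\<And>i. i \<le> n \<Longrightarrow> poly_fun (n + 1) (\<lambda>x. G x $ i)"
    and "poly_fun (n + 1) q" "\<exists>x\<in>carrier_vec (n + 1). q x \<noteq> 0"
    and "\<And>x. x \<in> carrier_vec (n + 1) \<Longrightarrow> q x \<noteq> 0 \<Longrightarrow> parallel n (F x) (G x)"
  shows "same_rational_map n F G"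
  unfolding same_rational_map_def
proof (intro ballI allI impI)
  fix x :: "'a vec" and i j assume x: "x \<in> carrier_vec (n + 1)" and ij: "i \<le> n" "j \<le> n"
  show "F x $ i * G x $ j = F x $ j * G x $ i"
    by (rule poly_fun_eq_if_generic[OF _ _ assms(3,4) _ x])
      (use assms ij in \<open>auto simp: parallel_def\<close>)
qed

lemma same_rational_map_refl: "same_rational_map n F F"
  unfolding same_rational_map_def by (simp add: mult.commute)

lemma same_rational_map_sym: "same_rational_map n F G \<Longrightarrow> same_rational_map n G F"
  unfolding same_rational_map_iff_parallel using parallel_sym by blast

lemma same_rational_map_trans:
  fixes F G H :: "'a::field_char_0 vec \<Rightarrow> 'a vec"
  assumes "homogeneous_tuple n F" "homogeneous_tuple n G" "homogeneous_tuple n H"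
    and "same_rational_map n F G" "same_rational_map n G H"
  shows "same_rational_map n F H"
proof -
  obtain q where q: "poly_fun (n + 1) q" "\<exists>x\<in>carrier_vec (n + 1). q x \<noteq> 0"
    "\<And>x. x \<in> carrier_vec (n + 1) \<Longrightarrow> q x \<noteq> 0 \<Longrightarrow> G x \<noteq> 0\<^sub>v (n + 1)"
    using homogeneous_tuple_generic[OF assms(2)] by blast
  show ?thesis
    by (rule same_rational_map_generic[OF _ _ q(1,2)])
      (use assms q(3) in \<open>auto intro: homogeneous_tuple_poly_fun parallel_trans
         homogeneous_tuple_carrier simp: same_rational_map_iff_parallel simp del: One_nat_def add_Suc_right\<close>)
qed

lemma rational_map_of_eq_iff:
  fixes F G :: "'a::field_char_0 vec \<Rightarrow> 'a vec"
  assumes "homogeneous_tuple n F" "homogeneous_tuple n G"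
  shows "rational_map_of n F = rational_map_of n G \<longleftrightarrow> same_rational_map n F G"
proof
  assume "rational_map_of n F = rational_map_of n G"
  then have "G \<in> rational_map_of n F"
    using assms by (simp add: rational_map_of_def same_rational_map_refl)
  then show "same_rational_map n F G" by (simp add: rational_map_of_def)
next
  assume "same_rational_map n F G"
  then show "rational_map_of n F = rational_map_of n G"
    unfolding rational_map_of_def
    using same_rational_map_trans same_rational_map_sym assms by blast
qed

section \<open>Composition of homogeneous tuples\<close>

lemma homogeneous_tuple_comp:
  fixes F G :: "'a::field_char_0 vec \<Rightarrow> 'a vec"
  assumes F: "homogeneous_tuple n F" and G: "homogeneous_tuple n G"
    and "\<exists>x\<in>carrier_vec (n + 1). F (G x) \<noteq> 0\<^sub>v (n + 1)"
  shows "homogeneous_tuple n (F \<circ> G)"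
proof -
  obtain d where d: "\<And>x c. x \<in> carrier_vec (n + 1) \<Longrightarrow> F (c \<cdot>\<^sub>v x) = c ^ d \<cdot>\<^sub>v F x"
    using homogeneous_tuple_smult[OF F] by blast
  obtain e where e: "\<And>x c. x \<in> carrier_vec (n + 1) \<Longrightarrow> G (c \<cdot>\<^sub>v x) = c ^ e \<cdot>\<^sub>v G x"
    using homogeneous_tuple_smult[OF G] by blast
  show ?thesis
  proof (rule homogeneous_tupleI[where d = "e * d"])
    show "poly_fun (n + 1) (\<lambda>x. (F \<circ> G) x $ i)" if "i \<le> n" for i
      unfolding comp_def
      by (rule poly_fun_compose[OF homogeneous_tuple_poly_fun[OF F that]])
        (use homogeneous_tuple_poly_fun[OF G] homogeneous_tuple_carrier[OF G] in auto)
    show "(F \<circ> G) (c \<cdot>\<^sub>v x) = c ^ (e * d) \<cdot>\<^sub>v (F \<circ> G) x" if "x \<in> carrier_vec (n + 1)" for x c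
      using d[OF homogeneous_tuple_carrier[OF G that]] e[OF that] by (simp add: power_mult)
    show "(F \<circ> G) x \<in> carrier_vec (n + 1)" if "x \<in> carrier_vec (n + 1)" for x
      using homogeneous_tuple_carrier[OF F] homogeneous_tuple_carrier[OF G that] by simp
  qed (use assms in auto)
qed

text \<open>Where neither inner map vanishes, their values differ by a scalar c, which the outer map
  turns into c^d by homogeneity.\<close>

lemma same_rational_map_comp:
  fixes F G :: "'a::field_char_0 vec \<Rightarrow> 'a vec"
  assumes F: "homogeneous_tuple n F" and F': "homogeneous_tuple n F'"
    and G: "homogeneous_tuple n G" and G': "homogeneous_tuple n G'"
    and "same_rational_map n F F'" "same_rational_map n G G'"
  shows "same_rational_map n (F \<circ> G) (F' \<circ> G')"
proof -
  obtain p where p: "poly_fun (n + 1) p" "\<exists>x\<in>carrier_vec (n + 1). p x \<noteq> 0"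
    "\<And>x. x \<in> carrier_vec (n + 1) \<Longrightarrow> p x \<noteq> 0 \<Longrightarrow> G x \<noteq> 0\<^sub>v (n + 1)"
    using homogeneous_tuple_generic[OF G] by blast
  obtain q where q: "poly_fun (n + 1) q" "\<exists>x\<in>carrier_vec (n + 1). q x \<noteq> 0"
    "\<And>x. x \<in> carrier_vec (n + 1) \<Longrightarrow> q x \<noteq> 0 \<Longrightarrow> G' x \<noteq> 0\<^sub>v (n + 1)"
    using homogeneous_tuple_generic[OF G'] by blast
  obtain d where d: "\<And>x c. x \<in> carrier_vec (n + 1) \<Longrightarrow> F (c \<cdot>\<^sub>v x) = c ^ d \<cdot>\<^sub>v F x"
    using homogeneous_tuple_smult[OF F] by blast
  show ?thesis
  proof (rule same_rational_map_generic[OF _ _ generic_conj[OF p(1,2) q(1,2)]])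
    fix x :: "'a vec" assume x: "x \<in> carrier_vec (n + 1)" "p x * q x \<noteq> 0"
    have "G x \<noteq> 0\<^sub>v (n + 1)" "G' x \<noteq> 0\<^sub>v (n + 1)" using p(3) q(3) x by auto
    moreover have "parallel n (G x) (G' x)"
      using assms(6) x by (simp add: same_rational_map_iff_parallel)
    ultimately obtain c where c: "c \<noteq> 0" "G x = c \<cdot>\<^sub>v G' x"
      using parallel_iff_smult homogeneous_tuple_carrier x G G' by metis
    have G'x: "G' x \<in> carrier_vec (n + 1)" using homogeneous_tuple_carrier[OF G' x(1)] .
    then have "F (G x) = c ^ d \<cdot>\<^sub>v F (G' x)" by (simp only: c(2) d)
    moreover have "parallel n (F (G' x)) (F' (G' x))"
      using assms(5) G'x by (simp add: same_rational_map_iff_parallel)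
    ultimately show "parallel n ((F \<circ> G) x) ((F' \<circ> G') x)"
      using homogeneous_tuple_carrier[OF F G'x] by (simp add: parallel_def)
  next
    fix i assume i: "i \<le> n"
    show "poly_fun (n + 1) (\<lambda>x. (F \<circ> G) x $ i)"
      unfolding comp_def
      by (rule poly_fun_compose[OF homogeneous_tuple_poly_fun[OF F i]])
        (use homogeneous_tuple_poly_fun[OF G] homogeneous_tuple_carrier[OF G] in auto)
    show "poly_fun (n + 1) (\<lambda>x. (F' \<circ> G') x $ i)"
      unfolding comp_def
      by (rule poly_fun_compose[OF homogeneous_tuple_poly_fun[OF F' i]])
        (use homogeneous_tuple_poly_fun[OF G'] homogeneous_tuple_carrier[OF G'] in auto)
  qed
qed

lemma poly_fun_coord0: "poly_fun (n + 1) (\<lambda>x. x $ 0)" "\<exists>x\<in>carrier_vec (n + 1). x $ 0 \<noteq> (0::'a::field)"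
proof -
  show "\<exists>x\<in>carrier_vec (n + 1). x $ 0 \<noteq> (0::'a)"
    by (rule bexI[of _ "vec (n + 1) (\<lambda>_. 1)"]) auto
qed auto

lemma homogeneous_tuple_id: "homogeneous_tuple n (id :: 'a::field_char_0 vec \<Rightarrow> 'a vec)"
proof (rule homogeneous_tupleI[where d = 1])
  obtain x :: "'a vec" where x: "x \<in> carrier_vec (n + 1)" "x $ 0 \<noteq> 0"
    using poly_fun_coord0(2)[of n] by blast
  then have "x \<noteq> 0\<^sub>v (n + 1)" by auto
  then show "\<exists>x\<in>carrier_vec (n + 1). id x \<noteq> (0\<^sub>v (n + 1) :: 'a vec)"
    using x(1) by (intro bexI[of _ x]) (simp_all only: id_apply not_False_eq_True)
  show "poly_fun (n + 1) (\<lambda>x. id x $ i)" if "i \<le> n" for i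
    using poly_fun_coord[of i "n + 1"] that by simp
qed auto

lemma same_rational_map_id_generic:
  fixes F :: "'a::field_char_0 vec \<Rightarrow> 'a vec"
  assumes F: "homogeneous_tuple n F" and "same_rational_map n F id"
  obtains q where "poly_fun (n + 1) q" "\<exists>x\<in>carrier_vec (n + 1). q x \<noteq> 0"
    "\<And>x. x \<in> carrier_vec (n + 1) \<Longrightarrow> q x \<noteq> 0 \<Longrightarrow> \<exists>c. c \<noteq> 0 \<and> F x = c \<cdot>\<^sub>v x"
proof -
  obtain p where p: "poly_fun (n + 1) p" "\<exists>x\<in>carrier_vec (n + 1). p x \<noteq> 0"
    "\<And>x. x \<in> carrier_vec (n + 1) \<Longrightarrow> p x \<noteq> 0 \<Longrightarrow> F x \<noteq> 0\<^sub>v (n + 1)"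
    using homogeneous_tuple_generic[OF F] by blast
  show thesis
  proof (rule that[OF generic_conj[OF p(1,2) poly_fun_coord0]])
    fix x :: "'a vec" assume x: "x \<in> carrier_vec (n + 1)" "p x * x $ 0 \<noteq> 0"
    then have "x \<noteq> 0\<^sub>v (n + 1)" by auto
    moreover have "F x \<noteq> 0\<^sub>v (n + 1)" using p(3) x by auto
    moreover have "parallel n (F x) x"
      using assms(2) x by (simp add: same_rational_map_iff_parallel)
    ultimately show "\<exists>c. c \<noteq> 0 \<and> F x = c \<cdot>\<^sub>v x"
      using parallel_iff_smult homogeneous_tuple_carrier[OF F] x by metis
  qed
qed

section \<open>Birational tuples\<close>

lemma birational_tuple_homogeneous: "birational_tuple n F \<Longrightarrow> homogeneous_tuple n F"
  unfolding birational_tuple_def by blast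

lemma birational_tupleE:
  assumes "birational_tuple n F"
  obtains G where "birational_tuple n G"
    "homogeneous_tuple n (F \<circ> G)" "same_rational_map n (F \<circ> G) id"
    "homogeneous_tuple n (G \<circ> F)" "same_rational_map n (G \<circ> F) id"
  using assms unfolding birational_tuple_def by blast

text \<open>A birational map is dominant, so nothing can be composed with it to give zero.\<close>

lemma homogeneous_tuple_comp_birational:
  fixes F G :: "'a::field_char_0 vec \<Rightarrow> 'a vec"
  assumes F: "homogeneous_tuple n F" and G: "birational_tuple n G"
  shows "homogeneous_tuple n (F \<circ> G)"
proof (rule homogeneous_tuple_comp[OF F birational_tuple_homogeneous[OF G]])
  obtain H where H: "birational_tuple n H"
    "homogeneous_tuple n (G \<circ> H)" "same_rational_map n (G \<circ> H) id"
    using birational_tupleE[OF G] .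
  obtain q where q: "poly_fun (n + 1) q" "\<exists>x\<in>carrier_vec (n + 1). q x \<noteq> 0"
    "\<And>x. x \<in> carrier_vec (n + 1) \<Longrightarrow> q x \<noteq> 0 \<Longrightarrow> \<exists>c. c \<noteq> 0 \<and> (G \<circ> H) x = c \<cdot>\<^sub>v x"
    using same_rational_map_id_generic[OF H(2,3)] by blast
  obtain p where p: "poly_fun (n + 1) p" "\<exists>x\<in>carrier_vec (n + 1). p x \<noteq> 0"
    "\<And>x. x \<in> carrier_vec (n + 1) \<Longrightarrow> p x \<noteq> 0 \<Longrightarrow> F x \<noteq> 0\<^sub>v (n + 1)"
    using homogeneous_tuple_generic[OF F] by blast
  obtain d where d: "\<And>x c. x \<in> carrier_vec (n + 1) \<Longrightarrow> F (c \<cdot>\<^sub>v x) = c ^ d \<cdot>\<^sub>v F x"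
    using homogeneous_tuple_smult[OF F] by blast
  obtain x where x: "x \<in> carrier_vec (n + 1)" "p x \<noteq> 0" "q x \<noteq> 0"
    using poly_fun_common_nonzero[OF p(1,2) q(1,2)] by blast
  obtain c where c: "c \<noteq> 0" "G (H x) = c \<cdot>\<^sub>v x" using q(3) x by auto
  have Fx: "F x \<in> carrier_vec (n + 1)" using homogeneous_tuple_carrier[OF F x(1)] .
  obtain k where k: "k \<le> n" "F x $ k \<noteq> 0" using nonzero_vec_index[OF Fx p(3)] x by blast
  have "F (G (H x)) $ k \<noteq> 0" using c d[OF x(1)] k Fx by auto
  then have "F (G (H x)) \<noteq> 0\<^sub>v (n + 1)" using k by auto
  then show "\<exists>x\<in>carrier_vec (n + 1). F (G x) \<noteq> 0\<^sub>v (n + 1)"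
    using homogeneous_tuple_carrier[OF birational_tuple_homogeneous[OF H(1)] x(1)] by blast
qed

text \<open>Whether a composite vanishes identically depends only on the rational map inside, not on
  its representative. The product of \<open>Bir_proj\<close> runs over all representatives and
  relies on this.\<close>

lemma homogeneous_tuple_comp_same:
  fixes F G :: "'a::field_char_0 vec \<Rightarrow> 'a vec"
  assumes F: "homogeneous_tuple n F" and G: "homogeneous_tuple n G" and G': "homogeneous_tuple n G'"
    and FG: "homogeneous_tuple n (F \<circ> G)" and "same_rational_map n G G'"
  shows "homogeneous_tuple n (F \<circ> G')"
proof (rule homogeneous_tuple_comp[OF F G'])
  obtain p where p: "poly_fun (n + 1) p" "\<exists>x\<in>carrier_vec (n + 1). p x \<noteq> 0"
    "\<And>x. x \<in> carrier_vec (n + 1) \<Longrightarrow> p x \<noteq> 0 \<Longrightarrow> (F \<circ> G) x \<noteq> 0\<^sub>v (n + 1)"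
    using homogeneous_tuple_generic[OF FG] by blast
  obtain q where q: "poly_fun (n + 1) q" "\<exists>x\<in>carrier_vec (n + 1). q x \<noteq> 0"
    "\<And>x. x \<in> carrier_vec (n + 1) \<Longrightarrow> q x \<noteq> 0 \<Longrightarrow> G x \<noteq> 0\<^sub>v (n + 1)"
    using homogeneous_tuple_generic[OF G] by blast
  obtain r where r: "poly_fun (n + 1) r" "\<exists>x\<in>carrier_vec (n + 1). r x \<noteq> 0"
    "\<And>x. x \<in> carrier_vec (n + 1) \<Longrightarrow> r x \<noteq> 0 \<Longrightarrow> G' x \<noteq> 0\<^sub>v (n + 1)"
    using homogeneous_tuple_generic[OF G'] by blast
  obtain x where x: "x \<in> carrier_vec (n + 1)" "p x \<noteq> 0" "q x \<noteq> 0" "r x \<noteq> 0"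
    using poly_fun_common_nonzero[OF p(1,2) generic_conj[OF q(1,2) r(1,2)]] by auto
  have "parallel n (G x) (G' x)" using assms(5) x by (simp add: same_rational_map_iff_parallel)
  then obtain c where c: "c \<noteq> 0" "G x = c \<cdot>\<^sub>v G' x"
    using parallel_iff_smult homogeneous_tuple_carrier x G G' q(3) r(3) by metis
  obtain d where d: "\<And>x c. x \<in> carrier_vec (n + 1) \<Longrightarrow> F (c \<cdot>\<^sub>v x) = c ^ d \<cdot>\<^sub>v F x"
    using homogeneous_tuple_smult[OF F] by blast
  have "F (G x) = c ^ d \<cdot>\<^sub>v F (G' x)"
    using d[OF homogeneous_tuple_carrier[OF G' x(1)]] c by simp
  moreover have "F (G x) \<noteq> 0\<^sub>v (n + 1)" using p(3) x by simp
  ultimately have "F (G' x) \<noteq> 0\<^sub>v (n + 1)" by auto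
  then show "\<exists>x\<in>carrier_vec (n + 1). F (G' x) \<noteq> 0\<^sub>v (n + 1)" using x by blast
qed

lemma birational_tuple_comp:
  fixes F G :: "'a::field_char_0 vec \<Rightarrow> 'a vec"
  assumes F: "birational_tuple n F" and G: "birational_tuple n G"
  shows "birational_tuple n (F \<circ> G)"
proof -
  \<comment> \<open>Stated for arbitrary tuples, since it is applied twice: to F, G and, with the
    roles exchanged, to their inverses.\<close>
  have inverse: "homogeneous_tuple n ((F \<circ> G) \<circ> (G' \<circ> F')) \<and> same_rational_map n ((F \<circ> G) \<circ> (G' \<circ> F')) id"
    if F: "birational_tuple n F" and G: "birational_tuple n G"
      and F': "birational_tuple n F'" and G': "birational_tuple n G'"
      and FF': "homogeneous_tuple n (F \<circ> F')" "same_rational_map n (F \<circ> F') id"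
      and GG': "homogeneous_tuple n (G \<circ> G')" "same_rational_map n (G \<circ> G') id"
    for F G F' G' :: "'a vec \<Rightarrow> 'a vec"
  proof -
    note hom = birational_tuple_homogeneous homogeneous_tuple_comp_birational
    have *: "homogeneous_tuple n (F \<circ> ((G \<circ> G') \<circ> F'))"
      using hom(2)[OF hom(2)[OF hom(2)[OF hom(1)[OF F] G] G'] F'] by (simp add: comp_assoc)
    moreover have "same_rational_map n ((G \<circ> G') \<circ> F') (id \<circ> F')"
      using GG' same_rational_map_refl homogeneous_tuple_id hom(1)[OF F']
      by (intro same_rational_map_comp) auto
    then have "same_rational_map n (F \<circ> ((G \<circ> G') \<circ> F')) (F \<circ> F')"
      using same_rational_map_refl hom(1)[OF F] hom(1)[OF F'] hom(2)[OF GG'(1) F']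
      by (intro same_rational_map_comp) auto
    ultimately have "same_rational_map n (F \<circ> ((G \<circ> G') \<circ> F')) id"
      using same_rational_map_trans FF' homogeneous_tuple_id by blast
    with * show ?thesis by (simp add: comp_assoc)
  qed
  obtain F' where F': "birational_tuple n F'"
    "homogeneous_tuple n (F \<circ> F')" "same_rational_map n (F \<circ> F') id"
    "homogeneous_tuple n (F' \<circ> F)" "same_rational_map n (F' \<circ> F) id"
    using birational_tupleE[OF F] .
  obtain G' where G': "birational_tuple n G'"
    "homogeneous_tuple n (G \<circ> G')" "same_rational_map n (G \<circ> G') id"
    "homogeneous_tuple n (G' \<circ> G)" "same_rational_map n (G' \<circ> G) id"
    using birational_tupleE[OF G] .
  note hom = homogeneous_tuple_comp_birational[OF birational_tuple_homogeneous]
  show ?thesis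
    unfolding birational_tuple_def
    using inverse[OF F G F'(1) G'(1) F'(2,3) G'(2,3)] inverse[OF G'(1) F'(1) G F G'(4,5) F'(4,5)]
      hom[OF F G] hom[OF G'(1) F'(1)]
    by (intro conjI exI[of _ "G' \<circ> F'"]) simp_all
qed

lemma birational_tuple_id: "birational_tuple n (id :: 'a::field_char_0 vec \<Rightarrow> 'a vec)"
  unfolding birational_tuple_def
  using homogeneous_tuple_id same_rational_map_refl[of n id]
  by (intro conjI exI[of _ id]) simp_all

text \<open>Inverse maps need to be checked only at general points and up to a scalar. A point with
  x_0 \<noteq> 0 then shows that the composites do not vanish identically.\<close>

lemma birational_tupleI:
  fixes F G :: "'a::field_char_0 vec \<Rightarrow> 'a vec"
  assumes F: "homogeneous_tuple n F" and G: "homogeneous_tuple n G"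
    and p: "poly_fun (n + 1) p" "\<exists>x\<in>carrier_vec (n + 1). p x \<noteq> 0"
    and FG: "\<And>x. x \<in> carrier_vec (n + 1) \<Longrightarrow> p x \<noteq> 0 \<Longrightarrow> \<exists>c. c \<noteq> 0 \<and> F (G x) = c \<cdot>\<^sub>v x"
    and q: "poly_fun (n + 1) q" "\<exists>x\<in>carrier_vec (n + 1). q x \<noteq> 0"
    and GF: "\<And>x. x \<in> carrier_vec (n + 1) \<Longrightarrow> q x \<noteq> 0 \<Longrightarrow> \<exists>c. c \<noteq> 0 \<and> G (F x) = c \<cdot>\<^sub>v x"
  shows "birational_tuple n F"
proof -
  have *: "homogeneous_tuple n (F \<circ> G) \<and> same_rational_map n (F \<circ> G) id"
    if F: "homogeneous_tuple n F" and G: "homogeneous_tuple n G"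
      and p: "poly_fun (n + 1) p" "\<exists>x\<in>carrier_vec (n + 1). p x \<noteq> 0"
      and FG: "\<And>x. x \<in> carrier_vec (n + 1) \<Longrightarrow> p x \<noteq> 0 \<Longrightarrow> \<exists>c. c \<noteq> 0 \<and> F (G x) = c \<cdot>\<^sub>v x"
    for F G :: "'a vec \<Rightarrow> 'a vec" and p
  proof
    obtain x where x: "x \<in> carrier_vec (n + 1)" "p x \<noteq> 0" "x $ 0 \<noteq> 0"
      using poly_fun_common_nonzero[OF p poly_fun_coord0] by blast
    obtain c where c: "c \<noteq> 0" "F (G x) = c \<cdot>\<^sub>v x" using FG x by blast
    have "F (G x) $ 0 \<noteq> 0" using c x by simp
    then have "F (G x) \<noteq> 0\<^sub>v (n + 1)" by auto
    then show FG': "homogeneous_tuple n (F \<circ> G)"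
      using homogeneous_tuple_comp[OF F G] x by blast
    show "same_rational_map n (F \<circ> G) id"
      by (rule same_rational_map_generic[OF homogeneous_tuple_poly_fun[OF FG']
            homogeneous_tuple_poly_fun[OF homogeneous_tuple_id] p])
        (use FG in \<open>force simp: parallel_def\<close>)+
  qed
  show ?thesis
    unfolding birational_tuple_def using F G *[OF F G p FG] *[OF G F q GF]
    by (intro conjI exI[of _ G]) simp_all
qed

subsection \<open>The Cremona group\<close>

lemma Bir_proj_simps [simp]:
  "carrier (Bir_proj n) = {rational_map_of n F | F. birational_tuple n F}"
  "\<one>\<^bsub>Bir_proj n\<^esub> = rational_map_of n id"
  unfolding Bir_proj_def by auto

text \<open>The union over all pairs of representatives collapses, because all their composites
  define one and the same class.\<close>

lemma Bir_proj_mult: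
  fixes F G :: "'a::field_char_0 vec \<Rightarrow> 'a vec"
  assumes F: "birational_tuple n F" and G: "birational_tuple n G"
  shows "rational_map_of n F \<otimes>\<^bsub>Bir_proj n\<^esub> rational_map_of n G = rational_map_of n (F \<circ> G)"
proof -
  note hF = birational_tuple_homogeneous[OF F] and hG = birational_tuple_homogeneous[OF G]
  have "rational_map_of n (F' \<circ> G') = rational_map_of n (F \<circ> G)"
    if "F' \<in> rational_map_of n F" "G' \<in> rational_map_of n G" for F' G'
  proof -
    have F': "homogeneous_tuple n F'" "same_rational_map n F F'"
      and G': "homogeneous_tuple n G'" "same_rational_map n G G'"
      using that by (auto simp: rational_map_of_def)
    have "homogeneous_tuple n (F' \<circ> G')"
      using homogeneous_tuple_comp_same[OF F'(1) hG G'(1) _ G'(2)]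
        homogeneous_tuple_comp_birational[OF F'(1) G] by blast
    moreover have "homogeneous_tuple n (F \<circ> G)"
      using homogeneous_tuple_comp_birational[OF hF G] .
    ultimately show ?thesis
      using same_rational_map_comp[OF hF F'(1) hG G'(1) F'(2) G'(2)] rational_map_of_eq_iff by metis
  qed
  moreover have "F \<in> rational_map_of n F" "G \<in> rational_map_of n G"
    using hF hG by (auto simp: rational_map_of_def same_rational_map_refl)
  ultimately have "(\<Union>F'\<in>rational_map_of n F. \<Union>G'\<in>rational_map_of n G. rational_map_of n (F' \<circ> G'))
    = rational_map_of n (F \<circ> G)"
    by blast
  then show ?thesis by (simp add: Bir_proj_def)
qed

lemma group_Bir_proj: "group (Bir_proj n :: 'a::field_char_0 rational_map monoid)"
proof (rule groupI)
  show "\<one>\<^bsub>Bir_proj n\<^esub> \<in> carrier (Bir_proj n :: 'a rational_map monoid)"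
    using birational_tuple_id by auto
  fix f g h :: "'a rational_map"
  assume f: "f \<in> carrier (Bir_proj n)"
  then obtain F where F: "birational_tuple n F" "f = rational_map_of n F" by auto
  show "\<one>\<^bsub>Bir_proj n\<^esub> \<otimes>\<^bsub>Bir_proj n\<^esub> f = f"
    unfolding F(2) Bir_proj_simps(2) Bir_proj_mult[OF birational_tuple_id F(1)] by simp
  obtain F' where F': "birational_tuple n F'"
    "homogeneous_tuple n (F' \<circ> F)" "same_rational_map n (F' \<circ> F) id"
    using birational_tupleE[OF F(1)] .
  then have "rational_map_of n F' \<otimes>\<^bsub>Bir_proj n\<^esub> f = \<one>\<^bsub>Bir_proj n\<^esub>"
    unfolding F(2) Bir_proj_simps(2) Bir_proj_mult[OF F'(1) F(1)]
    using rational_map_of_eq_iff[OF F'(2) homogeneous_tuple_id] by blast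
  moreover have "rational_map_of n F' \<in> carrier (Bir_proj n)" using F'(1) by auto
  ultimately show "\<exists>g\<in>carrier (Bir_proj n). g \<otimes>\<^bsub>Bir_proj n\<^esub> f = \<one>\<^bsub>Bir_proj n\<^esub>" by blast
  assume "g \<in> carrier (Bir_proj n)"
  then obtain G where G: "birational_tuple n G" "g = rational_map_of n G" by auto
  show "f \<otimes>\<^bsub>Bir_proj n\<^esub> g \<in> carrier (Bir_proj n)"
    unfolding F(2) G(2) Bir_proj_mult[OF F(1) G(1)] using birational_tuple_comp[OF F(1) G(1)] by auto
  assume "h \<in> carrier (Bir_proj n)"
  then obtain H where H: "birational_tuple n H" "h = rational_map_of n H" by auto
  show "f \<otimes>\<^bsub>Bir_proj n\<^esub> g \<otimes>\<^bsub>Bir_proj n\<^esub> h = f \<otimes>\<^bsub>Bir_proj n\<^esub> (g \<otimes>\<^bsub>Bir_proj n\<^esub> h)"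
    using F(1) G(1) H(1) unfolding F(2) G(2) H(2)
    by (simp add: Bir_proj_mult birational_tuple_comp comp_assoc del: Bir_proj_simps)
qed

lemma (in group) conj_by_iff:
  assumes "\<phi> \<in> carrier G" "g \<in> carrier G" "h \<in> carrier G"
  shows "conj_by G \<phi> g h \<longleftrightarrow> \<phi> \<otimes> g = h \<otimes> \<phi>"
  unfolding conj_by_def using assms by (metis inv_solve_right' m_closed)

lemma (in group) conjugate_in_sym:
  assumes "conjugate_in G g h" "g \<in> carrier G" "h \<in> carrier G"
  shows "conjugate_in G h g"
proof -
  obtain \<phi> where \<phi>: "\<phi> \<in> carrier G" "\<phi> \<otimes> g = h \<otimes> \<phi>"
    using assms conj_by_iff unfolding conjugate_in_def by blast
  then have "inv \<phi> \<otimes> h = g \<otimes> inv \<phi>"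
    using assms by (metis inv_closed inv_solve_left inv_solve_right m_assoc m_closed)
  then show ?thesis
    using \<phi> assms conj_by_iff[of "inv \<phi>"] unfolding conjugate_in_def by blast
qed

lemma (in group) conjugate_in_trans:
  assumes "conjugate_in G g h" "conjugate_in G h k"
    and "g \<in> carrier G" "h \<in> carrier G" "k \<in> carrier G"
  shows "conjugate_in G g k"
proof -
  obtain \<phi> where \<phi>: "\<phi> \<in> carrier G" "\<phi> \<otimes> g = h \<otimes> \<phi>"
    using assms conj_by_iff unfolding conjugate_in_def by blast
  obtain \<psi> where \<psi>: "\<psi> \<in> carrier G" "\<psi> \<otimes> h = k \<otimes> \<psi>"
    using assms conj_by_iff unfolding conjugate_in_def by blast
  have "(\<psi> \<otimes> \<phi>) \<otimes> g = k \<otimes> (\<psi> \<otimes> \<phi>)"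
    using \<phi> \<psi> assms by (metis m_assoc)
  then show ?thesis
    using \<phi> \<psi> assms conj_by_iff[of "\<psi> \<otimes> \<phi>"] unfolding conjugate_in_def by blast
qed

lemma conj_by_Bir_proj_iff:
  fixes F P Q :: "'a::field_char_0 vec \<Rightarrow> 'a vec"
  assumes F: "birational_tuple n F" and P: "birational_tuple n P" and Q: "birational_tuple n Q"
  shows "conj_by (Bir_proj n) (rational_map_of n F) (rational_map_of n P) (rational_map_of n Q)
    \<longleftrightarrow> same_rational_map n (F \<circ> P) (Q \<circ> F)"
proof -
  have "rational_map_of n F \<in> carrier (Bir_proj n)" "rational_map_of n P \<in> carrier (Bir_proj n)"
    "rational_map_of n Q \<in> carrier (Bir_proj n)" using assms by auto
  from group.conj_by_iff[OF group_Bir_proj this] show ?thesis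
    using assms by (simp add: Bir_proj_mult rational_map_of_eq_iff birational_tuple_comp
        birational_tuple_homogeneous)
qed

lemma conjugate_in_Bir_proj_iff:
  fixes P Q :: "'a::field_char_0 vec \<Rightarrow> 'a vec"
  assumes P: "birational_tuple n P" and Q: "birational_tuple n Q"
  shows "conjugate_in (Bir_proj n) (rational_map_of n P) (rational_map_of n Q)
    \<longleftrightarrow> (\<exists>F. birational_tuple n F \<and> same_rational_map n (F \<circ> P) (Q \<circ> F))"
  unfolding conjugate_in_def using conj_by_Bir_proj_iff[OF _ P Q] by auto

subsection \<open>Linear maps\<close>

lemma mult_mat_vec_eq_sum:
  assumes "M \<in> carrier_mat m k" "x \<in> carrier_vec k" "i < m"
  shows "(M *\<^sub>v x) $ i = (\<Sum>j<k. M $$ (i, j) * x $ j)"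
  using assms by (auto simp: scalar_prod_def lessThan_atLeast0 intro!: sum.cong)

lemma GL_mat_inverse:
  assumes "M \<in> GL_mat m"
  obtains N where "N \<in> GL_mat m" "M * N = 1\<^sub>m m" "N * M = 1\<^sub>m m"
proof -
  have M: "M \<in> carrier_mat m m" using assms by (simp add: GL_mat_def)
  obtain N where N: "M * N = 1\<^sub>m m" "N * M = 1\<^sub>m (dim_row N)"
    using assms M unfolding GL_mat_def invertible_mat_def inverts_mat_def by auto
  have "dim_col N = m" using arg_cong[OF N(1), of dim_col] by simp
  moreover have "dim_row N = m" using arg_cong[OF N(2), of dim_col] M by simp
  ultimately have "N \<in> carrier_mat m m" by auto
  then show thesis using that[of N] M N unfolding GL_mat_def invertible_mat_def inverts_mat_def by auto
qed

lemma GL_matI: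
  assumes "M \<in> carrier_mat m m" "N \<in> carrier_mat m m" "M * N = 1\<^sub>m m" "N * M = 1\<^sub>m m"
  shows "M \<in> GL_mat m"
  using assms unfolding GL_mat_def invertible_mat_def inverts_mat_def by auto

lemma birational_tuple_linear:
  fixes M :: "'a::field_char_0 mat"
  assumes "M \<in> GL_mat (n + 1)"
  shows "birational_tuple n (\<lambda>x. M *\<^sub>v x)"
proof -
  have hom: "homogeneous_tuple n (\<lambda>x. M *\<^sub>v x)" if M: "M \<in> GL_mat (n + 1)" for M :: "'a mat"
  proof (rule homogeneous_tupleI[where d = 1])
    have carr: "M \<in> carrier_mat (n + 1) (n + 1)" using M by (simp add: GL_mat_def)
    then show "M *\<^sub>v x \<in> carrier_vec (n + 1)" if "x \<in> carrier_vec (n + 1)" for x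
      using that by simp
    show "M *\<^sub>v (c \<cdot>\<^sub>v x) = c ^ 1 \<cdot>\<^sub>v (M *\<^sub>v x)" if "x \<in> carrier_vec (n + 1)" for x c
      using mult_mat_vec[OF carr that] by simp
    show "poly_fun (n + 1) (\<lambda>x. (M *\<^sub>v x) $ i)" if "i \<le> n" for i
    proof (rule poly_fun_cong)
      show "poly_fun (n + 1) (\<lambda>x. \<Sum>j<n + 1. M $$ (i, j) * x $ j)"
        by (intro poly_fun_sum poly_fun_mult poly_fun_const poly_fun_coord) auto
      show "(\<Sum>j<n + 1. M $$ (i, j) * x $ j) = (M *\<^sub>v x) $ i" if "x \<in> carrier_vec (n + 1)" for x
        using mult_mat_vec_eq_sum[OF carr that, of i] \<open>i \<le> n\<close> by simp
    qed
    obtain N where N: "N \<in> GL_mat (n + 1)" "M * N = 1\<^sub>m (n + 1)" using GL_mat_inverse[OF M] .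
    obtain x :: "'a vec" where x: "x \<in> carrier_vec (n + 1)" "x $ 0 \<noteq> 0"
      using poly_fun_coord0(2)[of n] by blast
    have "M *\<^sub>v (N *\<^sub>v x) = x"
      using assoc_mult_mat_vec[OF carr _ x(1), of N] N x by (simp add: GL_mat_def)
    then show "\<exists>x\<in>carrier_vec (n + 1). M *\<^sub>v x \<noteq> 0\<^sub>v (n + 1)"
      using x N by (intro bexI[of _ "N *\<^sub>v x"]) (auto simp: GL_mat_def)
  qed
  obtain N where N: "N \<in> GL_mat (n + 1)" "M * N = 1\<^sub>m (n + 1)" "N * M = 1\<^sub>m (n + 1)"
    using GL_mat_inverse[OF assms] .
  have MN: "M *\<^sub>v (N *\<^sub>v x) = x" "N *\<^sub>v (M *\<^sub>v x) = x" if "x \<in> carrier_vec (n + 1)" for x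
    using assms N that assoc_mult_mat_vec[of M "n+1" "n+1" N "n+1" x]
      assoc_mult_mat_vec[of N "n+1" "n+1" M "n+1" x]
    by (auto simp: GL_mat_def)
  show ?thesis
    by (rule birational_tupleI[OF hom[OF assms] hom[OF N(1)] poly_fun_coord0 _ poly_fun_coord0])
      (use MN in \<open>auto intro!: exI[of _ 1]\<close>)
qed

lemma Aut_proj_subset: "(Aut_proj n :: 'a::field_char_0 rational_map set) \<subseteq> carrier (Bir_proj n)"
  unfolding Aut_proj_def using birational_tuple_linear by auto

subsection \<open>Monomial actions\<close>

lemma prod_powi: "(\<Prod>i\<in>I. f i) powi k = (\<Prod>i\<in>I. (f i :: 'a::field) powi k)"
  by (induction I rule: infinite_finite_induct) (auto simp: power_int_mult_distrib)

lemma powi_sum: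
  "x \<noteq> 0 \<Longrightarrow> x powi (\<Sum>i\<in>I. f i) = (\<Prod>i\<in>I. (x :: 'a::field) powi f i)"
  by (induction I rule: infinite_finite_induct) (auto simp: power_int_add)

lemma torus_carrier: "\<mu> \<in> torus m \<Longrightarrow> \<mu> \<in> carrier_vec m"
  by (simp add: torus_def)

lemma torus_nonzero: "\<mu> \<in> torus m \<Longrightarrow> i < m \<Longrightarrow> \<mu> $ i \<noteq> 0"
  by (simp add: torus_def)

lemma monomial_act_index:
  "A \<in> carrier_mat m k \<Longrightarrow> i < m \<Longrightarrow> monomial_act A \<mu> $ i = (\<Prod>j<k. \<mu> $ j powi (A $$ (i, j)))"
  by (auto simp: monomial_act_def)

lemma monomial_act_dim [simp]: "dim_vec (monomial_act A \<mu>) = dim_row A"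
  by (simp add: monomial_act_def)

lemma monomial_act_torus:
  "A \<in> carrier_mat m k \<Longrightarrow> \<mu> \<in> torus k \<Longrightarrow> monomial_act A \<mu> \<in> torus m"
  by (auto simp: torus_def monomial_act_def power_int_not_zero)

text \<open>The torus matters: \<open>powi\<close> gives 0 at base 0 for negative exponents, so
  exponents add only at nonzero bases.\<close>

lemma monomial_act_mult:
  assumes A: "A \<in> carrier_mat m k" and B: "B \<in> carrier_mat k l" and \<mu>: "\<mu> \<in> torus l"
  shows "monomial_act (A * B) \<mu> = monomial_act A (monomial_act B \<mu>)"
proof (rule eq_vecI)
  fix i assume "i < dim_vec (monomial_act A (monomial_act B \<mu>))"
  then have i: "i < m" using A by simp
  have "monomial_act (A * B) \<mu> $ i = (\<Prod>h<l. \<mu> $ h powi (\<Sum>j<k. A $$ (i, j) * B $$ (j, h)))"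
    using A B i by (subst monomial_act_index[of _ m l])
      (auto simp: scalar_prod_def lessThan_atLeast0 intro!: prod.cong sum.cong arg_cong2[of _ _ _ _ "(powi)"])
  also have "\<dots> = (\<Prod>h<l. \<Prod>j<k. (\<mu> $ h powi B $$ (j, h)) powi A $$ (i, j))"
    using \<mu> by (intro prod.cong refl)
      (simp add: powi_sum torus_nonzero mult.commute flip: power_int_mult)
  also have "\<dots> = (\<Prod>j<k. (\<Prod>h<l. \<mu> $ h powi B $$ (j, h)) powi A $$ (i, j))"
    by (subst prod.swap) (simp add: prod_powi)
  also have "\<dots> = monomial_act A (monomial_act B \<mu>) $ i"
    using B by (subst monomial_act_index[OF A i]) (auto simp: monomial_act_index intro!: prod.cong)
  finally show "monomial_act (A * B) \<mu> $ i = monomial_act A (monomial_act B \<mu>) $ i" .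
qed (use A in auto)

lemma prod_powi_delta:
  "i < (m::nat) \<Longrightarrow> (\<Prod>j<m. \<mu> j powi (if i = j then c else 0)) = (\<mu> i :: 'a::field) powi c"
  by (subst prod.remove[of "{..<m}" i]) (auto intro!: prod.neutral)

lemma monomial_act_one:
  assumes "\<mu> \<in> carrier_vec m"
  shows "monomial_act (1\<^sub>m m) \<mu> = \<mu>"
proof (rule eq_vecI)
  fix i assume "i < dim_vec \<mu>"
  then have i: "i < m" using assms by simp
  have "monomial_act (1\<^sub>m m) \<mu> $ i = (\<Prod>j<m. \<mu> $ j powi (if i = j then 1 else 0))"
    using i by (subst monomial_act_index[of _ m m]) (auto intro!: prod.cong)
  then show "monomial_act (1\<^sub>m m) \<mu> $ i = \<mu> $ i"
    using i by (simp only: prod_powi_delta power_int_1_right)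
qed (use assms in auto)

text \<open>Monomial maps are multiplicative. Hence they intertwine multiplication by \<mu> with
  multiplication by the image of \<mu>, which is the equivariance behind \<open>T_map\<close> and
  \<open>S_map\<close>.\<close>

lemma monomial_act_times:
  assumes "A \<in> carrier_mat m k" "i < m"
  shows "monomial_act A (vec k (\<lambda>j. u $ j * v $ j)) $ i = monomial_act A u $ i * monomial_act A v $ i"
  using assms by (simp add: monomial_act_index power_int_mult_distrib prod.distrib)

lemma GL_mat_carrier: "A \<in> GL_mat m \<Longrightarrow> A \<in> carrier_mat m m"
  by (simp add: GL_mat_def)

lemma GL_mat_mult: "A \<in> GL_mat m \<Longrightarrow> B \<in> GL_mat m \<Longrightarrow> A * B \<in> GL_mat m"
proof -
  assume A: "A \<in> GL_mat m" and B: "B \<in> GL_mat m"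
  obtain A' where A': "A' \<in> GL_mat m" "A * A' = 1\<^sub>m m" "A' * A = 1\<^sub>m m" using GL_mat_inverse[OF A] .
  obtain B' where B': "B' \<in> GL_mat m" "B * B' = 1\<^sub>m m" "B' * B = 1\<^sub>m m" using GL_mat_inverse[OF B] .
  note carr = GL_mat_carrier[OF A] GL_mat_carrier[OF B] GL_mat_carrier[OF A'(1)] GL_mat_carrier[OF B'(1)]
  have *: "(P * Q) * (Q' * P') = 1\<^sub>m m"
    if "P \<in> carrier_mat m m" "Q \<in> carrier_mat m m" "P' \<in> carrier_mat m m" "Q' \<in> carrier_mat m m"
      "P * P' = 1\<^sub>m m" "Q * Q' = 1\<^sub>m m" for P Q P' Q' :: "'a mat"
  proof -
    have "(P * Q) * (Q' * P') = P * (Q * (Q' * P'))" using that by (intro assoc_mult_mat) auto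
    also have "Q * (Q' * P') = (Q * Q') * P'" using that by (intro assoc_mult_mat[symmetric]) auto
    finally show ?thesis using that by simp
  qed
  show ?thesis
    by (rule GL_matI[OF _ _ *[OF carr A'(2) B'(2)] *[OF carr(4,3,2,1) B'(3) A'(3)]]) (use carr in auto)
qed

lemma GL_mat_one: "1\<^sub>m m \<in> GL_mat m"
  by (rule GL_matI[of _ _ "1\<^sub>m m"]) auto

subsection \<open>Maps given in the chart\<close>

lemma chart0_inv_carrier: "chart0_inv n y \<in> carrier_vec (n + 1)"
  by (simp add: chart0_inv_def)

lemma chart0_carrier: "chart0 n x \<in> carrier_vec n"
  by (simp add: chart0_def)

lemma chart0_inv_chart0:
  assumes "x \<in> carrier_vec (n + 1)" "x $ 0 \<noteq> 0"
  shows "x = x $ 0 \<cdot>\<^sub>v chart0_inv n (chart0 n x)"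
proof (rule eq_vecI)
  fix i assume "i < dim_vec (x $ 0 \<cdot>\<^sub>v chart0_inv n (chart0 n x))"
  then have "i < n + 1" by (simp add: chart0_inv_def)
  then show "x $ i = (x $ 0 \<cdot>\<^sub>v chart0_inv n (chart0 n x)) $ i"
    using assms by (cases i) (auto simp: chart0_inv_def chart0_def)
qed (use assms in \<open>auto simp: chart0_inv_def\<close>)

lemma poly_fun_chart0_inv:
  assumes "poly_fun (n + 1) f"
  shows "poly_fun n (\<lambda>y. f (chart0_inv n y))"
proof (rule poly_fun_compose[OF assms])
  fix i assume "i < n + 1"
  then show "poly_fun n (\<lambda>y. chart0_inv n y $ i)"
    by (cases i) (auto simp: chart0_inv_def intro: poly_fun_coord)
qed (rule chart0_inv_carrier)

lemma homogeneous_tuple_via_chart: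
  fixes F :: "'a::field_char_0 vec \<Rightarrow> 'a vec"
  assumes F: "homogeneous_tuple n F"
  obtains d where "\<And>x. x \<in> carrier_vec (n + 1) \<Longrightarrow> x $ 0 \<noteq> 0 \<Longrightarrow>
    F x = (x $ 0) ^ d \<cdot>\<^sub>v F (chart0_inv n (chart0 n x))"
proof -
  obtain d where d: "\<And>x c. x \<in> carrier_vec (n + 1) \<Longrightarrow> F (c \<cdot>\<^sub>v x) = c ^ d \<cdot>\<^sub>v F x"
    using homogeneous_tuple_smult[OF F] by blast
  have "F x = (x $ 0) ^ d \<cdot>\<^sub>v F (chart0_inv n (chart0 n x))"
    if "x \<in> carrier_vec (n + 1)" "x $ 0 \<noteq> 0" for x
    using arg_cong[OF chart0_inv_chart0[OF that], of F]
    unfolding d[OF chart0_inv_carrier] .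
  then show thesis using that by blast
qed

lemma homogeneous_tuple_chart:
  fixes F :: "'a::field_char_0 vec \<Rightarrow> 'a vec"
  assumes F: "homogeneous_tuple n F" and "i \<le> n" "\<exists>x\<in>carrier_vec (n + 1). F x $ i \<noteq> 0"
  shows "\<exists>y\<in>carrier_vec n. F (chart0_inv n y) $ i \<noteq> 0"
proof -
  obtain x where x: "x \<in> carrier_vec (n + 1)" "F x $ i \<noteq> 0" "x $ 0 \<noteq> 0"
    using poly_fun_common_nonzero[OF homogeneous_tuple_poly_fun[OF F assms(2)] assms(3) poly_fun_coord0]
    by blast
  obtain d where d: "\<And>x. x \<in> carrier_vec (n + 1) \<Longrightarrow> x $ 0 \<noteq> 0 \<Longrightarrow>
    F x = (x $ 0) ^ d \<cdot>\<^sub>v F (chart0_inv n (chart0 n x))"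
    using homogeneous_tuple_via_chart[OF F] by blast
  let ?y = "chart0 n x"
  have "F x = (x $ 0) ^ d \<cdot>\<^sub>v F (chart0_inv n ?y)"
    using d[OF x(1,3)] .
  then have "F (chart0_inv n ?y) $ i \<noteq> 0"
    using x(2) assms(2) homogeneous_tuple_carrier[OF F chart0_inv_carrier, of ?y] by auto
  then show ?thesis using chart0_carrier by blast
qed

lemma same_rational_map_chart:
  fixes F G :: "'a::field_char_0 vec \<Rightarrow> 'a vec"
  assumes F: "homogeneous_tuple n F" and G: "homogeneous_tuple n G"
    and p: "poly_fun n p" "\<exists>y\<in>carrier_vec n. p y \<noteq> 0"
    and par: "\<And>y. y \<in> carrier_vec n \<Longrightarrow> p y \<noteq> 0 \<Longrightarrow> parallel n (F (chart0_inv n y)) (G (chart0_inv n y))"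
  shows "same_rational_map n F G"
proof (rule same_rational_map_generic[OF _ _ poly_fun_coord0])
  fix x :: "'a vec" assume x: "x \<in> carrier_vec (n + 1)" "x $ 0 \<noteq> 0"
  obtain d where d: "\<And>x. x \<in> carrier_vec (n + 1) \<Longrightarrow> x $ 0 \<noteq> 0 \<Longrightarrow>
    F x = (x $ 0) ^ d \<cdot>\<^sub>v F (chart0_inv n (chart0 n x))"
    using homogeneous_tuple_via_chart[OF F] by blast
  obtain e where e: "\<And>x. x \<in> carrier_vec (n + 1) \<Longrightarrow> x $ 0 \<noteq> 0 \<Longrightarrow>
    G x = (x $ 0) ^ e \<cdot>\<^sub>v G (chart0_inv n (chart0 n x))"
    using homogeneous_tuple_via_chart[OF G] by blast
  let ?y = "chart0 n x"
  have eq: "F (chart0_inv n y) $ i * G (chart0_inv n y) $ j = F (chart0_inv n y) $ j * G (chart0_inv n y) $ i"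
    if "i \<le> n" "j \<le> n" "y \<in> carrier_vec n" for i j y
  proof (rule poly_fun_eq_if_generic[OF _ _ p _ that(3)])
    note chart = poly_fun_chart0_inv[OF homogeneous_tuple_poly_fun]
    show "poly_fun n (\<lambda>y. F (chart0_inv n y) $ i * G (chart0_inv n y) $ j)"
      "poly_fun n (\<lambda>y. F (chart0_inv n y) $ j * G (chart0_inv n y) $ i)"
      using chart[OF F] chart[OF G] that(1,2) by (simp_all add: poly_fun_mult)
    show "F (chart0_inv n z) $ i * G (chart0_inv n z) $ j = F (chart0_inv n z) $ j * G (chart0_inv n z) $ i"
      if "z \<in> carrier_vec n" "p z \<noteq> 0" for z
      using par[OF that] \<open>i \<le> n\<close> \<open>j \<le> n\<close> unfolding parallel_def by blast
  qed
  have "parallel n (F (chart0_inv n ?y)) (G (chart0_inv n ?y))"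
    unfolding parallel_def using eq chart0_carrier by blast
  then show "parallel n (F x) (G x)"
    unfolding d[OF x] e[OF x] using homogeneous_tuple_carrier[OF F chart0_inv_carrier, of ?y]
      homogeneous_tuple_carrier[OF G chart0_inv_carrier, of ?y]
    by (simp add: parallel_def)
qed (use homogeneous_tuple_poly_fun F G in auto)

text \<open>Agreement with f on an open set determines the class: two such representatives have
  equal charts on a common open set, and conversely every representative of the class agrees with f
  generically.\<close>

lemma from_chart_eq:
  fixes F :: "'a::field_char_0 vec \<Rightarrow> 'a vec"
  assumes F: "homogeneous_tuple n F"
    and "generically n (\<lambda>y. F (chart0_inv n y) $ 0 \<noteq> 0 \<and> chart0 n (F (chart0_inv n y)) = f y)"
  shows "from_chart n f = rational_map_of n F"
proof -
  obtain p where p: "poly_fun n p" "\<exists>y\<in>carrier_vec n. p y \<noteq> 0"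
    "\<And>y. y \<in> carrier_vec n \<Longrightarrow> p y \<noteq> 0 \<Longrightarrow>
      F (chart0_inv n y) $ 0 \<noteq> 0 \<and> chart0 n (F (chart0_inv n y)) = f y"
    using assms(2) unfolding generically_def by blast
  have "G \<in> from_chart n f \<longleftrightarrow> G \<in> rational_map_of n F" for G
  proof
    assume "G \<in> from_chart n f"
    then obtain q where G: "homogeneous_tuple n G"
      and q: "poly_fun n q" "\<exists>y\<in>carrier_vec n. q y \<noteq> 0"
        "\<And>y. y \<in> carrier_vec n \<Longrightarrow> q y \<noteq> 0 \<Longrightarrow>
          G (chart0_inv n y) $ 0 \<noteq> 0 \<and> chart0 n (G (chart0_inv n y)) = f y"
      unfolding from_chart_def generically_def by blast
    have "same_rational_map n F G"
    proof (rule same_rational_map_chart[OF F G generic_conj[OF p(1,2) q(1,2)]])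
      fix y :: "'a vec" assume y: "y \<in> carrier_vec n" "p y * q y \<noteq> 0"
      let ?x = "chart0_inv n y"
      have nz: "F ?x $ 0 \<noteq> 0" "G ?x $ 0 \<noteq> 0" and eq: "chart0 n (F ?x) = chart0 n (G ?x)"
        using p(3)[OF y(1)] q(3)[OF y(1)] y(2) by auto
      have cF: "F ?x \<in> carrier_vec (n + 1)" and cG: "G ?x \<in> carrier_vec (n + 1)"
        using homogeneous_tuple_carrier[OF _ chart0_inv_carrier] F G by auto
      let ?w = "chart0_inv n (chart0 n (G ?x))"
      have "parallel n (F ?x $ 0 \<cdot>\<^sub>v ?w) (G ?x $ 0 \<cdot>\<^sub>v ?w)"
        using chart0_inv_carrier[of n "chart0 n (G ?x)"] by (simp add: parallel_def)
      then show "parallel n (F ?x) (G ?x)"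
        unfolding chart0_inv_chart0[OF cG nz(2), symmetric]
          chart0_inv_chart0[OF cF nz(1), unfolded eq, symmetric] .
    qed
    then show "G \<in> rational_map_of n F" using G by (simp add: rational_map_of_def)
  next
    assume "G \<in> rational_map_of n F"
    then have G: "homogeneous_tuple n G" and "same_rational_map n F G"
      by (auto simp: rational_map_of_def)
    then have par: "F (chart0_inv n y) $ i * G (chart0_inv n y) $ j =
        F (chart0_inv n y) $ j * G (chart0_inv n y) $ i" if "i \<le> n" "j \<le> n" for i j and y :: "'a vec"
      using that chart0_inv_carrier unfolding same_rational_map_def by blast
    obtain x where x: "x \<in> carrier_vec (n + 1)" "G x \<noteq> 0\<^sub>v (n + 1)"
      using G unfolding homogeneous_tuple_def by blast
    obtain i where i: "i \<le> n" "G x $ i \<noteq> 0"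
      using nonzero_vec_index[OF homogeneous_tuple_carrier[OF G x(1)] x(2)] .
    have "\<exists>y\<in>carrier_vec n. G (chart0_inv n y) $ i \<noteq> 0"
      using homogeneous_tuple_chart[OF G i(1)] x i by blast
    then obtain y where y: "y \<in> carrier_vec n" "G (chart0_inv n y) $ i \<noteq> 0" "p y \<noteq> 0"
      using poly_fun_common_nonzero[OF _ _ p(1,2)]
        poly_fun_chart0_inv[OF homogeneous_tuple_poly_fun[OF G i(1)]] by blast
    \<comment> \<open>Here F_i G_0 = F_0 G_i, and the right-hand side is nonzero at y.\<close>
    have "G (chart0_inv n y) $ 0 \<noteq> 0"
      using par[of i 0 y] i y p(3)[OF y(1,3)] by auto
    with y(1) have ex: "\<exists>y\<in>carrier_vec n. G (chart0_inv n y) $ 0 \<noteq> 0" by blast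
    have "generically n (\<lambda>y. G (chart0_inv n y) $ 0 \<noteq> 0 \<and> chart0 n (G (chart0_inv n y)) = f y)"
      unfolding generically_def
    proof (intro exI[of _ "\<lambda>y. p y * G (chart0_inv n y) $ 0"] conjI ballI impI)
      note gen = generic_conj[OF p(1,2) poly_fun_chart0_inv[OF homogeneous_tuple_poly_fun[OF G, of 0]] ex]
      show "poly_fun n (\<lambda>y. p y * G (chart0_inv n y) $ 0)"
        "\<exists>y\<in>carrier_vec n. p y * G (chart0_inv n y) $ 0 \<noteq> 0" using gen by auto
      fix y :: "'a vec" assume y: "y \<in> carrier_vec n" "p y * G (chart0_inv n y) $ 0 \<noteq> 0"
      then show "G (chart0_inv n y) $ 0 \<noteq> 0" by auto
      have "chart0 n (G (chart0_inv n y)) = chart0 n (F (chart0_inv n y))"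
      proof (rule eq_vecI)
        fix i assume "i < dim_vec (chart0 n (F (chart0_inv n y)))"
        then have i: "i < n" by (simp add: chart0_def)
        have "F (chart0_inv n y) $ 0 \<noteq> 0" "G (chart0_inv n y) $ 0 \<noteq> 0"
          using y p(3)[OF y(1)] by auto
        then show "chart0 n (G (chart0_inv n y)) $ i = chart0 n (F (chart0_inv n y)) $ i"
          using i par[of 0 "i + 1" y] by (simp add: chart0_def field_simps)
      qed (simp add: chart0_def)
      then show "chart0 n (G (chart0_inv n y)) = f y" using p(3) y by auto
    qed
    then show "G \<in> from_chart n f" using G by (simp add: from_chart_def)
  qed
  then show ?thesis by blast
qed

lemma from_chart_cong:
  assumes "\<And>y. y \<in> carrier_vec n \<Longrightarrow> f y = g y"
  shows "from_chart n f = from_chart n g"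
  unfolding from_chart_def generically_def using assms by auto

subsection \<open>Monomial maps\<close>

text \<open>The common factor \<open>\<Prod>\<^sub>j x_j ^ N j\<close> clears the negative exponents.\<close>

definition monomial_tuple :: "nat \<Rightarrow> (nat \<Rightarrow> nat) \<Rightarrow> int mat \<Rightarrow> 'a::field vec \<Rightarrow> 'a vec" where
  "monomial_tuple n N A x = vec (n + 1) (\<lambda>i.
    if i = 0 then x $ 0 ^ N 0 * (\<Prod>j<n. x $ (j + 1) ^ N (j + 1))
    else x $ 0 ^ nat (int (N 0) - (\<Sum>j<n. A $$ (i - 1, j))) *
      (\<Prod>j<n. x $ (j + 1) ^ nat (int (N (j + 1)) + A $$ (i - 1, j))))"

text \<open>These inequalities make the truncation by \<open>nat\<close> in
  \<open>monomial_tuple\<close> harmless. The exponent of x_0 drops by the row sum because the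
  affine coordinates are x_(j+1) / x_0; this also gives all components the same degree.\<close>

definition clearing_exponents :: "nat \<Rightarrow> (nat \<Rightarrow> nat) \<Rightarrow> int mat \<Rightarrow> bool" where
  "clearing_exponents n N A \<longleftrightarrow> (\<forall>i<n. (\<Sum>j<n. A $$ (i, j)) \<le> int (N 0) \<and>
    (\<forall>j<n. 0 \<le> int (N (j + 1)) + A $$ (i, j)))"

lemma clearing_exponents_exists: "\<exists>N. clearing_exponents n N A"
proof
  let ?S = "\<Sum>i<n. \<Sum>j<n. \<bar>A $$ (i, j)\<bar>"
  have le: "(\<Sum>j<n. \<bar>A $$ (i, j)\<bar>) \<le> ?S" if "i < n" for i
    using that member_le_sum[of i "{..<n}" "\<lambda>i. \<Sum>j<n. \<bar>A $$ (i, j)\<bar>"] by (auto intro: sum_nonneg)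
  have neg: "- A $$ (i, j) \<le> ?S" if "i < n" "j < n" for i j
    using that member_le_sum[of j "{..<n}" "\<lambda>j. \<bar>A $$ (i, j)\<bar>"] le[of i] by auto
  have pos: "(\<Sum>j<n. A $$ (i, j)) \<le> ?S" if "i < n" for i
    using le[OF that] sum_mono[of "{..<n}" "\<lambda>j. A $$ (i, j)" "\<lambda>j. \<bar>A $$ (i, j)\<bar>"] by linarith
  have "int (nat ?S) = ?S" by (simp add: sum_nonneg)
  then show "clearing_exponents n (\<lambda>_. nat ?S) A"
    unfolding clearing_exponents_def using neg pos by (smt (verit))
qed

lemma torus_points_generic:
  "x \<in> carrier_vec m \<Longrightarrow> (\<Prod>i<m. x $ i) \<noteq> 0 \<longleftrightarrow> x \<in> torus m"
  by (auto simp: torus_def)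

lemma generically_torusI:
  fixes P :: "'a::field vec \<Rightarrow> bool"
  assumes "\<And>y. y \<in> torus n \<Longrightarrow> P y"
  shows "generically n P"
  unfolding generically_def
proof (intro exI[of _ "\<lambda>y :: 'a vec. \<Prod>i<n. y $ i"] conjI ballI impI)
  show "P y" if "y \<in> carrier_vec n" "(\<Prod>i<n. y $ i) \<noteq> 0" for y
    using assms torus_points_generic that by blast
qed (rule poly_fun_prod_coords prod_coords_nonzero)+

lemma chart0_torus: "x \<in> torus (n + 1) \<Longrightarrow> chart0 n x \<in> torus n"
  by (auto simp: torus_def chart0_def)

lemma chart0_inv_torus: "y \<in> torus n \<Longrightarrow> chart0_inv n y \<in> torus (n + 1)"
  by (auto simp: torus_def chart0_inv_def)

lemma chart0_chart0_inv: "y \<in> carrier_vec n \<Longrightarrow> chart0 n (chart0_inv n y) = y"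
  by (intro eq_vecI) (auto simp: chart0_def chart0_inv_def)

lemma chart0_smult: "x \<in> carrier_vec (n + 1) \<Longrightarrow> c \<noteq> 0 \<Longrightarrow> chart0 n (c \<cdot>\<^sub>v x) = chart0 n x"
  by (intro eq_vecI) (auto simp: chart0_def)

lemma monomial_tuple_on_torus:
  assumes N: "clearing_exponents n N A" and A: "A \<in> carrier_mat n n" and x: "x \<in> torus (n + 1)"
  shows "monomial_tuple n N A x = (\<Prod>j\<le>n. x $ j ^ N j) \<cdot>\<^sub>v chart0_inv n (monomial_act A (chart0 n x))"
proof (rule eq_vecI)
  fix i assume "i < dim_vec ((\<Prod>j\<le>n. x $ j ^ N j) \<cdot>\<^sub>v chart0_inv n (monomial_act A (chart0 n x)))"
  then have i: "i < n + 1" by (simp add: chart0_inv_def)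
  have P: "(\<Prod>j\<le>n. x $ j ^ N j) = x $ 0 ^ N 0 * (\<Prod>j<n. x $ (j + 1) ^ N (j + 1))"
    by (simp add: prod.atMost_shift lessThan_Suc_atMost)
  have nz: "x $ j \<noteq> 0" if "j \<le> n" for j using x that by (auto simp: torus_def)
  show "monomial_tuple n N A x $ i = ((\<Prod>j\<le>n. x $ j ^ N j) \<cdot>\<^sub>v chart0_inv n (monomial_act A (chart0 n x))) $ i"
  proof (cases i)
    case 0
    then show ?thesis by (simp only: P) (simp add: monomial_tuple_def chart0_inv_def)
  next
    case (Suc k)
    then have k: "k < n" using i by simp
    let ?a = "\<lambda>j. A $$ (k, j)"
    have "monomial_act A (chart0 n x) $ k = (\<Prod>j<n. x $ (j + 1) powi ?a j * inverse (x $ 0 powi ?a j))"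
      by (subst monomial_act_index[OF A k])
        (auto simp: chart0_def power_int_divide_distrib divide_inverse power_int_mult_distrib
          power_int_inverse intro!: prod.cong)
    also have "\<dots> = (\<Prod>j<n. x $ (j + 1) powi ?a j) * x $ 0 powi - (\<Sum>j<n. ?a j)"
      using nz[of 0] by (simp add: prod.distrib powi_sum power_int_minus prod_inversef[unfolded comp_def])
    finally have act: "monomial_act A (chart0 n x) $ k = \<dots>" .
    have "x $ 0 ^ nat (int (N 0) - (\<Sum>j<n. ?a j)) = x $ 0 ^ N 0 * x $ 0 powi - (\<Sum>j<n. ?a j)"
      using N k nz[of 0] unfolding clearing_exponents_def
      by (simp add: power_int_add flip: power_int_nonneg_exp power_int_of_nat diff_conv_add_uminus)
        (simp add: power_int_diff power_int_minus field_simps)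
    moreover have "x $ (j + 1) ^ nat (int (N (j + 1)) + ?a j) = x $ (j + 1) ^ N (j + 1) * x $ (j + 1) powi ?a j"
      if "j < n" for j
      using N k nz[of "j + 1"] that unfolding clearing_exponents_def
      by (simp add: power_int_add flip: power_int_nonneg_exp)
    then have "(\<Prod>j<n. x $ (j + 1) ^ nat (int (N (j + 1)) + ?a j)) =
        (\<Prod>j<n. x $ (j + 1) ^ N (j + 1)) * (\<Prod>j<n. x $ (j + 1) powi ?a j)"
      by (simp add: prod.distrib)
    ultimately show ?thesis
      unfolding P using Suc k act A by (simp add: monomial_tuple_def chart0_inv_def)
  qed
qed (simp add: monomial_tuple_def chart0_inv_def)

lemma torus_smult: "c \<noteq> 0 \<Longrightarrow> x \<in> torus m \<Longrightarrow> c \<cdot>\<^sub>v x \<in> torus m"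
  by (auto simp: torus_def)

lemma
  assumes N: "clearing_exponents n N A" and A: "A \<in> carrier_mat n n" and x: "x \<in> torus (n + 1)"
  shows monomial_tuple_torus: "monomial_tuple n N A x \<in> torus (n + 1)"
    and chart0_monomial_tuple: "chart0 n (monomial_tuple n N A x) = monomial_act A (chart0 n x)"
proof -
  have c: "(\<Prod>j\<le>n. x $ j ^ N j) \<noteq> 0" using x by (auto simp: torus_def)
  have t: "monomial_act A (chart0 n x) \<in> torus n"
    using monomial_act_torus[OF A chart0_torus[OF x]] .
  show "monomial_tuple n N A x \<in> torus (n + 1)"
    unfolding monomial_tuple_on_torus[OF assms] using torus_smult[OF c chart0_inv_torus[OF t]] .
  show "chart0 n (monomial_tuple n N A x) = monomial_act A (chart0 n x)"
    unfolding monomial_tuple_on_torus[OF assms] chart0_smult[OF chart0_inv_carrier c]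
    using chart0_chart0_inv[OF torus_carrier[OF t]] .
qed

lemma torus_points_exist: "\<exists>x. x \<in> (torus m :: 'a::field vec set)"
  by (rule exI[of _ "vec m (\<lambda>_. 1)"]) (auto simp: torus_def)

lemma homogeneous_monomial_tuple:
  assumes N: "clearing_exponents n N A" and A: "A \<in> carrier_mat n n"
  shows "homogeneous_tuple n (monomial_tuple n N A :: 'a::field_char_0 vec \<Rightarrow> 'a vec)"
proof (rule homogeneous_tupleI)
  show "monomial_tuple n N A x \<in> carrier_vec (n + 1)" for x :: "'a vec"
    by (simp add: monomial_tuple_def)
  show "poly_fun (n + 1) (\<lambda>x :: 'a vec. monomial_tuple n N A x $ i)" if "i \<le> n" for i
    using that unfolding monomial_tuple_def
    by (cases "i = 0") (auto intro!: poly_fun_mult poly_fun_power poly_fun_prod poly_fun_coord)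
  fix x :: "'a vec" and c assume x: "x \<in> carrier_vec (n + 1)"
  show "monomial_tuple n N A (c \<cdot>\<^sub>v x) = c ^ (\<Sum>j\<le>n. N j) \<cdot>\<^sub>v monomial_tuple n N A x"
  proof (rule eq_vecI)
    fix i assume "i < dim_vec (c ^ (\<Sum>j\<le>n. N j) \<cdot>\<^sub>v monomial_tuple n N A x)"
    then have i: "i < n + 1" by (simp add: monomial_tuple_def)
    have S: "(\<Sum>j\<le>n. N j) = N 0 + (\<Sum>j<n. N (j + 1))"
      by (simp add: sum.atMost_shift lessThan_Suc_atMost)
    have *: "(c * x $ 0) ^ a * (\<Prod>j<n. (c * x $ (j + 1)) ^ b j) =
        c ^ (a + (\<Sum>j<n. b j)) * (x $ 0 ^ a * (\<Prod>j<n. x $ (j + 1) ^ b j))" for a b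
      by (simp add: power_mult_distrib prod.distrib power_add power_sum)
    show "monomial_tuple n N A (c \<cdot>\<^sub>v x) $ i = (c ^ (\<Sum>j\<le>n. N j) \<cdot>\<^sub>v monomial_tuple n N A x) $ i"
    proof (cases i)
      case 0
      then show ?thesis using x *[of "N 0" "\<lambda>j. N (j + 1)"] by (simp add: monomial_tuple_def S del: add_Suc_right)
    next
      case (Suc k)
      then have k: "k < n" using i by simp
      have "int (nat (int (N 0) - (\<Sum>j<n. A $$ (k, j))) + (\<Sum>j<n. nat (int (N (j + 1)) + A $$ (k, j))))
        = int (\<Sum>j\<le>n. N j)"
        using N k unfolding clearing_exponents_def S by (simp add: sum.distrib)
      then have e: "nat (int (N 0) - (\<Sum>j<n. A $$ (k, j))) + (\<Sum>j<n. nat (int (N (j + 1)) + A $$ (k, j)))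
        = (\<Sum>j\<le>n. N j)"
        by (simp only: of_nat_eq_iff)
      show ?thesis
        using Suc k x *[of "nat (int (N 0) - (\<Sum>j<n. A $$ (k, j)))" "\<lambda>j. nat (int (N (j + 1)) + A $$ (k, j))",
            unfolded e]
        by (simp add: monomial_tuple_def)
    qed
  qed (simp add: monomial_tuple_def)
next
  obtain x :: "'a vec" where x: "x \<in> torus (n + 1)" using torus_points_exist by blast
  then have "monomial_tuple n N A x $ 0 \<noteq> 0"
    using monomial_tuple_torus[OF N A] torus_nonzero by fastforce
  then have "monomial_tuple n N A x \<noteq> 0\<^sub>v (n + 1)" by auto
  then show "\<exists>x\<in>carrier_vec (n + 1). monomial_tuple n N A x \<noteq> (0\<^sub>v (n + 1) :: 'a vec)"
    using torus_carrier[OF x] by blast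
qed

lemma monomial_tuple_inverse:
  assumes N: "clearing_exponents n N A" and A: "A \<in> carrier_mat n n"
    and N': "clearing_exponents n N' B" and B: "B \<in> carrier_mat n n"
    and AB: "A * B = 1\<^sub>m n" and x: "x \<in> torus (n + 1)"
  shows "\<exists>c. c \<noteq> 0 \<and> monomial_tuple n N A (monomial_tuple n N' B x) = c \<cdot>\<^sub>v x"
proof -
  let ?w = "monomial_tuple n N A (monomial_tuple n N' B x)"
  have t: "?w \<in> torus (n + 1)"
    using monomial_tuple_torus[OF N A monomial_tuple_torus[OF N' B x]] .
  have "chart0 n ?w = chart0 n x"
    unfolding chart0_monomial_tuple[OF N A monomial_tuple_torus[OF N' B x]] chart0_monomial_tuple[OF N' B x]
      monomial_act_mult[OF A B chart0_torus[OF x], symmetric] AB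
    by (rule monomial_act_one[OF chart0_carrier])
  then obtain u where u: "?w = ?w $ 0 \<cdot>\<^sub>v u" "x = x $ 0 \<cdot>\<^sub>v u"
    using chart0_inv_chart0[OF torus_carrier[OF t]] chart0_inv_chart0[OF torus_carrier[OF x]]
      torus_nonzero[OF t, of 0] torus_nonzero[OF x, of 0] by force
  have nz: "?w $ 0 \<noteq> 0" "x $ 0 \<noteq> 0"
    using torus_nonzero[OF t, of 0] torus_nonzero[OF x, of 0] by auto
  have "(?w $ 0 / x $ 0) \<cdot>\<^sub>v (x $ 0 \<cdot>\<^sub>v u) = ?w $ 0 \<cdot>\<^sub>v u"
    using nz by (simp add: smult_smult_assoc)
  then have "?w = (?w $ 0 / x $ 0) \<cdot>\<^sub>v x"
    unfolding u(1)[symmetric] u(2)[symmetric] by (rule sym)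
  then show ?thesis using nz by (intro exI[of _ "?w $ 0 / x $ 0"]) simp
qed

lemma birational_monomial_tuple:
  assumes N: "clearing_exponents n N A" and A: "A \<in> GL_mat n"
  shows "birational_tuple n (monomial_tuple n N A :: 'a::field_char_0 vec \<Rightarrow> 'a vec)"
proof -
  obtain B where B: "B \<in> GL_mat n" "A * B = 1\<^sub>m n" "B * A = 1\<^sub>m n" using GL_mat_inverse[OF A] .
  obtain N' where N': "clearing_exponents n N' B" using clearing_exponents_exists by blast
  note carr = GL_mat_carrier[OF A] GL_mat_carrier[OF B(1)]
  note gen = poly_fun_prod_coords prod_coords_nonzero
  show ?thesis
    by (rule birational_tupleI[OF homogeneous_monomial_tuple[OF N carr(1)]
          homogeneous_monomial_tuple[OF N' carr(2)] gen _ gen])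
      (use monomial_tuple_inverse[OF N carr(1) N' carr(2) B(2)]
        monomial_tuple_inverse[OF N' carr(2) N carr(1) B(3)] torus_points_generic in blast)+
qed

lemma T_map_eq:
  assumes N: "clearing_exponents n N A" and A: "A \<in> carrier_mat n n"
  shows "T_map n A = rational_map_of n (monomial_tuple n N A :: 'a::field_char_0 vec \<Rightarrow> 'a vec)"
  unfolding T_map_def
proof (rule from_chart_eq[OF homogeneous_monomial_tuple[OF N A]])
  have "monomial_tuple n N A (chart0_inv n y) $ 0 \<noteq> 0 \<and>
      chart0 n (monomial_tuple n N A (chart0_inv n y)) = monomial_act A y"
    if y: "y \<in> torus n" for y :: "'a vec"
    using torus_nonzero[OF monomial_tuple_torus[OF N A chart0_inv_torus[OF y]], of 0]
      chart0_monomial_tuple[OF N A chart0_inv_torus[OF y]] chart0_chart0_inv[OF torus_carrier[OF y]]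
    by simp
  then show "generically n (\<lambda>y :: 'a vec. monomial_tuple n N A (chart0_inv n y) $ 0 \<noteq> 0 \<and>
      chart0 n (monomial_tuple n N A (chart0_inv n y)) = monomial_act A y)"
    by (rule generically_torusI)
qed

text \<open>S(B) fixes the first affine coordinate, so it is the monomial map of the block sum of 1
  and B. Everything about \<open>S_map\<close> is thereby reduced to \<open>T_map\<close>.\<close>

definition block_one :: "nat \<Rightarrow> int mat \<Rightarrow> int mat" where
  "block_one n B = four_block_mat (1\<^sub>m 1) (0\<^sub>m 1 (n - 1)) (0\<^sub>m (n - 1) 1) B"

lemma GL_mat_four_block:
  assumes A: "A \<in> GL_mat r" and B: "B \<in> GL_mat s"
  shows "four_block_mat A (0\<^sub>m r s) (0\<^sub>m s r) B \<in> GL_mat (r + s)"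
proof -
  obtain A' where A': "A' \<in> GL_mat r" "A * A' = 1\<^sub>m r" "A' * A = 1\<^sub>m r" using GL_mat_inverse[OF A] .
  obtain B' where B': "B' \<in> GL_mat s" "B * B' = 1\<^sub>m s" "B' * B = 1\<^sub>m s" using GL_mat_inverse[OF B] .
  note carr = GL_mat_carrier[OF A] GL_mat_carrier[OF B] GL_mat_carrier[OF A'(1)] GL_mat_carrier[OF B'(1)]
  have one: "four_block_mat (1\<^sub>m r) (0\<^sub>m r s) (0\<^sub>m s r) (1\<^sub>m s) = (1\<^sub>m (r + s) :: 'a mat)"
    by (rule eq_matI) auto
  have *: "four_block_mat P (0\<^sub>m r s) (0\<^sub>m s r) Q * four_block_mat P' (0\<^sub>m r s) (0\<^sub>m s r) Q' = 1\<^sub>m (r + s)"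
    if "P \<in> carrier_mat r r" "Q \<in> carrier_mat s s" "P' \<in> carrier_mat r r" "Q' \<in> carrier_mat s s"
      "P * P' = 1\<^sub>m r" "Q * Q' = 1\<^sub>m s" for P Q P' Q' :: "'a mat"
    using that by (subst mult_four_block_mat[of _ r r _ s _ s _ _ r _ s]) (auto simp: one)
  show ?thesis
    by (rule GL_matI[OF _ _ *[OF carr A'(2) B'(2)] *[OF carr(3,4,1,2) A'(3) B'(3)]]) (use carr in auto)
qed

lemma block_one_GL: "n \<ge> 1 \<Longrightarrow> B \<in> GL_mat (n - 1) \<Longrightarrow> block_one n B \<in> GL_mat n"
  unfolding block_one_def using GL_mat_four_block[OF GL_mat_one[of 1], of B "n - 1"] by simp

lemma monomial_act_block_one:
  assumes "n \<ge> 1" and B: "B \<in> carrier_mat (n - 1) (n - 1)"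
  shows "monomial_act (block_one n B) y = vec n (\<lambda>i. if i = 0 then y $ 0
    else monomial_act B (vec (n - 1) (\<lambda>j. y $ (j + 1))) $ (i - 1))"
proof -
  obtain m where m: "n = Suc m" using assms(1) by (cases n) auto
  have entry: "block_one n B $$ (i, j) = (if i = 0 \<or> j = 0 then if i = j then 1 else 0 else B $$ (i - 1, j - 1))"
    if "i < n" "j < n" for i j
    using that B by (auto simp: block_one_def)
  have carr: "block_one n B \<in> carrier_mat n n"
    using B m by (auto simp: block_one_def)
  show ?thesis
  proof (rule eq_vecI)
    fix i assume "i < dim_vec (vec n (\<lambda>i. if i = 0 then y $ 0
      else monomial_act B (vec (n - 1) (\<lambda>j. y $ (j + 1))) $ (i - 1)))"
    then have i: "i < n" by simp
    have "monomial_act (block_one n B) y $ i =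
        y $ 0 powi block_one n B $$ (i, 0) * (\<Prod>j<m. y $ Suc j powi block_one n B $$ (i, Suc j))"
      by (simp only: monomial_act_index[OF carr i]) (simp only: m prod.lessThan_Suc_shift comp_def)
    also have "\<dots> = (if i = 0 then y $ 0 else monomial_act B (vec (n - 1) (\<lambda>j. y $ (j + 1))) $ (i - 1))"
    proof -
      have "(\<Prod>j<m. y $ Suc j powi block_one n B $$ (i, Suc j)) =
          (\<Prod>j<m. y $ Suc j powi (if i = 0 then 0 else B $$ (i - 1, j)))"
        by (intro prod.cong refl, subst entry) (use i m in auto)
      then show ?thesis
        using i B m entry[of i 0] by (auto simp: monomial_act_index[of B "n - 1" "n - 1"])
    qed
    finally show "monomial_act (block_one n B) y $ i = vec n (\<lambda>i. if i = 0 then y $ 0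
      else monomial_act B (vec (n - 1) (\<lambda>j. y $ (j + 1))) $ (i - 1)) $ i"
      using i by simp
  qed (use carr in simp)
qed

lemma S_map_eq_T_map:
  assumes "n \<ge> 1" and B: "B \<in> carrier_mat (n - 1) (n - 1)"
  shows "S_map n B = T_map n (block_one n B)"
  unfolding S_map_def T_map_def by (rule from_chart_cong) (simp only: monomial_act_block_one[OF assms])

subsection \<open>Diagonal and almost-diagonal automorphisms\<close>

text \<open>Both families have the form \<open>x_i \<mapsto> l_i x_i\<close> up to the additional term \<open>\<epsilon> x_0\<close> in the coordinate
  of index 1, with \<open>\<epsilon> = 0\<close> and \<open>\<epsilon> = 1\<close> respectively.\<close>

definition lin_tuple :: "nat \<Rightarrow> 'a \<Rightarrow> (nat \<Rightarrow> 'a) \<Rightarrow> 'a::field vec \<Rightarrow> 'a vec" where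
  "lin_tuple n \<epsilon> l x = vec (n + 1) (\<lambda>i. l i * x $ i + (if i = 1 then \<epsilon> * x $ 0 else 0))"

definition diag_weights :: "'a::field vec \<Rightarrow> nat \<Rightarrow> 'a" where
  "diag_weights \<mu> i = (if i = 0 then 1 else \<mu> $ (i - 1))"

definition almost_diag_weights :: "'a::field vec \<Rightarrow> nat \<Rightarrow> 'a" where
  "almost_diag_weights \<nu> i = (if i \<le> 1 then 1 else \<nu> $ (i - 2))"

lemma diagonal_aut_eq: "diagonal_aut n \<mu> = rational_map_of n (lin_tuple n 0 (diag_weights \<mu>))"
proof -
  have "(\<lambda>x. vec (n + 1) (\<lambda>i. if i = 0 then x $ 0 else \<mu> $ (i - 1) * x $ i)) = lin_tuple n 0 (diag_weights \<mu>)"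
    unfolding lin_tuple_def diag_weights_def by (intro ext arg_cong[of _ _ "vec (n + 1)"]) auto
  then show ?thesis by (simp add: diagonal_aut_def)
qed

lemma almost_diagonal_aut_eq:
  "almost_diagonal_aut n \<nu> = rational_map_of n (lin_tuple n 1 (almost_diag_weights \<nu>))"
proof -
  have "(\<lambda>x. vec (n + 1) (\<lambda>i. if i = 0 then x $ 0 else if i = 1 then x $ 0 + x $ 1 else \<nu> $ (i - 2) * x $ i))
    = lin_tuple n 1 (almost_diag_weights \<nu>)"
    unfolding lin_tuple_def almost_diag_weights_def by (intro ext arg_cong[of _ _ "vec (n + 1)"]) auto
  then show ?thesis by (simp add: almost_diagonal_aut_def)
qed

lemma lin_tuple_carrier: "lin_tuple n \<epsilon> l x \<in> carrier_vec (n + 1)"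
  by (simp add: lin_tuple_def)

lemma lin_tuple_smult:
  "x \<in> carrier_vec (n + 1) \<Longrightarrow> lin_tuple n \<epsilon> l (c \<cdot>\<^sub>v x) = c \<cdot>\<^sub>v lin_tuple n \<epsilon> l x"
  by (rule eq_vecI) (auto simp: lin_tuple_def algebra_simps)

lemma birational_lin_tuple:
  fixes l :: "nat \<Rightarrow> 'a::field_char_0"
  assumes l: "\<forall>i\<le>n. l i \<noteq> 0"
  shows "birational_tuple n (lin_tuple n \<epsilon> l)"
proof -
  have hom: "homogeneous_tuple n (lin_tuple n \<epsilon> l)" if l: "\<forall>i\<le>n. l i \<noteq> 0"
    for \<epsilon> and l :: "nat \<Rightarrow> 'a"
  proof (rule homogeneous_tupleI[where d = 1])
    fix i assume "i \<le> n"
    then show "poly_fun (n + 1) (\<lambda>x. lin_tuple n \<epsilon> l x $ i)"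
      unfolding lin_tuple_def by (cases "i = 1") (auto intro!: poly_fun_add poly_fun_mult poly_fun_coord)
  next
    obtain x :: "'a vec" where x: "x \<in> carrier_vec (n + 1)" "x $ 0 \<noteq> 0"
      using poly_fun_coord0(2)[of n] by blast
    then have "lin_tuple n \<epsilon> l x $ 0 \<noteq> 0" using l by (simp add: lin_tuple_def)
    then have "lin_tuple n \<epsilon> l x \<noteq> 0\<^sub>v (n + 1)" by auto
    then show "\<exists>x\<in>carrier_vec (n + 1). lin_tuple n \<epsilon> l x \<noteq> 0\<^sub>v (n + 1)" using x by blast
  qed (simp_all only: lin_tuple_carrier lin_tuple_smult power_one_right)
  let ?\<epsilon> = "- \<epsilon> / (l 0 * l 1)" and ?l = "\<lambda>i. 1 / l i"
  have l': "\<forall>i\<le>n. 1 / l i \<noteq> 0" using l by simp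
  have "lin_tuple n \<epsilon> l (lin_tuple n ?\<epsilon> ?l x) = x" "lin_tuple n ?\<epsilon> ?l (lin_tuple n \<epsilon> l x) = x"
    if "x \<in> carrier_vec (n + 1)" for x
    using that l by (auto intro!: eq_vecI simp: lin_tuple_def divide_simps)
  then have "\<And>x. x \<in> carrier_vec (n + 1) \<Longrightarrow> \<exists>c. c \<noteq> 0 \<and> lin_tuple n \<epsilon> l (lin_tuple n ?\<epsilon> ?l x) = c \<cdot>\<^sub>v x"
    "\<And>x. x \<in> carrier_vec (n + 1) \<Longrightarrow> \<exists>c. c \<noteq> 0 \<and> lin_tuple n ?\<epsilon> ?l (lin_tuple n \<epsilon> l x) = c \<cdot>\<^sub>v x"
    by (auto intro!: exI[of _ 1])
  moreover have "homogeneous_tuple n (lin_tuple n \<epsilon> l)" "homogeneous_tuple n (lin_tuple n ?\<epsilon> ?l)"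
    by (rule hom[OF l], rule hom[OF l'])
  ultimately show ?thesis
    by (intro birational_tupleI[of n "lin_tuple n \<epsilon> l" "lin_tuple n ?\<epsilon> ?l", OF _ _ poly_fun_coord0 _ poly_fun_coord0])
      auto
qed

lemma diag_weights_0 [simp]: "diag_weights \<mu> 0 = 1"
  by (simp add: diag_weights_def)

lemma almost_diag_weights_0 [simp]: "almost_diag_weights \<nu> 0 = 1"
  by (simp add: almost_diag_weights_def)

lemma diag_weights_nonzero: "\<mu> \<in> torus n \<Longrightarrow> \<forall>i\<le>n. diag_weights \<mu> i \<noteq> 0"
  by (auto simp: torus_def diag_weights_def)

lemma almost_diag_weights_nonzero: "\<nu> \<in> torus (n - 1) \<Longrightarrow> \<forall>i\<le>n. almost_diag_weights \<nu> i \<noteq> 0"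
  by (auto simp: torus_def almost_diag_weights_def)

text \<open>The map \<open>lin_tuple\<close> in the chart, for \<open>l 0 = 1\<close>. Affine index
  i is homogeneous index i + 1, so the additive term sits at affine index 0.\<close>

definition aff :: "nat \<Rightarrow> 'a \<Rightarrow> (nat \<Rightarrow> 'a) \<Rightarrow> 'a::field vec \<Rightarrow> 'a vec" where
  "aff n \<epsilon> l y = vec n (\<lambda>i. l (i + 1) * y $ i + (if i = 0 then \<epsilon> else 0))"

lemma chart0_lin_tuple:
  assumes "l 0 = 1" "x \<in> carrier_vec (n + 1)" "x $ 0 \<noteq> 0"
  shows "chart0 n (lin_tuple n \<epsilon> l x) = aff n \<epsilon> l (chart0 n x)"
  using assms by (intro eq_vecI) (auto simp: chart0_def lin_tuple_def aff_def field_simps)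

lemma lin_tuple_chart0_inv:
  assumes "l 0 = 1"
  shows "lin_tuple n \<epsilon> l (chart0_inv n y) = chart0_inv n (aff n \<epsilon> l y)"
proof (rule eq_vecI)
  fix i assume "i < dim_vec (chart0_inv n (aff n \<epsilon> l y))"
  then show "lin_tuple n \<epsilon> l (chart0_inv n y) $ i = chart0_inv n (aff n \<epsilon> l y) $ i"
    using assms by (cases i) (auto simp: chart0_inv_def lin_tuple_def aff_def)
qed (simp add: chart0_inv_def lin_tuple_def)

lemma monomial_tuple_equivariant:
  fixes l l' :: "nat \<Rightarrow> 'a::field_char_0"
  assumes N: "clearing_exponents n N A" and A: "A \<in> GL_mat n"
    and l: "\<forall>i\<le>n. l i \<noteq> 0" "l 0 = 1" and l': "\<forall>i\<le>n. l' i \<noteq> 0" "l' 0 = 1"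
    and eq: "\<And>y. y \<in> torus n \<Longrightarrow> monomial_act A (aff n \<epsilon> l y) = aff n \<epsilon>' l' (monomial_act A y)"
  shows "same_rational_map n (monomial_tuple n N A \<circ> lin_tuple n \<epsilon> l) (lin_tuple n \<epsilon>' l' \<circ> monomial_tuple n N A)"
proof -
  note carr = GL_mat_carrier[OF A]
  note bir = birational_lin_tuple[OF l(1), where \<epsilon> = \<epsilon>] birational_lin_tuple[OF l'(1), where \<epsilon> = \<epsilon>']
    birational_monomial_tuple[OF N A]
  note hom = birational_tuple_homogeneous[OF birational_tuple_comp]
  \<comment> \<open>For \<epsilon> \<noteq> 0 the linear map does not preserve the torus, so the
    image of x must be required to have nonzero coordinates as well.\<close>
  let ?p = "\<lambda>x :: 'a vec. \<Prod>i<n + 1. x $ i" and ?q = "\<lambda>x. \<Prod>i<n + 1. lin_tuple n \<epsilon> l x $ i"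
  have q: "poly_fun (n + 1) ?q"
    using homogeneous_tuple_poly_fun[OF birational_tuple_homogeneous[OF bir(1)]]
    by (intro poly_fun_prod) auto
  have q': "\<exists>x\<in>carrier_vec (n + 1). ?q x \<noteq> 0"
  proof -
    obtain G where G: "birational_tuple n G" "homogeneous_tuple n (lin_tuple n \<epsilon> l \<circ> G)"
      "same_rational_map n (lin_tuple n \<epsilon> l \<circ> G) id"
      using birational_tupleE[OF bir(1)] by blast
    obtain r where r: "poly_fun (n + 1) r" "\<exists>x\<in>carrier_vec (n + 1). r x \<noteq> 0"
      "\<And>x. x \<in> carrier_vec (n + 1) \<Longrightarrow> r x \<noteq> 0 \<Longrightarrow> \<exists>c. c \<noteq> 0 \<and> (lin_tuple n \<epsilon> l \<circ> G) x = c \<cdot>\<^sub>v x"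
      using same_rational_map_id_generic[OF G(2,3)] by blast
    obtain x where x: "x \<in> carrier_vec (n + 1)" "r x \<noteq> 0" "?p x \<noteq> 0"
      using poly_fun_common_nonzero[OF r(1,2) poly_fun_prod_coords prod_coords_nonzero] by blast
    obtain c where c: "c \<noteq> 0" "lin_tuple n \<epsilon> l (G x) = c \<cdot>\<^sub>v x" using r(3) x by auto
    have "c \<cdot>\<^sub>v x \<in> torus (n + 1)" using torus_smult[OF c(1)] torus_points_generic[OF x(1)] x(3) by blast
    then have "?q (G x) \<noteq> 0" unfolding c(2) using torus_points_generic torus_carrier by blast
    then show ?thesis
      using homogeneous_tuple_carrier[OF birational_tuple_homogeneous[OF G(1)] x(1)] by blast
  qed
  show ?thesis
  proof (rule same_rational_map_generic[OF homogeneous_tuple_poly_fun[OF hom[OF bir(3,1)]]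
        homogeneous_tuple_poly_fun[OF hom[OF bir(2,3)]]
        generic_conj[OF poly_fun_prod_coords prod_coords_nonzero q q']])
    fix x :: "'a vec" assume x: "x \<in> carrier_vec (n + 1)" "?p x * ?q x \<noteq> 0"
    have t: "x \<in> torus (n + 1)" "lin_tuple n \<epsilon> l x \<in> torus (n + 1)"
      using x torus_points_generic[OF x(1)] torus_points_generic[OF lin_tuple_carrier] by auto
    have x0: "x $ 0 \<noteq> 0" using torus_nonzero[OF t(1), of 0] by simp
    let ?z = "monomial_act A (chart0 n x)"
    have "chart0 n (lin_tuple n \<epsilon> l x) = aff n \<epsilon> l (chart0 n x)"
      by (rule chart0_lin_tuple[of l, OF l(2) x(1) x0])
    then obtain a where a: "monomial_tuple n N A (lin_tuple n \<epsilon> l x) = a \<cdot>\<^sub>v chart0_inv n (aff n \<epsilon>' l' ?z)"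
      using monomial_tuple_on_torus[OF N carr t(2)] eq[OF chart0_torus[OF t(1)]] by metis
    obtain b where "monomial_tuple n N A x = b \<cdot>\<^sub>v chart0_inv n ?z"
      using monomial_tuple_on_torus[OF N carr t(1)] by blast
    then have b: "lin_tuple n \<epsilon>' l' (monomial_tuple n N A x) = b \<cdot>\<^sub>v chart0_inv n (aff n \<epsilon>' l' ?z)"
      by (simp only: lin_tuple_smult[OF chart0_inv_carrier] lin_tuple_chart0_inv[of l', OF l'(2)])
    show "parallel n ((monomial_tuple n N A \<circ> lin_tuple n \<epsilon> l) x) ((lin_tuple n \<epsilon>' l' \<circ> monomial_tuple n N A) x)"
      unfolding comp_def a b using chart0_inv_carrier[of n "aff n \<epsilon>' l' ?z"] by (simp add: parallel_def)
  qed
qed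

lemma conj_by_T_map:
  fixes \<mu> :: "'a::field_char_0 vec"
  assumes A: "A \<in> GL_mat n" and \<mu>: "\<mu> \<in> torus n"
  shows "conj_by (Bir_proj n) (T_map n A) (diagonal_aut n \<mu>) (diagonal_aut n (monomial_act A \<mu>))"
proof -
  obtain N where N: "clearing_exponents n N A" using clearing_exponents_exists by blast
  note carr = GL_mat_carrier[OF A]
  have t: "monomial_act A \<mu> \<in> torus n" by (rule monomial_act_torus[OF carr \<mu>])
  have "monomial_act A (aff n 0 (diag_weights \<mu>) y) = aff n 0 (diag_weights (monomial_act A \<mu>)) (monomial_act A y)"
    for y
  proof -
    have eq: "aff n 0 (diag_weights \<mu>) y = vec n (\<lambda>j. \<mu> $ j * y $ j)"
      by (rule eq_vecI) (auto simp: aff_def diag_weights_def)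
    show ?thesis
      unfolding eq using carr
      by (intro eq_vecI) (simp_all add: monomial_act_times[OF carr] aff_def diag_weights_def)
  qed
  then show ?thesis
    unfolding T_map_eq[OF N carr] diagonal_aut_eq
    using conj_by_Bir_proj_iff[OF birational_monomial_tuple[OF N A]
        birational_lin_tuple[OF diag_weights_nonzero[OF \<mu>]] birational_lin_tuple[OF diag_weights_nonzero[OF t]]]
      monomial_tuple_equivariant[OF N A diag_weights_nonzero[OF \<mu>] _ diag_weights_nonzero[OF t]]
    by simp
qed

lemma T_map_carrier:
  assumes A: "A \<in> GL_mat n"
  shows "(T_map n A :: 'a::field_char_0 rational_map) \<in> carrier (Bir_proj n)"
proof -
  obtain N where N: "clearing_exponents n N A" using clearing_exponents_exists by blast
  show ?thesis
    unfolding T_map_eq[OF N GL_mat_carrier[OF A]] using birational_monomial_tuple[OF N A] by auto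
qed

lemma S_map_carrier:
  assumes "n \<ge> 1" "B \<in> GL_mat (n - 1)"
  shows "(S_map n B :: 'a::field_char_0 rational_map) \<in> carrier (Bir_proj n)"
  using S_map_eq_T_map[OF assms(1) GL_mat_carrier[OF assms(2)]] T_map_carrier[OF block_one_GL[OF assms]]
  by metis

lemma conj_by_S_map:
  fixes \<nu> :: "'a::field_char_0 vec"
  assumes n: "n \<ge> 1" and B: "B \<in> GL_mat (n - 1)" and \<nu>: "\<nu> \<in> torus (n - 1)"
  shows "conj_by (Bir_proj n) (S_map n B) (almost_diagonal_aut n \<nu>) (almost_diagonal_aut n (monomial_act B \<nu>))"
proof -
  note carr = GL_mat_carrier[OF B]
  note A = block_one_GL[OF n B]
  obtain N where N: "clearing_exponents n N (block_one n B)" using clearing_exponents_exists by blast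
  have t: "monomial_act B \<nu> \<in> torus (n - 1)" by (rule monomial_act_torus[OF carr \<nu>])
  have "monomial_act (block_one n B) (aff n 1 (almost_diag_weights \<nu>) y) =
    aff n 1 (almost_diag_weights (monomial_act B \<nu>)) (monomial_act (block_one n B) y)" for y
  proof -
    have eq: "vec (n - 1) (\<lambda>j. aff n 1 (almost_diag_weights \<nu>) y $ (j + 1)) =
        vec (n - 1) (\<lambda>j. \<nu> $ j * vec (n - 1) (\<lambda>j. y $ (j + 1)) $ j)"
      by (rule eq_vecI) (auto simp: aff_def almost_diag_weights_def)
    show ?thesis
      unfolding monomial_act_block_one[OF n carr] eq using carr n
      by (intro eq_vecI)
        (auto simp: monomial_act_times[OF carr, unfolded One_nat_def] aff_def almost_diag_weights_def)
  qed
  then show ?thesis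
    unfolding S_map_eq_T_map[OF n carr] T_map_eq[OF N GL_mat_carrier[OF A]] almost_diagonal_aut_eq
    using conj_by_Bir_proj_iff[OF birational_monomial_tuple[OF N A]
        birational_lin_tuple[OF almost_diag_weights_nonzero[OF \<nu>]]
        birational_lin_tuple[OF almost_diag_weights_nonzero[OF t]]]
      monomial_tuple_equivariant[OF N A almost_diag_weights_nonzero[OF \<nu>] _ almost_diag_weights_nonzero[OF t]]
    by simp
qed

subsection \<open>Bidiagonal normal form\<close>

lemma GL_mat_iff_det:
  fixes M :: "'a::field mat"
  assumes "M \<in> carrier_mat m m"
  shows "M \<in> GL_mat m \<longleftrightarrow> det M \<noteq> 0"
proof
  assume "M \<in> GL_mat m"
  then obtain N where N: "N \<in> GL_mat m" "M * N = 1\<^sub>m m" using GL_mat_inverse by blast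
  then have "det M * det N = 1"
    using det_mult[OF assms GL_mat_carrier[OF N(1)]] by simp
  then show "det M \<noteq> 0" by auto
next
  assume "det M \<noteq> 0"
  from det_non_zero_imp_unit[OF assms this, of "()"]
  show "M \<in> GL_mat m"
    unfolding Units_def ring_mat_def using GL_matI[OF assms] by auto
qed

lemma GL_mat_first_column:
  fixes v :: "'a::field vec"
  assumes v: "v \<in> carrier_vec (Suc m)" "v \<noteq> 0\<^sub>v (Suc m)"
  obtains P where "P \<in> GL_mat (Suc m)" "P *\<^sub>v unit_vec (Suc m) 0 = v"
proof -
  obtain r where r: "r \<le> m" "v $ r \<noteq> 0" using nonzero_vec_index[of v m] v by auto
  \<comment> \<open>The identity matrix with column 0 replaced by v. If r \<noteq> 0, column r is
    redundant modulo v and takes over the displaced unit vector e_0.\<close>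
  define P where "P = mat (Suc m) (Suc m) (\<lambda>(i, j). if j = 0 then v $ i
    else if j = r then if i = 0 then 1 else 0 else if i = j then 1 else 0)"
  have P: "P \<in> carrier_mat (Suc m) (Suc m)" by (simp add: P_def)
  have row: "(P *\<^sub>v w) $ i = v $ i * w $ 0 + (\<Sum>j<m. P $$ (i, Suc j) * w $ Suc j)"
    if "w \<in> carrier_vec (Suc m)" "i < Suc m" for w i
    using that mult_mat_vec_eq_sum[OF P that]
    by (simp add: sum.lessThan_Suc_shift P_def del: sum.lessThan_Suc)
  have "w = 0\<^sub>v (Suc m)" if w: "w \<in> carrier_vec (Suc m)" "P *\<^sub>v w = 0\<^sub>v (Suc m)" for w
  proof -
    have "(\<Sum>j<m. P $$ (r, Suc j) * w $ Suc j) = 0"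
      using r(1) by (intro sum.neutral) (auto simp: P_def)
    then have w0: "w $ 0 = 0" using row[OF w(1), of r] w(2) r by simp
    have "w $ i = 0" if i: "i < Suc m" for i
    proof (cases "i = 0")
      case False
      \<comment> \<open>Once w_0 = 0 is known, row k of P w is w_i alone; for i = r the unit entry
        of column r lies in row 0.\<close>
      define k where "k = (if i = r then 0 else i)"
      have "(\<Sum>j<m. P $$ (k, Suc j) * w $ Suc j) = (\<Sum>j<m. if Suc j = i then w $ i else 0)"
        using i r(1) False by (intro sum.cong) (auto simp: P_def k_def)
      also have "\<dots> = w $ i" using False i by (cases i) (auto simp: sum.delta)
      finally show ?thesis using row[OF w(1), of k] w(2) w0 i r(1) by (simp add: k_def split: if_splits)
    qed (simp add: w0)
    then show ?thesis using w(1) by (intro eq_vecI) auto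
  qed
  then have "det P \<noteq> 0" using det_0_iff_vec_prod_zero_field[OF P] by blast
  then have "P \<in> GL_mat (Suc m)" using GL_mat_iff_det[OF P] by blast
  moreover have "P *\<^sub>v unit_vec (Suc m) 0 = v"
  proof (rule eq_vecI)
    fix i assume "i < dim_vec v"
    then have i: "i < Suc m" using v by simp
    have "(\<Sum>j<m. P $$ (i, Suc j) * unit_vec (Suc m) 0 $ Suc j) = 0"
      by (intro sum.neutral) auto
    then show "(P *\<^sub>v unit_vec (Suc m) 0) $ i = v $ i" using row[of "unit_vec (Suc m) 0" i] i by simp
  qed (use P v in auto)
  ultimately show thesis using that by blast
qed

text \<open>An eigenvector taken as first basis vector splits off a 1x1 block, and the induction
  hypothesis treats the lower right block. Algebraic closedness supplies one eigenvalue at each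
  stage.\<close>

lemma similar_upper_triangular:
  fixes A :: "'a::alg_closed_field mat"
  assumes "A \<in> carrier_mat m m"
  shows "\<exists>B. B \<in> carrier_mat m m \<and> upper_triangular B \<and> similar_mat A B"
  using assms
proof (induction m arbitrary: A)
  case 0
  then show ?case by (intro exI[of _ A]) (auto simp: similar_mat_refl)
next
  case (Suc m)
  note A = Suc.prems
  have "degree (char_poly A) = Suc m" using degree_monic_char_poly[OF A] by blast
  then obtain k where "poly (char_poly A) k = 0"
    using alg_closed_imp_poly_has_root[of "char_poly A"] by auto
  then obtain v where "eigenvector A v k"
    using eigenvalue_root_char_poly[OF A] unfolding eigenvalue_def by blast
  then have v: "v \<in> carrier_vec (Suc m)" "v \<noteq> 0\<^sub>v (Suc m)" "A *\<^sub>v v = k \<cdot>\<^sub>v v"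
    using A unfolding eigenvector_def by auto
  let ?e = "unit_vec (Suc m) 0 :: 'a vec"
  obtain P where P: "P \<in> GL_mat (Suc m)" "P *\<^sub>v ?e = v"
    using GL_mat_first_column[OF v(1,2)] .
  obtain Q where Q: "Q \<in> GL_mat (Suc m)" "P * Q = 1\<^sub>m (Suc m)" "Q * P = 1\<^sub>m (Suc m)"
    using GL_mat_inverse[OF P(1)] .
  note carr = A GL_mat_carrier[OF P(1)] GL_mat_carrier[OF Q(1)]
  define C where "C = Q * A * P"
  have C: "C \<in> carrier_mat (Suc m) (Suc m)" using carr by (simp add: C_def)
  have e: "?e \<in> carrier_vec (Suc m)" by simp
  have Qv: "Q *\<^sub>v v = ?e"
    using carr Q(3) e by (subst P(2)[symmetric], subst assoc_mult_mat_vec[symmetric]) auto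
  have "C *\<^sub>v ?e = (Q * A) *\<^sub>v (P *\<^sub>v ?e)"
    unfolding C_def using carr e by (intro assoc_mult_mat_vec) auto
  also have "\<dots> = Q *\<^sub>v (A *\<^sub>v v)" unfolding P(2) using carr v by (intro assoc_mult_mat_vec) auto
  also have "\<dots> = k \<cdot>\<^sub>v ?e" using v carr Qv mult_mat_vec[OF carr(3) v(1)] by simp
  finally have Ce: "C *\<^sub>v ?e = k \<cdot>\<^sub>v ?e" .
  have col: "C $$ (i, 0) = (if i = 0 then k else 0)" if "i < Suc m" for i
  proof -
    have "(\<Sum>j<m. C $$ (i, Suc j) * ?e $ Suc j) = 0" by (intro sum.neutral) auto
    then have "C $$ (i, 0) = (C *\<^sub>v ?e) $ i"
      unfolding mult_mat_vec_eq_sum[OF C e that] sum.lessThan_Suc_shift by simp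
    then show ?thesis unfolding Ce using that by auto
  qed
  have simAC: "similar_mat A C"
  proof (rule similar_matI[of _ _ P Q "Suc m"])
    have "P * C * Q = (P * Q) * A * (P * Q)"
      unfolding C_def using carr by (simp add: assoc_mult_mat[of _ "Suc m" "Suc m" _ "Suc m" _ "Suc m"])
    then show "A = P * C * Q" using Q carr by simp
  qed (use carr C Q in auto)
  define A1 A0 A2 where "A1 = mat 1 1 (\<lambda>_. k)" and "A0 = mat 1 m (\<lambda>(i, j). C $$ (i, j + 1))"
    and "A2 = mat m m (\<lambda>(i, j). C $$ (i + 1, j + 1))"
  have dims: "A1 \<in> carrier_mat 1 1" "A0 \<in> carrier_mat 1 m" "A2 \<in> carrier_mat m m"
    by (auto simp: A1_def A0_def A2_def)
  have C_block: "C = four_block_mat A1 A0 (0\<^sub>m m 1) A2"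
    using C col by (intro eq_matI) (auto simp: A1_def A0_def A2_def)
  obtain B2 where B2: "B2 \<in> carrier_mat m m" "upper_triangular B2" "similar_mat A2 B2"
    using Suc.IH[OF dims(3)] by blast
  obtain B0 where B0: "B0 \<in> carrier_mat 1 m"
    "similar_mat C (four_block_mat A1 B0 (0\<^sub>m m 1) B2)"
    using similar_mat_four_block_0_ex[OF similar_mat_refl[OF dims(1)] B2(3) dims(2,1,3)]
    unfolding C_block by blast
  have "upper_triangular (four_block_mat A1 B0 (0\<^sub>m m 1) B2)"
    using B2(1,2) B0(1) dims(1) by (auto simp: upper_triangular_def)
  moreover have "four_block_mat A1 B0 (0\<^sub>m m 1) B2 \<in> carrier_mat (Suc m) (Suc m)"
    using four_block_carrier_mat[OF dims(1) B2(1), of B0 "0\<^sub>m m 1"] by simp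
  ultimately show ?case using similar_mat_trans[OF simAC B0(2)] by blast
qed

text \<open>When d is constant along S, a maximal run i, ..., i + L - 1 in S is a Jordan block on
  the coordinates i, ..., i + L. Removing i from S splits off its first coordinate, which is how the
  nilpotent part is dismantled.\<close>

definition bidiag_mat :: "nat \<Rightarrow> (nat \<Rightarrow> 'a) \<Rightarrow> nat set \<Rightarrow> 'a::zero_neq_one mat" where
  "bidiag_mat m d S = mat m m (\<lambda>(i, j). if i = j then d i else if j = i + 1 \<and> i \<in> S then 1 else 0)"

lemma bidiag_mat_carrier [simp]: "bidiag_mat m d S \<in> carrier_mat m m"
  by (simp add: bidiag_mat_def)

lemma jordan_matrix_bidiag:
  "\<exists>d S. jordan_matrix n_as = bidiag_mat (sum_list (map fst n_as)) d S
    \<and> (\<forall>i\<in>S. i + 1 < sum_list (map fst n_as) \<and> d (i + 1) = (d i :: 'a::field))"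
proof (induction n_as)
  case Nil
  show ?case by (intro exI[of _ "{}"] exI) (auto simp: jordan_matrix_def bidiag_mat_def)
next
  case (Cons na n_as)
  obtain k a where na: "na = (k, a)" by (cases na)
  let ?m = "sum_list (map fst n_as)"
  obtain d S where dS: "jordan_matrix n_as = bidiag_mat ?m d S"
    "\<forall>i\<in>S. i + 1 < ?m \<and> d (i + 1) = d i" using Cons.IH by blast
  let ?d = "\<lambda>i. if i < k then a else d (i - k)" and ?S = "{i. i + 1 < k} \<union> (\<lambda>i. i + k) ` S"
  have "jordan_matrix (na # n_as) = four_block_mat (jordan_block k a) (0\<^sub>m k ?m) (0\<^sub>m ?m k) (jordan_matrix n_as)"
    by (simp add: na jordan_matrix_def Let_def dim_diag_block_mat comp_def case_prod_beta)
  also have "\<dots> = bidiag_mat (k + ?m) ?d ?S"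
    unfolding dS(1) using dS(2)
    by (intro eq_matI) (auto simp: bidiag_mat_def image_iff not_less le_iff_add)
  finally have "jordan_matrix (na # n_as) = bidiag_mat (sum_list (map fst (na # n_as))) ?d ?S"
    by (simp add: na)
  moreover have "\<forall>i\<in>?S. i + 1 < sum_list (map fst (na # n_as)) \<and> ?d (i + 1) = ?d i"
    using dS(2) by (auto simp: na)
  ultimately show ?case by blast
qed

lemma det_bidiag_mat: "det (bidiag_mat m d S :: 'a::field mat) = (\<Prod>i<m. d i)"
proof -
  have "upper_triangular (bidiag_mat m d S)" by (auto simp: upper_triangular_def bidiag_mat_def)
  then have "det (bidiag_mat m d S) = prod_list (diag_mat (bidiag_mat m d S))"
    using det_upper_triangular[OF _ bidiag_mat_carrier] by blast
  also have "diag_mat (bidiag_mat m d S) = map d [0..<m]"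
    by (auto simp: diag_mat_def bidiag_mat_def)
  finally show ?thesis
    using prod.distinct_set_conv_list[of "[0..<m]" d] by (simp add: atLeast0LessThan)
qed

lemma similar_bidiag_mat:
  fixes M :: "'a::alg_closed_field mat"
  assumes M: "M \<in> GL_mat m"
  obtains d S where "similar_mat M (bidiag_mat m d S)" "\<forall>i<m. d i \<noteq> 0"
    "\<forall>i\<in>S. i + 1 < m \<and> d (i + 1) = d i"
proof -
  obtain B where B: "B \<in> carrier_mat m m" "upper_triangular B" "similar_mat M B"
    using similar_upper_triangular[OF GL_mat_carrier[OF M]] by blast
  obtain n_as where "similar_mat B (jordan_matrix n_as)"
    using triangular_to_jnf_vector[OF B(1,2)] unfolding jordan_nf_def by blast
  then have sim: "similar_mat M (jordan_matrix n_as)" using similar_mat_trans[OF B(3)] by blast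
  obtain k where k: "M \<in> carrier_mat k k" "jordan_matrix n_as \<in> carrier_mat k k"
    using similar_matD[OF sim] by blast
  have "sum_list (map fst n_as) = m"
    using carrier_matD(1)[OF k(1)] carrier_matD(1)[OF k(2)] carrier_matD(1)[OF GL_mat_carrier[OF M]]
    by simp
  then obtain d S where dS: "jordan_matrix n_as = bidiag_mat m d S"
    "\<forall>i\<in>S. i + 1 < m \<and> d (i + 1) = d i" using jordan_matrix_bidiag[of n_as] by auto
  have "det (bidiag_mat m d S) \<noteq> 0"
    using det_similar[OF sim] M GL_mat_iff_det[OF GL_mat_carrier[OF M]] dS(1) by simp
  then have "\<forall>i<m. d i \<noteq> 0" unfolding det_bidiag_mat by auto
  with dS sim show thesis using that by auto
qed

lemma bidiag_mat_vec:
  fixes d :: "nat \<Rightarrow> 'a::field"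
  assumes "x \<in> carrier_vec m" "i < m"
  shows "(bidiag_mat m d S *\<^sub>v x) $ i = d i * x $ i + (if i + 1 < m \<and> i \<in> S then x $ (i + 1) else 0)"
proof -
  have "(bidiag_mat m d S *\<^sub>v x) $ i =
      (\<Sum>j<m. (if j = i then d i * x $ i else 0) + (if j = i + 1 then if i \<in> S then x $ (i + 1) else 0 else 0))"
    unfolding mult_mat_vec_eq_sum[OF bidiag_mat_carrier assms]
    using assms by (intro sum.cong) (auto simp: bidiag_mat_def)
  then show ?thesis using assms by (simp add: sum.distrib sum.delta)
qed

lemma bidiag_mat_GL:
  fixes d :: "nat \<Rightarrow> 'a::field"
  shows "\<forall>i<m. d i \<noteq> 0 \<Longrightarrow> bidiag_mat m d S \<in> GL_mat m"
  by (simp add: GL_mat_iff_det[OF bidiag_mat_carrier] det_bidiag_mat)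

subsection \<open>Elementary birational maps\<close>

text \<open>In the chart \<open>x_q \<noteq> 0\<close>, this is \<open>x_i \<mapsto> x_i + R(x) / x_q^m\<close>.\<close>

definition elem_tuple :: "nat \<Rightarrow> nat \<Rightarrow> nat \<Rightarrow> nat \<Rightarrow> ('a::field vec \<Rightarrow> 'a) \<Rightarrow> 'a vec \<Rightarrow> 'a vec" where
  "elem_tuple n q m i R x = vec (n + 1) (\<lambda>k. x $ q ^ m * x $ k + (if k = i then R x else 0))"

lemma poly_fun_coord_nonzero:
  "i < m \<Longrightarrow> \<exists>x\<in>carrier_vec m. x $ i \<noteq> (0::'a::field)"
  by (rule bexI[of _ "vec m (\<lambda>_. 1)"]) auto

lemma homogeneous_elem_tuple:
  fixes R :: "'a::field_char_0 vec \<Rightarrow> 'a"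
  assumes q: "q \<le> n" "q \<noteq> i" and R: "poly_fun (n + 1) R"
    and hom: "\<And>x c. x \<in> carrier_vec (n + 1) \<Longrightarrow> R (c \<cdot>\<^sub>v x) = c ^ (m + 1) * R x"
  shows "homogeneous_tuple n (elem_tuple n q m i R)"
proof (rule homogeneous_tupleI[where d = "m + 1"])
  show "elem_tuple n q m i R x \<in> carrier_vec (n + 1)" for x by (simp add: elem_tuple_def)
  show "poly_fun (n + 1) (\<lambda>x. elem_tuple n q m i R x $ k)" if "k \<le> n" for k
    using that q R unfolding elem_tuple_def
    by (cases "k = i") (auto intro!: poly_fun_add poly_fun_mult poly_fun_power poly_fun_coord)
  show "elem_tuple n q m i R (c \<cdot>\<^sub>v x) = c ^ (m + 1) \<cdot>\<^sub>v elem_tuple n q m i R x"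
    if "x \<in> carrier_vec (n + 1)" for x c
    using that q hom[OF that] by (intro eq_vecI) (auto simp: elem_tuple_def algebra_simps)
  obtain x :: "'a vec" where x: "x \<in> carrier_vec (n + 1)" "x $ q \<noteq> 0"
    using poly_fun_coord_nonzero[of q "n + 1"] q by auto
  then have "elem_tuple n q m i R x $ q \<noteq> 0" using q by (simp add: elem_tuple_def)
  then have "elem_tuple n q m i R x \<noteq> 0\<^sub>v (n + 1)" using q by auto
  then show "\<exists>x\<in>carrier_vec (n + 1). elem_tuple n q m i R x \<noteq> 0\<^sub>v (n + 1)" using x by blast
qed

text \<open>As R does not involve x_i and q \<noteq> i, the shear is undone by the one with
  -R.\<close>

lemma birational_elem_tuple:
  fixes R :: "'a::field_char_0 vec \<Rightarrow> 'a"
  assumes q: "q \<le> n" "q \<noteq> i" and R: "poly_fun (n + 1) R"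
    and hom: "\<And>x c. x \<in> carrier_vec (n + 1) \<Longrightarrow> R (c \<cdot>\<^sub>v x) = c ^ (m + 1) * R x"
    and indep: "\<And>x y. x \<in> carrier_vec (n + 1) \<Longrightarrow> y \<in> carrier_vec (n + 1) \<Longrightarrow>
      (\<And>k. k \<le> n \<Longrightarrow> k \<noteq> i \<Longrightarrow> x $ k = y $ k) \<Longrightarrow> R x = R y"
  shows "birational_tuple n (elem_tuple n q m i R)"
proof -
  \<comment> \<open>The first map multiplies by x_q^m and turns x_q into x_q^(m+1); the second
    multiplies by the m-th power of the latter. This accounts for the exponent (m + 1) m +
    m.\<close>
  have inv: "elem_tuple n q m i R (elem_tuple n q m i R' x) = (x $ q) ^ ((m + 1) * m + m) \<cdot>\<^sub>v x"
    if x: "x \<in> carrier_vec (n + 1)" and R': "\<And>x. R' x = - R x"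
      and hom: "\<And>x c. x \<in> carrier_vec (n + 1) \<Longrightarrow> R (c \<cdot>\<^sub>v x) = c ^ (m + 1) * R x"
      and indep: "\<And>x y. x \<in> carrier_vec (n + 1) \<Longrightarrow> y \<in> carrier_vec (n + 1) \<Longrightarrow>
        (\<And>k. k \<le> n \<Longrightarrow> k \<noteq> i \<Longrightarrow> x $ k = y $ k) \<Longrightarrow> R x = R y"
    for x :: "'a vec" and R R'
  proof -
    let ?y = "elem_tuple n q m i R' x"
    have y: "?y \<in> carrier_vec (n + 1)" by (simp add: elem_tuple_def)
    have yk: "?y $ k = x $ q ^ m * x $ k" if "k \<le> n" "k \<noteq> i" for k
      using that by (simp add: elem_tuple_def)
    have "R ?y = R (x $ q ^ m \<cdot>\<^sub>v x)"
      by (rule indep[OF y]) (use x yk in auto)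
    then have Ry: "R ?y = (x $ q ^ m) ^ (m + 1) * R x" using hom[OF x] by simp
    show ?thesis
    proof (rule eq_vecI)
      fix k assume "k < dim_vec ((x $ q) ^ ((m + 1) * m + m) \<cdot>\<^sub>v x)"
      then have k: "k \<le> n" using x by simp
      have yq: "?y $ q = x $ q ^ (m + 1)" using yk[OF q] by simp
      have lhs: "elem_tuple n q m i R ?y $ k = (x $ q ^ (m + 1)) ^ m * ?y $ k + (if k = i then R ?y else 0)"
        using k by (subst elem_tuple_def) (simp add: yq)
      define A where "A = (x $ q ^ (m + 1)) ^ m"
      have A: "(x $ q ^ m) ^ (m + 1) = A"
        unfolding A_def by (simp only: power_mult[symmetric] mult.commute)
      have yk': "?y $ k = x $ q ^ m * x $ k - (if k = i then R x else 0)"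
        using k by (simp add: elem_tuple_def R')
      have "elem_tuple n q m i R ?y $ k = A * x $ q ^ m * x $ k"
        unfolding lhs Ry A A_def[symmetric] yk' by (simp add: right_diff_distrib)
      then have "elem_tuple n q m i R ?y $ k = (x $ q ^ (m + 1)) ^ m * x $ q ^ m * x $ k"
        unfolding A_def .
      also have "(x $ q ^ (m + 1)) ^ m * x $ q ^ m = x $ q ^ ((m + 1) * m + m)"
        by (simp only: power_mult[symmetric] power_add[symmetric])
      finally show "elem_tuple n q m i R ?y $ k = ((x $ q) ^ ((m + 1) * m + m) \<cdot>\<^sub>v x) $ k"
        using k x by simp
    qed (use x in \<open>simp add: elem_tuple_def\<close>)
  qed
  let ?R = "\<lambda>x. - R x"
  have R': "poly_fun (n + 1) ?R" using poly_fun_diff[OF poly_fun_const[of _ 0] R] by simp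
  have hom': "?R (c \<cdot>\<^sub>v x) = c ^ (m + 1) * ?R x" if "x \<in> carrier_vec (n + 1)" for x c
    using hom[OF that] by simp
  have indep': "?R x = ?R y" if "x \<in> carrier_vec (n + 1)" "y \<in> carrier_vec (n + 1)"
    "\<And>k. k \<le> n \<Longrightarrow> k \<noteq> i \<Longrightarrow> x $ k = y $ k" for x y
    using indep[OF that] by simp
  have gen: "poly_fun (n + 1) (\<lambda>x :: 'a vec. x $ q)" "\<exists>x\<in>carrier_vec (n + 1). x $ q \<noteq> (0::'a)"
    using q(1) poly_fun_coord_nonzero[of q "n + 1"] by (auto intro!: poly_fun_coord)
  show ?thesis
  proof (rule birational_tupleI[OF homogeneous_elem_tuple[OF q R hom] homogeneous_elem_tuple[OF q R' hom'] gen _ gen])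
    fix x :: "'a vec" assume x: "x \<in> carrier_vec (n + 1)" "x $ q \<noteq> 0"
    show "\<exists>c. c \<noteq> 0 \<and> elem_tuple n q m i R (elem_tuple n q m i ?R x) = c \<cdot>\<^sub>v x"
    proof (intro exI conjI)
      show "elem_tuple n q m i R (elem_tuple n q m i ?R x) = (x $ q) ^ ((m + 1) * m + m) \<cdot>\<^sub>v x"
        by (rule inv[of x ?R R, OF x(1) _ hom indep]) simp_all
    qed (use x(2) in simp)
    show "\<exists>c. c \<noteq> 0 \<and> elem_tuple n q m i ?R (elem_tuple n q m i R x) = c \<cdot>\<^sub>v x"
    proof (intro exI conjI)
      show "elem_tuple n q m i ?R (elem_tuple n q m i R x) = (x $ q) ^ ((m + 1) * m + m) \<cdot>\<^sub>v x"
        by (rule inv[of x R ?R, OF x(1) _ hom' indep']) simp_all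
    qed (use x(2) in simp)
  qed auto
qed

subsection \<open>Removing the nilpotent part of a Jordan matrix\<close>

text \<open>The numbers d * z l + z (l + 1) are the images of the block coordinates, and -s - 1 is
  the new value of -s. Comparing the coefficients of z gives Pascal's rule, so the sum is an
  eigenvector for d.\<close>

lemma gbinomial_eigen_sum:
  fixes s d :: "'a::field_char_0"
  assumes "d \<noteq> 0"
  shows "(\<Sum>l\<le>L. ((- s - 1) gchoose l) / d ^ l * (d * z l + (if l < L then z (l + 1) else 0)))
    = d * (\<Sum>l\<le>L. ((- s) gchoose l) / d ^ l * z l)"
proof -
  \<comment> \<open>The last coordinate of a block has no successor, so the second sum stops before
    L.\<close>
  have split: "(\<Sum>l\<le>L. b l * (d * z l + (if l < L then z (l + 1) else 0))) =
      (\<Sum>l\<le>L. b l * d * z l) + (\<Sum>l<L. b l * z (l + 1))" for b :: "nat \<Rightarrow> 'a"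
    by (simp add: algebra_simps sum.distrib flip: lessThan_Suc_atMost)
  define b c where "b l = ((- s - 1) gchoose l) / d ^ l" and "c l = ((- s) gchoose l) / d ^ l" for l
  have "(\<Sum>l\<le>L. b l * d * z l) + (\<Sum>l<L. b l * z (l + 1)) = d * (\<Sum>l\<le>L. c l * z l)"
  proof (induction L)
    case (Suc L)
    have "(- s) gchoose Suc L = ((- s - 1) gchoose L) + ((- s - 1) gchoose Suc L)"
      using gbinomial_Suc_Suc[of "- s - 1" L] by simp
    then have step: "b (Suc L) * d * z (Suc L) + b L * z (L + 1) = d * (c (Suc L) * z (Suc L))"
      using assms by (simp add: b_def c_def field_simps)
    have "(\<Sum>l\<le>Suc L. b l * d * z l) + (\<Sum>l<Suc L. b l * z (l + 1)) =
        ((\<Sum>l\<le>L. b l * d * z l) + (\<Sum>l<L. b l * z (l + 1))) + (b (Suc L) * d * z (Suc L) + b L * z (L + 1))"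
      by (simp add: add_ac)
    also have "\<dots> = d * (\<Sum>l\<le>Suc L. c l * z l)"
      unfolding Suc step by (simp add: distrib_left)
    finally show ?case .
  qed (simp add: b_def c_def)
  then show ?thesis by (simp only: split b_def c_def)
qed

text \<open>With \<open>s = d_p x_p / x_{p+1}\<close> the Jordan matrix maps \<open>s\<close> to \<open>s + 1\<close>, and by Pascal's rule
  \<open>\<Sum>\<^sub>l C(-s, l) d^{-l} x_{i+l}\<close> becomes an eigenfunction that can replace the first coordinate \<open>x_i\<close>
  of a block.\<close>

lemma conjugate_bidiag_remove:
  fixes d :: "nat \<Rightarrow> 'a::field_char_0"
  assumes d: "\<forall>i<n + 1. d i \<noteq> 0" and S: "\<forall>i\<in>S. i + 1 < n + 1 \<and> d (i + 1) = d i"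
    and p: "p \<in> S" "p + 1 \<notin> S" and i: "i \<in> S" "i \<noteq> p" and first: "\<forall>k\<in>S. k + 1 \<noteq> i"
  shows "conjugate_in (Bir_proj n) (rational_map_of n (\<lambda>x. bidiag_mat (n + 1) d S *\<^sub>v x))
    (rational_map_of n (\<lambda>x. bidiag_mat (n + 1) d (S - {i}) *\<^sub>v x))"
proof -
  let ?q = "p + 1"
  \<comment> \<open>The block that starts at i consists of the coordinates i, ..., i + L.\<close>
  define L where "L = (LEAST l. i + l \<notin> S)"
  have "i + (n + 1) \<notin> S" using S by fastforce
  then have endL: "i + L \<notin> S" unfolding L_def by (rule LeastI)
  have block: "i + l \<in> S" if "l < L" for l using not_less_Least that unfolding L_def by blast
  have dl: "l \<le> L \<Longrightarrow> d (i + l) = d i" for l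
  proof (induction l)
    case (Suc l)
    then show ?case using S block[of l] by simp
  qed simp
  have L1: "L \<ge> 1" using endL i by (cases L) auto
  have iL: "i + L \<le> n" using S block[of "L - 1"] L1 by fastforce
  \<comment> \<open>Since i is not p and has no predecessor in S, both p and p + 1 differ from i. So
    s does not involve x_i, even when p lies in the block of i.\<close>
  have q: "?q \<le> n" "?q \<noteq> i" "p \<noteq> i" "d ?q = d p" "d p \<noteq> 0" "d i \<noteq> 0" "i \<le> n"
    using S p i d iL by auto
  \<comment> \<open>P_j is x_q^j times j! C(-s, j) for s = d_p x_p / x_q. R collects the terms with
    j \<ge> 1, multiplied by x_q^L to clear denominators; the term j = 0 is the x_q^L x_i already
    present in \<open>elem_tuple\<close>.\<close>
  define P where "P j x = (\<Prod>l<j. - d p * x $ p - of_nat l * x $ ?q)" for j and x :: "'a vec"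
  define R where "R x = (\<Sum>j\<in>{1..L}. P j x / (fact j * d i ^ j) * x $ ?q ^ (L - j) * x $ (i + j))" for x :: "'a vec"
  define s where "s x = d p * x $ p / x $ ?q" for x :: "'a vec"
  have Rpoly: "poly_fun (n + 1) R"
    unfolding R_def P_def divide_inverse using q iL S p(1)
    by (intro poly_fun_sum poly_fun_mult poly_fun_prod poly_fun_power poly_fun_coord poly_fun_const poly_fun_diff) auto
  have Rhom: "R (c \<cdot>\<^sub>v x) = c ^ (L + 1) * R x" if x: "x \<in> carrier_vec (n + 1)" for x c
  proof -
    have Phom: "P j (c \<cdot>\<^sub>v x) = c ^ j * P j x" for j
    proof -
      have "P j (c \<cdot>\<^sub>v x) = (\<Prod>l<j. c * (- d p * x $ p - of_nat l * x $ ?q))"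
        unfolding P_def using x q(1) by (intro prod.cong) (auto simp: algebra_simps)
      then show ?thesis by (simp add: P_def prod.distrib)
    qed
    have "P j (c \<cdot>\<^sub>v x) / (fact j * d i ^ j) * (c \<cdot>\<^sub>v x) $ ?q ^ (L - j) * (c \<cdot>\<^sub>v x) $ (i + j) =
        c ^ (L + 1) * (P j x / (fact j * d i ^ j) * x $ ?q ^ (L - j) * x $ (i + j))" if j: "j \<in> {1..L}" for j
    proof -
      have "c ^ j * c ^ (L - j) = c ^ L" using j by (simp flip: power_add)
      then show ?thesis using x q(1) iL j by (simp add: Phom power_mult_distrib)
    qed
    then show ?thesis unfolding R_def sum_distrib_left by (intro sum.cong) auto
  qed
  have Rindep: "R x = R y" if "x \<in> carrier_vec (n + 1)" "y \<in> carrier_vec (n + 1)"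
    "\<And>k. k \<le> n \<Longrightarrow> k \<noteq> i \<Longrightarrow> x $ k = y $ k" for x y
  proof -
    have "x $ p = y $ p" "x $ ?q = y $ ?q" using that(3)[of p] that(3)[of ?q] q by auto
    then show ?thesis unfolding R_def P_def using that(3) iL by (intro sum.cong) auto
  qed
  let ?E = "elem_tuple n ?q L i R"
  let ?J = "\<lambda>x. bidiag_mat (n + 1) d S *\<^sub>v x" and ?J' = "\<lambda>x. bidiag_mat (n + 1) d (S - {i}) *\<^sub>v x"
  have bir: "birational_tuple n ?E" "birational_tuple n ?J" "birational_tuple n ?J'"
    by (rule birational_elem_tuple[OF q(1,2) Rpoly Rhom Rindep], assumption+)
      (rule birational_tuple_linear[OF bidiag_mat_GL[OF d]])+
  have Ei: "?E x $ i = x $ ?q ^ L * (\<Sum>l\<le>L. ((- s x) gchoose l) / d i ^ l * x $ (i + l))"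
    if x: "x \<in> carrier_vec (n + 1)" "x $ ?q \<noteq> 0" for x
  proof -
    have PX: "P j x = x $ ?q ^ j * (fact j * ((- s x) gchoose j))" for j
    proof -
      have "P j x = (\<Prod>l<j. x $ ?q * (- s x - of_nat l))"
        unfolding P_def s_def using x(2) by (intro prod.cong) (auto simp: field_simps)
      also have "\<dots> = x $ ?q ^ j * (\<Prod>l = 0..<j. - s x - of_nat l)" by (simp add: prod.distrib lessThan_atLeast0)
      finally show ?thesis by (simp add: gbinomial_prod_rev)
    qed
    have summand: "P j x / (fact j * d i ^ j) * x $ ?q ^ (L - j) * x $ (i + j) =
        x $ ?q ^ L * (((- s x) gchoose j) / d i ^ j * x $ (i + j))" if j: "j \<in> {1..L}" for j
    proof -
      have "x $ ?q ^ L = x $ ?q ^ j * x $ ?q ^ (L - j)" using j by (simp flip: power_add)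
      then show ?thesis by (simp add: PX)
    qed
    have "R x = x $ ?q ^ L * (\<Sum>j\<in>{1..L}. ((- s x) gchoose j) / d i ^ j * x $ (i + j))"
      unfolding R_def sum_distrib_left using summand by (intro sum.cong) auto
    moreover have "{..L} = insert 0 {1..L}" by auto
    ultimately show ?thesis using q by (simp add: elem_tuple_def algebra_simps)
  qed
  have "same_rational_map n (?E \<circ> ?J) (?J' \<circ> ?E)"
  proof (rule same_rational_map_generic[of n _ _ "\<lambda>x. x $ ?q"])
    note hom = homogeneous_tuple_poly_fun[OF birational_tuple_homogeneous[OF birational_tuple_comp]]
    show "poly_fun (n + 1) (\<lambda>x. (?E \<circ> ?J) x $ k)" if "k \<le> n" for k by (rule hom[OF bir(1,2) that])
    show "poly_fun (n + 1) (\<lambda>x. (?J' \<circ> ?E) x $ k)" if "k \<le> n" for k by (rule hom[OF bir(3,1) that])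
    show "poly_fun (n + 1) (\<lambda>x. x $ ?q)" using q(1) by (intro poly_fun_coord) simp
    show "\<exists>x\<in>carrier_vec (n + 1). x $ ?q \<noteq> (0::'a)" using q(1) by (intro poly_fun_coord_nonzero) simp
    fix x :: "'a vec" assume x: "x \<in> carrier_vec (n + 1)" "x $ ?q \<noteq> 0"
    have Jx: "?J x \<in> carrier_vec (n + 1)" using x(1) by (simp add: mult_mat_vec_carrier[OF bidiag_mat_carrier])
    have Ex: "?E x \<in> carrier_vec (n + 1)" by (simp add: elem_tuple_def)
    have Jk: "?J x $ k = d k * x $ k + (if k \<in> S then x $ (k + 1) else 0)" if "k \<le> n" for k
      using bidiag_mat_vec[OF x(1), of k] S that by auto
    have J'k: "?J' (?E x) $ k = d k * ?E x $ k + (if k \<in> S - {i} then ?E x $ (k + 1) else 0)" if "k \<le> n" for k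
      using bidiag_mat_vec[OF Ex, of k] S that by auto
    have Jq: "?J x $ ?q = d p * x $ ?q" using Jk[OF q(1)] p(2) q(4) by simp
    \<comment> \<open>The two sides differ by d_p^L because the Jordan matrix multiplies the
      denominator x_q^L by this factor.\<close>
    have "?E (?J x) = d p ^ L \<cdot>\<^sub>v ?J' (?E x)"
    proof (rule eq_vecI)
      fix k assume "k < dim_vec (d p ^ L \<cdot>\<^sub>v ?J' (?E x))"
      then have k: "k \<le> n" by (simp add: bidiag_mat_def)
      show "?E (?J x) $ k = (d p ^ L \<cdot>\<^sub>v ?J' (?E x)) $ k"
      proof (cases "k = i")
        case False
        then have "?E (?J x) $ k = (d p * x $ ?q) ^ L * ?J x $ k"
          using k Jq by (subst elem_tuple_def) simp
        moreover have "?E x $ k = x $ ?q ^ L * x $ k" using k False by (simp add: elem_tuple_def)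
        \<comment> \<open>No other row refers to the modified coordinate i, because i is the first
          of its block.\<close>
        moreover have "?E x $ (k + 1) = x $ ?q ^ L * x $ (k + 1)" if "k \<in> S"
          using S first that by (simp add: elem_tuple_def)
        ultimately show ?thesis
          using k False Jk[OF k] J'k[OF k] by (simp add: bidiag_mat_def power_mult_distrib algebra_simps)
      next
        case True
        have sJ: "s (?J x) = s x + 1"
          unfolding s_def Jq using Jk[of p] p(1) q x(2) by (simp add: field_simps)
        have "?E (?J x) $ i = ?J x $ ?q ^ L * (\<Sum>l\<le>L. ((- s (?J x)) gchoose l) / d i ^ l * ?J x $ (i + l))"
          using q x(2) Jq by (intro Ei[OF Jx]) simp
        also have "(\<Sum>l\<le>L. ((- s (?J x)) gchoose l) / d i ^ l * ?J x $ (i + l)) =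
          (\<Sum>l\<le>L. ((- s x - 1) gchoose l) / d i ^ l * (d i * x $ (i + l) + (if l < L then x $ (i + (l + 1)) else 0)))"
        proof (intro sum.cong refl)
          fix l assume "l \<in> {..L}"
          then have l: "l \<le> L" by simp
          have "?J x $ (i + l) = d i * x $ (i + l) + (if l < L then x $ (i + (l + 1)) else 0)"
            using Jk[of "i + l"] iL l dl[OF l] block[of l] endL by (cases "l = L") (auto simp: add.assoc)
          moreover have "- s (?J x) = - s x - 1" unfolding sJ by simp
          ultimately show "((- s (?J x)) gchoose l) / d i ^ l * ?J x $ (i + l) =
            ((- s x - 1) gchoose l) / d i ^ l * (d i * x $ (i + l) + (if l < L then x $ (i + (l + 1)) else 0))"
            by simp
        qed
        also have "\<dots> = d i * (\<Sum>l\<le>L. ((- s x) gchoose l) / d i ^ l * x $ (i + l))"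
          using gbinomial_eigen_sum[OF q(6), where z = "\<lambda>l. x $ (i + l)"] by blast
        finally show ?thesis
          using True q(7) J'k[OF q(7)] Ei[OF x] Jq by (simp add: bidiag_mat_def power_mult_distrib algebra_simps)
      qed
    qed (simp add: elem_tuple_def bidiag_mat_def)
    then show "parallel n ((?E \<circ> ?J) x) ((?J' \<circ> ?E) x)"
      using parallel_smult[OF mult_mat_vec_carrier[OF bidiag_mat_carrier Ex]] by simp
  qed
  then show ?thesis using conjugate_in_Bir_proj_iff[OF bir(2,3)] bir(1) by blast
qed

lemma conjugate_bidiag_single:
  fixes d :: "nat \<Rightarrow> 'a::field_char_0"
  assumes d: "\<forall>i<n + 1. d i \<noteq> 0" and S: "\<forall>i\<in>S. i + 1 < n + 1 \<and> d (i + 1) = d i"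
    and p: "p \<in> S" "p + 1 \<notin> S"
  shows "conjugate_in (Bir_proj n) (rational_map_of n (\<lambda>x. bidiag_mat (n + 1) d S *\<^sub>v x))
    (rational_map_of n (\<lambda>x. bidiag_mat (n + 1) d {p} *\<^sub>v x))"
  using S p
proof (induction "card (S - {p})" arbitrary: S rule: less_induct)
  case less
  have fin: "finite S" using less.prems(1) by (intro finite_subset[of S "{..n}"]) auto
  have bir: "birational_tuple n (\<lambda>x. bidiag_mat (n + 1) d S *\<^sub>v x)" for S
    by (rule birational_tuple_linear[OF bidiag_mat_GL[OF d]])
  show ?case
  proof (cases "S = {p}")
    case True
    then show ?thesis
      using conjugate_in_Bir_proj_iff[OF bir bir] birational_tuple_id same_rational_map_refl
      by (metis comp_id id_comp)
  next
    case False
    \<comment> \<open>The smallest element other than p begins a block: a predecessor in S would be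
      a smaller element or p itself, and p + 1 is not in S.\<close>
    define i where "i = Min (S - {p})"
    have "S - {p} \<noteq> {}" using False less.prems(2) by auto
    then have i: "i \<in> S" "i \<noteq> p" using Min_in[of "S - {p}"] fin unfolding i_def by auto
    have first: "\<forall>k\<in>S. k + 1 \<noteq> i"
    proof
      fix k assume k: "k \<in> S"
      show "k + 1 \<noteq> i"
      proof
        assume "k + 1 = i"
        then have "k \<in> S - {p}" using k i less.prems(3) by auto
        then have "i \<le> k" unfolding i_def using fin by simp
        then show False using \<open>k + 1 = i\<close> by simp
      qed
    qed
    have 1: "conjugate_in (Bir_proj n) (rational_map_of n (\<lambda>x. bidiag_mat (n + 1) d S *\<^sub>v x))
      (rational_map_of n (\<lambda>x. bidiag_mat (n + 1) d (S - {i}) *\<^sub>v x))"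
      by (rule conjugate_bidiag_remove[OF d less.prems i first])
    have "card (S - {i} - {p}) < card (S - {p})"
      using i fin by (intro psubset_card_mono) auto
    then have 2: "conjugate_in (Bir_proj n) (rational_map_of n (\<lambda>x. bidiag_mat (n + 1) d (S - {i}) *\<^sub>v x))
      (rational_map_of n (\<lambda>x. bidiag_mat (n + 1) d {p} *\<^sub>v x))"
      using less.prems i by (intro less.hyps) auto
    show ?thesis
      by (rule group.conjugate_in_trans[OF group_Bir_proj 1 2]) (use bir in auto)
  qed
qed

definition perm_tuple :: "nat \<Rightarrow> (nat \<Rightarrow> nat) \<Rightarrow> (nat \<Rightarrow> 'a) \<Rightarrow> 'a::field vec \<Rightarrow> 'a vec" where
  "perm_tuple n \<pi> c x = vec (n + 1) (\<lambda>i. c i * x $ \<pi> i)"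

lemma birational_perm_tuple:
  fixes c :: "nat \<Rightarrow> 'a::field_char_0"
  assumes \<pi>: "bij_betw \<pi> {..n} {..n}" and c: "\<forall>i\<le>n. c i \<noteq> 0"
  shows "birational_tuple n (perm_tuple n \<pi> c)"
proof -
  have hom: "homogeneous_tuple n (perm_tuple n \<pi> c)"
    if \<pi>: "bij_betw \<pi> {..n} {..n}" and c: "\<forall>i\<le>n. c i \<noteq> 0" for \<pi> and c :: "nat \<Rightarrow> 'a"
  proof (rule homogeneous_tupleI[where d = 1])
    have \<pi>n: "\<pi> i \<le> n" if "i \<le> n" for i using bij_betwE[OF \<pi>] that by auto
    show "perm_tuple n \<pi> c x \<in> carrier_vec (n + 1)" for x by (simp add: perm_tuple_def)
    show "poly_fun (n + 1) (\<lambda>x. perm_tuple n \<pi> c x $ i)" if "i \<le> n" for i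
      using that \<pi>n[OF that] unfolding perm_tuple_def by (auto intro!: poly_fun_mult poly_fun_coord)
    show "perm_tuple n \<pi> c (a \<cdot>\<^sub>v x) = a ^ 1 \<cdot>\<^sub>v perm_tuple n \<pi> c x" if "x \<in> carrier_vec (n + 1)" for x a
      using that \<pi>n by (intro eq_vecI) (auto simp: perm_tuple_def less_Suc_eq_le)
    obtain x :: "'a vec" where x: "x \<in> carrier_vec (n + 1)" "x $ \<pi> 0 \<noteq> 0"
      using poly_fun_coord_nonzero[of "\<pi> 0" "n + 1"] \<pi>n[of 0] by auto
    then have "perm_tuple n \<pi> c x $ 0 \<noteq> 0" using c by (simp add: perm_tuple_def)
    then have "perm_tuple n \<pi> c x \<noteq> 0\<^sub>v (n + 1)" by auto
    then show "\<exists>x\<in>carrier_vec (n + 1). perm_tuple n \<pi> c x \<noteq> 0\<^sub>v (n + 1)" using x by blast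
  qed
  define \<sigma> where "\<sigma> = the_inv_into {..n} \<pi>"
  let ?c = "\<lambda>i. 1 / c (\<sigma> i)"
  have \<sigma>: "bij_betw \<sigma> {..n} {..n}" unfolding \<sigma>_def by (rule bij_betw_the_inv_into[OF \<pi>])
  have \<pi>n: "\<pi> i \<le> n" "\<sigma> i \<le> n" if "i \<le> n" for i
    using bij_betwE[OF \<pi>] bij_betwE[OF \<sigma>] that by auto
  have inv: "\<sigma> (\<pi> i) = i" "\<pi> (\<sigma> i) = i" if "i \<le> n" for i
    using \<pi> that f_the_inv_into_f[of \<pi> "{..n}" i]
    by (auto simp: \<sigma>_def bij_betw_def the_inv_into_f_f)
  have c': "\<forall>i\<le>n. ?c i \<noteq> 0" using c \<pi>n by simp
  have 1: "perm_tuple n \<pi> c (perm_tuple n \<sigma> ?c x) = 1 \<cdot>\<^sub>v x" if x: "x \<in> carrier_vec (n + 1)" for x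
  proof (rule eq_vecI)
    fix i assume "i < dim_vec (1 \<cdot>\<^sub>v x)"
    then have "i \<le> n" using x by simp
    then show "perm_tuple n \<pi> c (perm_tuple n \<sigma> ?c x) $ i = (1 \<cdot>\<^sub>v x) $ i"
      using x c \<pi>n[of i] inv[of i] by (simp add: perm_tuple_def)
  qed (use x in \<open>simp add: perm_tuple_def\<close>)
  have 2: "perm_tuple n \<sigma> ?c (perm_tuple n \<pi> c x) = 1 \<cdot>\<^sub>v x" if x: "x \<in> carrier_vec (n + 1)" for x
  proof (rule eq_vecI)
    fix i assume "i < dim_vec (1 \<cdot>\<^sub>v x)"
    then have "i \<le> n" using x by simp
    then show "perm_tuple n \<sigma> ?c (perm_tuple n \<pi> c x) $ i = (1 \<cdot>\<^sub>v x) $ i"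
      using x c \<pi>n[of i] inv[of i] by (simp add: perm_tuple_def)
  qed (use x in \<open>simp add: perm_tuple_def\<close>)
  show ?thesis
    by (rule birational_tupleI[OF hom[OF \<pi> c] hom[OF \<sigma> c'] poly_fun_coord0 _ poly_fun_coord0];
        intro exI[of _ 1] conjI one_neq_zero 1 2; assumption)
qed

lemma conjugate_bidiag_almost_diagonal:
  fixes d :: "nat \<Rightarrow> 'a::field_char_0"
  assumes d: "\<forall>i<n + 1. d i \<noteq> 0" and p: "p + 1 \<le> n" "d (p + 1) = d p"
  shows "\<exists>\<nu>\<in>torus (n - 1). conjugate_in (Bir_proj n)
    (rational_map_of n (\<lambda>x. bidiag_mat (n + 1) d {p} *\<^sub>v x)) (almost_diagonal_aut n \<nu>)"
proof -
  let ?t = "Transposition.transpose 0 (p + 1)"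
  \<comment> \<open>The first transposition brings p + 1 to index 0; the inner one then brings p to
    index 1, wherever the first has moved it. This includes p = 0.\<close>
  define \<pi> where "\<pi> = ?t \<circ> Transposition.transpose 1 (?t p)"
  have \<pi>01: "\<pi> 0 = p + 1" "\<pi> 1 = p" by (auto simp: \<pi>_def Transposition.transpose_def)
  have sw: "bij_betw (Transposition.transpose a b) {..n} {..n}" if "a \<le> n" "b \<le> n" for a b
    using that by (intro bij_betw_byWitness[of _ "Transposition.transpose a b"])
      (auto simp: Transposition.transpose_def)
  have "?t p \<le> n" using p by (auto simp: Transposition.transpose_def)
  then have \<pi>: "bij_betw \<pi> {..n} {..n}"
    unfolding \<pi>_def by (intro bij_betw_trans[OF sw sw]) (use p in auto)
  have \<pi>n: "\<pi> k \<le> n" if "k \<le> n" for k using bij_betwE[OF \<pi>] that by auto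
  have \<pi>ne: "\<pi> k \<noteq> p" "\<pi> k \<noteq> p + 1" if "k \<ge> 2" "k \<le> n" for k
  proof -
    have inj: "inj_on \<pi> {..n}" using \<pi> by (simp add: bij_betw_def)
    show "\<pi> k \<noteq> p" using inj_onD[OF inj, of k 1] \<pi>01 that by auto
    show "\<pi> k \<noteq> p + 1" using inj_onD[OF inj, of k 0] \<pi>01 that by auto
  qed
  \<comment> \<open>With y_0 = x_(p+1) and y_1 = d_p x_p the block acts by y_1 \<mapsto> d_p (y_1 +
    y_0). The projective factor d_p is divided out, which explains the quotients in \<nu>.\<close>
  define c where "c k = (if k = 1 then d p else 1)" for k :: nat
  define \<nu> where "\<nu> = vec (n - 1) (\<lambda>k. d (\<pi> (k + 2)) / d p)"
  have \<nu>: "\<nu> \<in> torus (n - 1)"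
    using d p \<pi>n by (auto simp: \<nu>_def torus_def less_Suc_eq_le)
  have c: "\<forall>k\<le>n. c k \<noteq> 0" using d p by (simp add: c_def)
  let ?J = "\<lambda>x. bidiag_mat (n + 1) d {p} *\<^sub>v x"
  let ?D = "lin_tuple n 1 (almost_diag_weights \<nu>)" and ?F = "perm_tuple n \<pi> c"
  have bir: "birational_tuple n ?F" "birational_tuple n ?J" "birational_tuple n ?D"
    by (rule birational_perm_tuple[OF \<pi> c] birational_tuple_linear[OF bidiag_mat_GL[OF d]]
      birational_lin_tuple[OF almost_diag_weights_nonzero[OF \<nu>]])+
  have "?F (?J x) = d p \<cdot>\<^sub>v ?D (?F x)" if x: "x \<in> carrier_vec (n + 1)" for x
  proof (rule eq_vecI)
    fix k assume "k < dim_vec (d p \<cdot>\<^sub>v ?D (?F x))"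
    then have k: "k \<le> n" by (simp add: lin_tuple_def)
    have Jx: "?J x $ \<pi> k = d (\<pi> k) * x $ \<pi> k + (if \<pi> k = p then x $ (p + 1) else 0)"
      using bidiag_mat_vec[OF x, of "\<pi> k"] \<pi>n[OF k] p by simp
    have F: "?F (?J x) $ k = c k * ?J x $ \<pi> k" using k by (simp add: perm_tuple_def)
    consider "k = 0" | "k = 1" | "k \<ge> 2" by linarith
    then show "?F (?J x) $ k = (d p \<cdot>\<^sub>v ?D (?F x)) $ k"
    proof cases
      case 1
      then show ?thesis unfolding F Jx using \<pi>01 p
        by (simp add: lin_tuple_def perm_tuple_def c_def almost_diag_weights_def)
    next
      case 2
      then show ?thesis unfolding F Jx using \<pi>01 p k
        by (simp add: lin_tuple_def perm_tuple_def c_def almost_diag_weights_def algebra_simps)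
    next
      case 3
      have "d p \<noteq> 0" using d p by simp
      moreover have "almost_diag_weights \<nu> k = d (\<pi> k) / d p"
      proof -
        have "Suc (Suc (k - 2)) = k" using 3 by simp
        then show ?thesis using 3 k by (simp add: almost_diag_weights_def \<nu>_def)
      qed
      ultimately show ?thesis unfolding F Jx using \<pi>ne[OF 3 k] 3 k
        by (simp add: lin_tuple_def perm_tuple_def c_def)
    qed
  qed (simp add: lin_tuple_def perm_tuple_def)
  then have "same_rational_map n (?F \<circ> ?J) (?D \<circ> ?F)"
    unfolding same_rational_map_iff_parallel comp_def
    using parallel_smult[OF lin_tuple_carrier] by metis
  then show ?thesis
    unfolding almost_diagonal_aut_eq using conjugate_in_Bir_proj_iff[OF bir(2,3)] bir(1) \<nu> by blast
qed

lemma rational_map_of_scaled: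
  fixes F G :: "'a::field_char_0 vec \<Rightarrow> 'a vec"
  assumes "homogeneous_tuple n F" "homogeneous_tuple n G"
    and "\<And>x. x \<in> carrier_vec (n + 1) \<Longrightarrow> F x = c \<cdot>\<^sub>v G x"
  shows "rational_map_of n F = rational_map_of n G"
  unfolding rational_map_of_eq_iff[OF assms(1,2)] same_rational_map_iff_parallel
  using assms(3) parallel_smult[OF homogeneous_tuple_carrier[OF assms(2)]] by metis

lemma bidiag_diagonal:
  fixes d :: "nat \<Rightarrow> 'a::field_char_0"
  assumes d: "\<forall>i<n + 1. d i \<noteq> 0"
  shows "\<exists>\<mu>\<in>torus n. rational_map_of n (\<lambda>x. bidiag_mat (n + 1) d {} *\<^sub>v x) = diagonal_aut n \<mu>"
proof
  let ?\<mu> = "vec n (\<lambda>i. d (i + 1) / d 0)"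
  show \<mu>: "?\<mu> \<in> torus n" using d by (auto simp: torus_def)
  show "rational_map_of n (\<lambda>x. bidiag_mat (n + 1) d {} *\<^sub>v x) = diagonal_aut n ?\<mu>"
    unfolding diagonal_aut_eq
  proof (rule rational_map_of_scaled[where c = "d 0"])
    fix x :: "'a vec" assume x: "x \<in> carrier_vec (n + 1)"
    show "bidiag_mat (n + 1) d {} *\<^sub>v x = d 0 \<cdot>\<^sub>v lin_tuple n 0 (diag_weights ?\<mu>) x"
    proof (rule eq_vecI)
      fix i assume "i < dim_vec (d 0 \<cdot>\<^sub>v lin_tuple n 0 (diag_weights ?\<mu>) x)"
      then have i: "i < n + 1" by (simp add: lin_tuple_def)
      then show "(bidiag_mat (n + 1) d {} *\<^sub>v x) $ i = (d 0 \<cdot>\<^sub>v lin_tuple n 0 (diag_weights ?\<mu>) x) $ i"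
        unfolding bidiag_mat_vec[OF x i] using d by (cases i) (auto simp: lin_tuple_def diag_weights_def)
    qed (simp add: lin_tuple_def bidiag_mat_def)
  qed (rule birational_tuple_homogeneous birational_tuple_linear bidiag_mat_GL[OF d]
        birational_lin_tuple[OF diag_weights_nonzero[OF \<mu>]])+
qed

lemma conjugate_similar:
  fixes M N :: "'a::field_char_0 mat"
  assumes sim: "similar_mat M N" and M: "M \<in> GL_mat (n + 1)" and N: "N \<in> GL_mat (n + 1)"
  shows "conjugate_in (Bir_proj n) (rational_map_of n (\<lambda>x. M *\<^sub>v x)) (rational_map_of n (\<lambda>x. N *\<^sub>v x))"
proof -
  obtain P Q where wit: "similar_mat_wit M N P Q" using sim unfolding similar_mat_def by blast
  note carr = GL_mat_carrier[OF M] GL_mat_carrier[OF N]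
  note w = similar_mat_witD2[OF carr(1) wit]
  have Q: "Q \<in> GL_mat (n + 1)" using w by (intro GL_matI[of Q _ P]) auto
  have "Q *\<^sub>v (M *\<^sub>v x) = N *\<^sub>v (Q *\<^sub>v x)" if x: "x \<in> carrier_vec (n + 1)" for x
  proof -
    have "Q * M = Q * (P * (N * Q))"
      using w(3) assoc_mult_mat[OF w(6) w(5) w(7)] by simp
    also have "\<dots> = (Q * P) * (N * Q)"
      using w(5-7) by (intro assoc_mult_mat[symmetric, OF w(7) w(6)]) auto
    also have "\<dots> = N * Q" using w by simp
    finally have "Q * M = N * Q" .
    moreover have "Q *\<^sub>v (M *\<^sub>v x) = (Q * M) *\<^sub>v x" "N *\<^sub>v (Q *\<^sub>v x) = (N * Q) *\<^sub>v x"
      using w(7) carr x by (auto intro!: assoc_mult_mat_vec[symmetric])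
    ultimately show ?thesis by simp
  qed
  then have "same_rational_map n ((\<lambda>x. Q *\<^sub>v x) \<circ> (\<lambda>x. M *\<^sub>v x)) ((\<lambda>x. N *\<^sub>v x) \<circ> (\<lambda>x. Q *\<^sub>v x))"
    unfolding same_rational_map_iff_parallel by (simp add: parallel_def mult.commute)
  then show ?thesis
    using conjugate_in_Bir_proj_iff[OF birational_tuple_linear[OF M] birational_tuple_linear[OF N]]
      birational_tuple_linear[OF Q] by blast
qed

lemma diagonal_aut_carrier:
  fixes \<mu> :: "'a::field_char_0 vec"
  shows "\<mu> \<in> torus n \<Longrightarrow> diagonal_aut n \<mu> \<in> carrier (Bir_proj n)"
  unfolding diagonal_aut_eq using birational_lin_tuple[OF diag_weights_nonzero] by auto

lemma almost_diagonal_aut_carrier: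
  fixes \<nu> :: "'a::field_char_0 vec"
  shows "\<nu> \<in> torus (n - 1) \<Longrightarrow> almost_diagonal_aut n \<nu> \<in> carrier (Bir_proj n)"
  unfolding almost_diagonal_aut_eq using birational_lin_tuple[OF almost_diag_weights_nonzero] by auto

lemma Aut_proj_normal_form:
  fixes f :: "'a::{alg_closed_field, field_char_0} rational_map"
  assumes f: "f \<in> Aut_proj n"
  shows "(\<exists>\<mu>\<in>torus n. conjugate_in (Bir_proj n) f (diagonal_aut n \<mu>)) \<or>
    (\<exists>\<nu>\<in>torus (n - 1). conjugate_in (Bir_proj n) f (almost_diagonal_aut n \<nu>))"
proof -
  obtain M where M: "M \<in> GL_mat (n + 1)" "f = rational_map_of n (\<lambda>x. M *\<^sub>v x)"
    using f unfolding Aut_proj_def by blast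
  obtain d S where dS: "similar_mat M (bidiag_mat (n + 1) d S)" "\<forall>i<n + 1. d i \<noteq> 0"
    "\<forall>i\<in>S. i + 1 < n + 1 \<and> d (i + 1) = d i" using similar_bidiag_mat[OF M(1)] .
  let ?J = "\<lambda>S. rational_map_of n (\<lambda>x. bidiag_mat (n + 1) d S *\<^sub>v x)"
  have fJ: "conjugate_in (Bir_proj n) f (?J S)"
    unfolding M(2) by (rule conjugate_similar[OF dS(1) M(1) bidiag_mat_GL[OF dS(2)]])
  have carr: "f \<in> carrier (Bir_proj n)" "?J S' \<in> carrier (Bir_proj n)" for S'
    using f Aut_proj_subset birational_tuple_linear[OF bidiag_mat_GL[OF dS(2)]] by auto
  note trans = group.conjugate_in_trans[OF group_Bir_proj]
  show ?thesis
  proof (cases "S = {}")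
    case True
    then show ?thesis using fJ bidiag_diagonal[OF dS(2)] by auto
  next
    case False
    have fin: "finite S" using dS(3) by (intro finite_subset[of S "{..n}"]) auto
    \<comment> \<open>The last superdiagonal 1 ends a block and is the one that survives the
      reduction.\<close>
    define p where "p = Max S"
    have p: "p \<in> S" "p + 1 \<notin> S"
      using Max_in[OF fin False] Max_ge[OF fin, of "p + 1"] by (auto simp: p_def)
    have single: "conjugate_in (Bir_proj n) (?J S) (?J {p})"
      by (rule conjugate_bidiag_single[OF dS(2,3) p])
    have "p + 1 \<le> n" "d (p + 1) = d p" using dS(3) p(1) by auto
    then obtain \<nu> where \<nu>: "\<nu> \<in> torus (n - 1)"
      "conjugate_in (Bir_proj n) (?J {p}) (almost_diagonal_aut n \<nu>)"
      using conjugate_bidiag_almost_diagonal[OF dS(2)] by blast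
    have "conjugate_in (Bir_proj n) f (?J {p})" by (rule trans[OF fJ single carr(1) carr(2) carr(2)])
    then have "conjugate_in (Bir_proj n) f (almost_diagonal_aut n \<nu>)"
      using trans[OF _ \<nu>(2) carr(1) carr(2) almost_diagonal_aut_carrier[OF \<nu>(1)]] by blast
    then show ?thesis using \<nu>(1) by blast
  qed
qed

subsection \<open>Exponential polynomials\<close>

text \<open>The operator \<open>g(k) \<mapsto> g(k + 1) - \<tau> g(k)\<close> lowers the degree of the coefficient of \<open>\<tau>^k\<close> and
  preserves the degrees of the others.\<close>

lemma exp_poly_independent:
  fixes p :: "'a::field_char_0 \<Rightarrow> 'a poly"
  assumes "finite S" "0 \<notin> S" "\<And>k :: nat. (\<Sum>\<sigma>\<in>S. poly (p \<sigma>) (of_nat k) * \<sigma> ^ k) = 0"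
  shows "\<forall>\<sigma>\<in>S. p \<sigma> = 0"
  using assms(3)
\<comment> \<open>A nonzero coefficient counts with its degree plus one, so that a constant that
  becomes zero also decreases the measure.\<close>
proof (induction "\<Sum>\<sigma>\<in>S. if p \<sigma> = 0 then 0 else Suc (degree (p \<sigma>))" arbitrary: p rule: less_induct)
  case less
  show ?case
  proof (rule ccontr)
    assume "\<not> ?thesis"
    then obtain \<tau> where \<tau>: "\<tau> \<in> S" "p \<tau> \<noteq> 0" by blast
    have "\<tau> \<noteq> 0" using \<tau>(1) assms(2) by blast
    define q where "q \<sigma> = p \<sigma> \<circ>\<^sub>p [:1, 1:]" for \<sigma>
    define p' where "p' \<sigma> = smult \<sigma> (q \<sigma>) - smult \<tau> (p \<sigma>)" for \<sigma>
    have poly_q: "poly (q \<sigma>) (of_nat k) = poly (p \<sigma>) (of_nat (Suc k))" for \<sigma> k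
      by (simp add: q_def poly_pcompose)
    have deg_q: "degree (q \<sigma>) = degree (p \<sigma>)" for \<sigma> by (simp add: q_def)
    have lc_q: "coeff (q \<sigma>) (degree (p \<sigma>)) = lead_coeff (p \<sigma>)" for \<sigma>
      using lead_coeff_comp[of "[:1, 1:]" "p \<sigma>"] deg_q[of \<sigma>] by (simp add: q_def)
    have deg_p': "degree (p' \<sigma>) \<le> degree (p \<sigma>)" for \<sigma>
      unfolding p'_def by (intro degree_diff_le order_trans[OF degree_smult_le]) (simp_all add: deg_q)
    have "p' \<sigma> = 0" if "p \<sigma> = 0" for \<sigma> using that by (simp add: p'_def q_def)
    then have le: "(if p' \<sigma> = 0 then 0 else Suc (degree (p' \<sigma>))) \<le> (if p \<sigma> = 0 then 0 else Suc (degree (p \<sigma>)))"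
      for \<sigma> using deg_p'[of \<sigma>] by simp
    have "coeff (p' \<tau>) (degree (p \<tau>)) = 0" using lc_q[of \<tau>] by (simp add: p'_def)
    then have "p' \<tau> = 0 \<or> degree (p' \<tau>) < degree (p \<tau>)"
      using deg_p'[of \<tau>] by (metis leading_coeff_0_iff le_neq_implies_less)
    then have "(\<Sum>\<sigma>\<in>S. if p' \<sigma> = 0 then 0 else Suc (degree (p' \<sigma>))) <
        (\<Sum>\<sigma>\<in>S. if p \<sigma> = 0 then 0 else Suc (degree (p \<sigma>)))"
      using \<tau> le assms(1) by (intro sum_strict_mono_ex1) auto
    moreover have "(\<Sum>\<sigma>\<in>S. poly (p' \<sigma>) (of_nat k) * \<sigma> ^ k) = 0" for k
    proof -
      have "(\<Sum>\<sigma>\<in>S. poly (p' \<sigma>) (of_nat k) * \<sigma> ^ k) =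
        (\<Sum>\<sigma>\<in>S. poly (p \<sigma>) (of_nat (Suc k)) * \<sigma> ^ Suc k) - \<tau> * (\<Sum>\<sigma>\<in>S. poly (p \<sigma>) (of_nat k) * \<sigma> ^ k)"
        unfolding sum_distrib_left sum_subtractf[symmetric]
        by (intro sum.cong refl) (simp add: p'_def poly_q algebra_simps)
      then show ?thesis using less.prems[of k] less.prems[of "Suc k"] by simp
    qed
    ultimately have zero: "\<forall>\<sigma>\<in>S. p' \<sigma> = 0" by (rule less.hyps)
    have others: "p \<sigma> = 0" if "\<sigma> \<in> S" "\<sigma> \<noteq> \<tau>" for \<sigma>
    proof -
      have "coeff (p' \<sigma>) (degree (p \<sigma>)) = (\<sigma> - \<tau>) * lead_coeff (p \<sigma>)"
        using lc_q[of \<sigma>] by (simp add: p'_def algebra_simps)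
      then show ?thesis using zero that by simp
    qed
    have "poly (p \<tau>) (of_nat k) = 0" for k
    proof -
      have "(\<Sum>\<sigma>\<in>S. poly (p \<sigma>) (of_nat k) * \<sigma> ^ k) = poly (p \<tau>) (of_nat k) * \<tau> ^ k"
        using others assms(1) \<tau>(1) by (subst sum.remove[of _ \<tau>]) (auto intro!: sum.neutral)
      then show ?thesis using less.prems[of k] \<open>\<tau> \<noteq> 0\<close> by simp
    qed
    \<comment> \<open>Only the base \<tau> is left, and its coefficient has infinitely many roots
      because the naturals embed in characteristic 0.\<close>
    then have "range (of_nat :: nat \<Rightarrow> 'a) \<subseteq> {x. poly (p \<tau>) x = 0}" by auto
    moreover have "infinite (range (of_nat :: nat \<Rightarrow> 'a))"
      using finite_imageD[of "of_nat :: nat \<Rightarrow> 'a" UNIV] by (auto simp: inj_on_def)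
    ultimately show False using poly_roots_finite[OF \<tau>(2)] finite_subset by blast
  qed
qed

text \<open>Bases with different indices may coincide, so only the total coefficient belonging to
  each value of the base has to vanish.\<close>

lemma exp_poly_fibres:
  fixes p :: "'i \<Rightarrow> 'a::field_char_0 poly"
  assumes "finite I" "\<And>i. i \<in> I \<Longrightarrow> b i \<noteq> 0"
    and "\<And>k :: nat. (\<Sum>i\<in>I. poly (p i) (of_nat k) * b i ^ k) = 0"
  shows "(\<Sum>i\<in>{i\<in>I. b i = \<beta>}. p i) = 0"
proof (cases "\<beta> \<in> b ` I")
  case True
  have "(\<Sum>\<sigma>\<in>b ` I. poly (\<Sum>i\<in>{i\<in>I. b i = \<sigma>}. p i) (of_nat k) * \<sigma> ^ k) = 0" for k
  proof -
    have "(\<Sum>i\<in>I. poly (p i) (of_nat k) * b i ^ k) =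
      (\<Sum>\<sigma>\<in>b ` I. \<Sum>i\<in>{i\<in>I. b i = \<sigma>}. poly (p i) (of_nat k) * b i ^ k)"
      by (rule sum.image_gen[OF assms(1)])
    also have "\<dots> = (\<Sum>\<sigma>\<in>b ` I. poly (\<Sum>i\<in>{i\<in>I. b i = \<sigma>}. p i) (of_nat k) * \<sigma> ^ k)"
      by (intro sum.cong refl) (auto simp: poly_sum sum_distrib_right)
    finally show ?thesis using assms(3) by simp
  qed
  then have "\<forall>\<sigma>\<in>b ` I. (\<Sum>i\<in>{i\<in>I. b i = \<sigma>}. p i) = 0"
    using assms(1,2) by (intro exp_poly_independent) auto
  then show ?thesis using True by blast
next
  case False
  then have "{i\<in>I. b i = \<beta>} = {}" by auto
  then show ?thesis by (simp only: sum.empty)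
qed

subsection \<open>Orbits\<close>

lemma lin_tuple_surj:
  fixes l :: "nat \<Rightarrow> 'a::field"
  assumes l: "\<forall>i\<le>n. l i \<noteq> 0" and y: "y \<in> carrier_vec (n + 1)"
  shows "\<exists>x\<in>carrier_vec (n + 1). lin_tuple n \<epsilon> l x = y"
proof
  let ?x = "lin_tuple n (- \<epsilon> / (l 0 * l 1)) (\<lambda>i. 1 / l i) y"
  show "?x \<in> carrier_vec (n + 1)" by (rule lin_tuple_carrier)
  show "lin_tuple n \<epsilon> l ?x = y"
    using y l by (auto intro!: eq_vecI simp: lin_tuple_def divide_simps)
qed

lemma poly_fun_upoly:
  assumes "poly_fun k f"
  shows "poly_fun k (\<lambda>y. poly r (f y))"
  unfolding poly_altdef by (intro poly_fun_sum poly_fun_mult poly_fun_const poly_fun_power assms)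

text \<open>The additive term is allowed only beside weight 1. The linear part on coordinates 0 and
  1 is then unipotent if \<epsilon> \<noteq> 0, and the k-th iterate has the same shape with
  parameters k \<epsilon> and l_i^k.\<close>

locale affine_diagonal =
  fixes n :: nat and \<epsilon> :: "'a::field_char_0" and l :: "nat \<Rightarrow> 'a"
  assumes l_nonzero: "\<forall>i\<le>n. l i \<noteq> 0" and l0: "l 0 = 1" and l1: "\<epsilon> = 0 \<or> l 1 = 1"
begin

abbreviation M :: "'a vec \<Rightarrow> 'a vec" where "M \<equiv> lin_tuple n \<epsilon> l"

definition orbit :: "nat \<Rightarrow> 'a vec \<Rightarrow> 'a vec" where
  "orbit k = lin_tuple n (of_nat k * \<epsilon>) (\<lambda>i. l i ^ k)"

lemma orbit_carrier: "orbit k x \<in> carrier_vec (n + 1)"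
  unfolding orbit_def by (rule lin_tuple_carrier)

lemma orbit_0: "x \<in> carrier_vec (n + 1) \<Longrightarrow> orbit 0 x = x"
  by (rule eq_vecI) (auto simp: orbit_def lin_tuple_def)

lemma orbit_Suc: "M (orbit k x) = orbit (Suc k) x"
  by (rule eq_vecI) (use l0 l1 in \<open>auto simp: orbit_def lin_tuple_def algebra_simps\<close>)

lemma orbit_surj: "y \<in> carrier_vec (n + 1) \<Longrightarrow> \<exists>x\<in>carrier_vec (n + 1). orbit k x = y"
  unfolding orbit_def using l_nonzero by (intro lin_tuple_surj) auto

lemma poly_fun_orbit:
  assumes "poly_fun (n + 1) Q"
  shows "poly_fun (n + 1) (\<lambda>x. Q (orbit k x))"
proof (rule poly_fun_compose[OF assms])
  fix i assume "i < n + 1"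
  then show "poly_fun (n + 1) (\<lambda>x. orbit k x $ i)"
    unfolding orbit_def lin_tuple_def
    by (cases "i = 1") (auto intro!: poly_fun_add poly_fun_mult poly_fun_coord)
qed (rule orbit_carrier)

text \<open>With \<open>f = P / Q\<close>, this covers both \<open>f \<circ> M = a f\<close> and \<open>f \<circ> M = f + b\<close>.\<close>

lemma orbit_relation:
  assumes P: "poly_fun (n + 1) P" and Q: "poly_fun (n + 1) Q" "\<exists>x\<in>carrier_vec (n + 1). Q x \<noteq> 0"
    and ab: "a = 1 \<or> b = 0"
    and rel: "\<And>x. x \<in> carrier_vec (n + 1) \<Longrightarrow> P (M x) * Q x = (a * P x + b * Q x) * Q (M x)"
    and x: "x \<in> carrier_vec (n + 1)"
  shows "P (orbit k x) * Q x = (a ^ k * P x + of_nat k * b * Q x) * Q (orbit k x)"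
  using x
proof (induction k arbitrary: x)
  case 0
  then show ?case by (simp add: orbit_0)
next
  case (Suc k)
  note poly = P Q(1) poly_fun_orbit[OF P] poly_fun_orbit[OF Q(1)]
  \<comment> \<open>The induction step cancels Q at the k-th iterate. This factor is not identically
    zero because the iterate is surjective, and the cancelled identity extends by density.\<close>
  obtain y where y: "y \<in> carrier_vec (n + 1)" "Q y \<noteq> 0" using Q(2) by blast
  then have nz: "\<exists>x\<in>carrier_vec (n + 1). Q (orbit k x) \<noteq> 0" using orbit_surj by metis
  show ?case
  proof (rule poly_fun_eq_if_generic[OF _ _ poly(4) nz _ Suc.prems])
    show "poly_fun (n + 1) (\<lambda>x. P (orbit (Suc k) x) * Q x)"
      "poly_fun (n + 1) (\<lambda>x. (a ^ Suc k * P x + of_nat (Suc k) * b * Q x) * Q (orbit (Suc k) x))"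
      by (intro poly_fun_mult poly_fun_add poly_fun_const poly)+
    fix z assume z: "z \<in> carrier_vec (n + 1)" "Q (orbit k z) \<noteq> 0"
    have 1: "P (orbit (Suc k) z) * Q (orbit k z) = (a * P (orbit k z) + b * Q (orbit k z)) * Q (orbit (Suc k) z)"
      using rel[OF orbit_carrier, of k z] by (simp add: orbit_Suc)
    have 2: "P (orbit k z) * Q z = (a ^ k * P z + of_nat k * b * Q z) * Q (orbit k z)"
      by (rule Suc.IH[OF z(1)])
    have "Q (orbit k z) * (P (orbit (Suc k) z) * Q z) =
        (a * (P (orbit k z) * Q z) + b * Q (orbit k z) * Q z) * Q (orbit (Suc k) z)"
      using 1 by (simp add: algebra_simps)
    also have "\<dots> = Q (orbit k z) * ((a * (a ^ k * P z + of_nat k * b * Q z) + b * Q z) * Q (orbit (Suc k) z))"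
      unfolding 2 by (simp add: algebra_simps)
    also have "a * (a ^ k * P z + of_nat k * b * Q z) + b * Q z = a ^ Suc k * P z + of_nat (Suc k) * b * Q z"
      using ab by (auto simp: algebra_simps)
    finally show "P (orbit (Suc k) z) * Q z = (a ^ Suc k * P z + of_nat (Suc k) * b * Q z) * Q (orbit (Suc k) z)"
      using z(2) by simp
  qed
qed

section \<open>Polynomial functions along orbits as exponential polynomials\<close>

definition base :: "(nat \<Rightarrow> nat) \<Rightarrow> 'a" where
  "base e = (\<Prod>i<n + 1. l i ^ e i)"

text \<open>The unipotent part of the iterates, with the exponent k replaced by an arbitrary scalar
  t. A monomial at the k-th iterate is \<open>base e ^ k\<close> times its value at
  \<open>shift k x\<close>, and \<open>orbit_poly\<close> is that value as a polynomial in
  t.\<close>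

definition shift :: "'a \<Rightarrow> 'a vec \<Rightarrow> 'a vec" where
  "shift t x = vec (n + 1) (\<lambda>i. x $ i + (if i = 1 then t * \<epsilon> * x $ 0 else 0))"

definition orbit_poly :: "(nat \<Rightarrow> nat) \<Rightarrow> 'a vec \<Rightarrow> 'a poly" where
  "orbit_poly e x = (\<Prod>i<n + 1. [:x $ i, if i = 1 then \<epsilon> * x $ 0 else 0:] ^ e i)"

lemma base_nonzero: "base e \<noteq> 0"
  using l_nonzero by (auto simp: base_def less_Suc_eq_le)

lemma poly_orbit_poly: "poly (orbit_poly e x) t = monomial_fun (n + 1) e (shift t x)"
  unfolding orbit_poly_def poly_prod monomial_fun_def
  by (intro prod.cong) (auto simp: shift_def mult.assoc)

lemma monomial_fun_orbit:
  "monomial_fun (n + 1) e (orbit k x) = poly (orbit_poly e x) (of_nat k) * base e ^ k"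
proof -
  \<comment> \<open>At index 1 the weight can be factored out of the additive term too, since it is
    1 unless \<epsilon> = 0.\<close>
  have "orbit k x $ i = l i ^ k * shift (of_nat k) x $ i" if "i < n + 1" for i
    using that l1 by (auto simp: orbit_def lin_tuple_def shift_def)
  then have "monomial_fun (n + 1) e (orbit k x) = (\<Prod>i<n + 1. (l i ^ e i) ^ k * shift (of_nat k) x $ i ^ e i)"
    unfolding monomial_fun_def
  proof (intro prod.cong refl)
    fix i assume "i \<in> {..<n + 1}"
    moreover have "(l i ^ k) ^ e i = (l i ^ e i) ^ k" by (metis power_mult mult.commute)
    ultimately show "orbit k x $ i ^ e i = (l i ^ e i) ^ k * shift (of_nat k) x $ i ^ e i"
      using \<open>\<And>i. i < n + 1 \<Longrightarrow> orbit k x $ i = l i ^ k * shift (of_nat k) x $ i\<close>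
      by (simp add: power_mult_distrib)
  qed
  then show ?thesis
    unfolding poly_orbit_poly base_def prod_power_distrib monomial_fun_def prod.distrib
    by (simp only: mult.commute)
qed

lemma shift_0: "x \<in> carrier_vec (n + 1) \<Longrightarrow> shift 0 x = x"
  by (rule eq_vecI) (auto simp: shift_def)

lemma poly_fun_orbit_expansion:
  assumes "poly_fun (n + 1) P"
  obtains E :: "(nat \<Rightarrow> nat) set" and c where "finite E"
    "\<And>x. x \<in> carrier_vec (n + 1) \<Longrightarrow> P x = (\<Sum>e\<in>E. c e * monomial_fun (n + 1) e x)"
    "\<And>k x. P (orbit k x) = (\<Sum>e\<in>E. poly (smult (c e) (orbit_poly e x)) (of_nat k) * base e ^ k)"
proof -
  obtain E c where E: "finite E" "\<And>x. x \<in> carrier_vec (n + 1) \<Longrightarrow> P x = (\<Sum>e\<in>E. c e * monomial_fun (n + 1) e x)"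
    using poly_funE[OF assms] by blast
  have "P (orbit k x) = (\<Sum>e\<in>E. poly (smult (c e) (orbit_poly e x)) (of_nat k) * base e ^ k)" for k x
    unfolding E(2)[OF orbit_carrier] monomial_fun_orbit by (simp add: mult.assoc)
  then show thesis using that E by blast
qed

text \<open>Along an orbit P(M^k x) Q(x) = a^k P(x) Q(M^k x). The left side has bases
  \<open>base e\<close>, the right side a times such bases. If none coincided, independence would
  annihilate every coefficient on the right and force Q(x) = 0.\<close>

lemma semi_invariant_eigenvalue:
  assumes P: "poly_fun (n + 1) P" "\<exists>x\<in>carrier_vec (n + 1). P x \<noteq> 0"
    and Q: "poly_fun (n + 1) Q" "\<exists>x\<in>carrier_vec (n + 1). Q x \<noteq> 0" and a: "a \<noteq> 0"
    and rel: "\<And>x. x \<in> carrier_vec (n + 1) \<Longrightarrow> P (M x) * Q x = a * P x * Q (M x)"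
  shows "\<exists>e e'. base e = a * base e'"
proof (rule ccontr)
  assume none: "\<not> ?thesis"
  obtain x where x: "x \<in> carrier_vec (n + 1)" "P x \<noteq> 0" "Q x \<noteq> 0"
    using poly_fun_common_nonzero[OF P Q] by blast
  have orb: "P (orbit k x) * Q x = a ^ k * P x * Q (orbit k x)" for k
    using orbit_relation[OF P(1) Q, of a 0 x k] rel x(1) by simp
  obtain E c where E: "finite E"
    "\<And>x. x \<in> carrier_vec (n + 1) \<Longrightarrow> P x = (\<Sum>e\<in>E. c e * monomial_fun (n + 1) e x)"
    "\<And>k x. P (orbit k x) = (\<Sum>e\<in>E. poly (smult (c e) (orbit_poly e x)) (of_nat k) * base e ^ k)"
    by (rule poly_fun_orbit_expansion[OF P(1)]) (rule that)
  obtain E' c' where E': "finite E'"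
    "\<And>x. x \<in> carrier_vec (n + 1) \<Longrightarrow> Q x = (\<Sum>e\<in>E'. c' e * monomial_fun (n + 1) e x)"
    "\<And>k x. Q (orbit k x) = (\<Sum>e\<in>E'. poly (smult (c' e) (orbit_poly e x)) (of_nat k) * base e ^ k)"
    by (rule poly_fun_orbit_expansion[OF Q(1)]) (rule that)
  define p where "p = case_sum (\<lambda>e. smult (c e * Q x) (orbit_poly e x)) (\<lambda>e. smult (- c' e * P x) (orbit_poly e x))"
  define b where "b = case_sum base (\<lambda>e. a * base e)"
  have fibre: "(\<Sum>i\<in>{i\<in>E <+> E'. b i = \<beta>}. p i) = 0" for \<beta>
  proof (rule exp_poly_fibres)
    show "finite (E <+> E')" using E E' by simp
    show "b i \<noteq> 0" for i by (cases i) (auto simp: b_def base_nonzero a)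
    show "(\<Sum>i\<in>E <+> E'. poly (p i) (of_nat k) * b i ^ k) = 0" for k
    proof -
      have "(\<Sum>i\<in>E <+> E'. poly (p i) (of_nat k) * b i ^ k) = P (orbit k x) * Q x - a ^ k * P x * Q (orbit k x)"
        unfolding E(3) E'(3) sum.Plus[OF E(1) E'(1)] p_def b_def
        by (simp add: sum_distrib_left sum_distrib_right power_mult_distrib mult_ac sum_negf)
      then show ?thesis using orb by simp
    qed
  qed
  have zero: "(\<Sum>e\<in>{e\<in>E'. a * base e = \<beta>}. c' e * monomial_fun (n + 1) e x) = 0" for \<beta>
  proof (cases "{e\<in>E'. a * base e = \<beta>} = {}")
    case False
    then have "{i\<in>E <+> E'. b i = \<beta>} = Inr ` {e\<in>E'. a * base e = \<beta>}"
      using none by (auto simp: b_def)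
    then have "(\<Sum>e\<in>{e\<in>E'. a * base e = \<beta>}. p (Inr e)) = 0"
      using fibre[of \<beta>] by (simp add: sum.reindex)
    \<comment> \<open>Evaluation at 0 recovers the monomials at x itself.\<close>
    then have "poly (\<Sum>e\<in>{e\<in>E'. a * base e = \<beta>}. p (Inr e)) 0 = 0" by simp
    then have "(\<Sum>e\<in>{e\<in>E'. a * base e = \<beta>}. P x * (c' e * monomial_fun (n + 1) e x)) = 0"
      by (simp add: poly_sum p_def poly_orbit_poly shift_0[OF x(1)] sum_negf mult_ac)
    then show ?thesis using x(2) unfolding sum_distrib_left[symmetric] by simp
  qed (simp only: sum.empty)
  have "Q x = (\<Sum>\<beta>\<in>(\<lambda>e. a * base e) ` E'. \<Sum>e\<in>{e\<in>E'. a * base e = \<beta>}. c' e * monomial_fun (n + 1) e x)"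
    unfolding E'(2)[OF x(1)] by (rule sum.image_gen[OF E'(1)])
  then show False using zero x(3) by simp
qed

text \<open>For \<epsilon> = 0 the coefficients in P(M^k x) and Q(M^k x) are constant in k, whereas
  the relation multiplies Q(M^k x) by P(x) + k Q(x). The part linear in k therefore has to vanish
  for every base, which gives Q(x) = 0.\<close>

lemma no_additive_semi_invariant:
  assumes P: "poly_fun (n + 1) P" and Q: "poly_fun (n + 1) Q" "\<exists>x\<in>carrier_vec (n + 1). Q x \<noteq> 0"
    and rel: "\<And>x. x \<in> carrier_vec (n + 1) \<Longrightarrow> P (M x) * Q x = (P x + Q x) * Q (M x)"
    and \<epsilon>: "\<epsilon> = 0"
  shows False
proof -
  obtain x where x: "x \<in> carrier_vec (n + 1)" "Q x \<noteq> 0" using Q(2) by blast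
  have orb: "P (orbit k x) * Q x = (P x + of_nat k * Q x) * Q (orbit k x)" for k
    using orbit_relation[OF P Q, of 1 1 x k] rel x(1) by simp
  obtain E c where E: "finite E"
    "\<And>x. x \<in> carrier_vec (n + 1) \<Longrightarrow> P x = (\<Sum>e\<in>E. c e * monomial_fun (n + 1) e x)"
    "\<And>k x. P (orbit k x) = (\<Sum>e\<in>E. poly (smult (c e) (orbit_poly e x)) (of_nat k) * base e ^ k)"
    by (rule poly_fun_orbit_expansion[OF P]) (rule that)
  obtain E' c' where E': "finite E'"
    "\<And>x. x \<in> carrier_vec (n + 1) \<Longrightarrow> Q x = (\<Sum>e\<in>E'. c' e * monomial_fun (n + 1) e x)"
    "\<And>k x. Q (orbit k x) = (\<Sum>e\<in>E'. poly (smult (c' e) (orbit_poly e x)) (of_nat k) * base e ^ k)"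
    by (rule poly_fun_orbit_expansion[OF Q(1)]) (rule that)
  define m where "m e = monomial_fun (n + 1) e x" for e
  have "shift t x = x" for t unfolding shift_def by (intro eq_vecI) (use x(1) \<epsilon> in auto)
  then have "poly (orbit_poly e x) t = m e" for e t
    unfolding poly_orbit_poly m_def by simp
  then have const: "orbit_poly e x = [:m e:]" for e
    by (intro poly_eq_poly_eq_iff[THEN iffD1] ext) simp
  define p where "p = case_sum (\<lambda>e. [:c e * Q x * m e:]) (\<lambda>e. [:P x, Q x:] * [:- c' e * m e:])"
  define b where "b = case_sum base base"
  have fibre: "(\<Sum>i\<in>{i\<in>E <+> E'. b i = \<beta>}. p i) = 0" for \<beta>
  proof (rule exp_poly_fibres)
    show "finite (E <+> E')" using E E' by simp
    show "b i \<noteq> 0" for i by (cases i) (auto simp: b_def base_nonzero)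
    show "(\<Sum>i\<in>E <+> E'. poly (p i) (of_nat k) * b i ^ k) = 0" for k
    proof -
      have "(\<Sum>e\<in>E. poly (p (Inl e)) (of_nat k) * b (Inl e) ^ k) = P (orbit k x) * Q x"
        unfolding E(3) const sum_distrib_right
        by (intro sum.cong refl) (simp add: p_def b_def mult_ac)
      moreover have "(\<Sum>e\<in>E'. poly (p (Inr e)) (of_nat k) * b (Inr e) ^ k) =
          - ((P x + of_nat k * Q x) * Q (orbit k x))"
        unfolding E'(3) const sum_distrib_left sum_negf[symmetric]
        by (intro sum.cong refl) (simp add: p_def b_def algebra_simps)
      ultimately show ?thesis using orb unfolding sum.Plus[OF E(1) E'(1)] by simp
    qed
  qed
  have zero: "(\<Sum>e\<in>{e\<in>E'. base e = \<beta>}. c' e * m e) = 0" for \<beta>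
  proof -
    have "{i\<in>E <+> E'. b i = \<beta>} = {e\<in>E. base e = \<beta>} <+> {e\<in>E'. base e = \<beta>}"
      by (auto simp: b_def)
    then have "(\<Sum>e\<in>{e\<in>E. base e = \<beta>}. p (Inl e)) + (\<Sum>e\<in>{e\<in>E'. base e = \<beta>}. p (Inr e)) = 0"
      using fibre[of \<beta>] E(1) E'(1) by (simp add: sum.Plus)
    \<comment> \<open>Coefficient 1: the terms from P are constant polynomials and drop out.\<close>
    then have "coeff ((\<Sum>e\<in>{e\<in>E. base e = \<beta>}. p (Inl e)) + (\<Sum>e\<in>{e\<in>E'. base e = \<beta>}. p (Inr e))) 1 = 0"
      by simp
    then have "(\<Sum>e\<in>{e\<in>E'. base e = \<beta>}. Q x * (c' e * m e)) = 0"
      by (simp add: coeff_sum p_def sum_negf mult_ac)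
    then show ?thesis using x(2) unfolding sum_distrib_left[symmetric] by simp
  qed
  have "Q x = (\<Sum>\<beta>\<in>base ` E'. \<Sum>e\<in>{e\<in>E'. base e = \<beta>}. c' e * m e)"
    unfolding E'(2)[OF x(1)] m_def by (rule sum.image_gen[OF E'(1)])
  then show False using zero x(2) by simp
qed

section \<open>Density of orbits in the free coordinates\<close>

definition mid :: "nat set" where
  "mid = {(if \<epsilon> = 0 then 1 else 2)..<n}"

text \<open>\<open>mid\<close> leaves out index 0, the additive index 1 if \<epsilon> \<noteq> 0,
  and the torsion index n. Independence is stated as separation of monomials in the m-th powers of
  the remaining weights, the form in which bases of exponential polynomials are compared.\<close>

definition mid_independent :: "nat \<Rightarrow> bool" where
  "mid_independent m \<longleftrightarrow> (\<forall>e e'. (\<Prod>i\<in>mid. l i ^ (m * e i)) = (\<Prod>i\<in>mid. l i ^ (m * e' i)) \<longrightarrow>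
    (\<forall>i\<in>mid. e i = (e' i :: nat)))"

text \<open>Powers of independent weights are Zariski dense in a torus, so the closure of the orbit
  contains all points with the same first and last coordinates.\<close>

lemma orbit_dense:
  assumes R: "poly_fun (n + 1) R" and n: "(if \<epsilon> = 0 then 1 else 2) \<le> n"
    and m: "m > 0" "l n ^ m = 1" and indep: "mid_independent m"
    and x: "x \<in> torus (n + 1)" and orb: "\<And>k. R (orbit (m * k) x) = 0"
    and z: "z \<in> carrier_vec (n + 1)" "z $ 0 = x $ 0" "z $ n = x $ n"
  shows "R z = 0"
proof -
  obtain E c where E: "finite E"
    "\<And>x. x \<in> carrier_vec (n + 1) \<Longrightarrow> R x = (\<Sum>e\<in>E. c e * monomial_fun (n + 1) e x)"
    "\<And>k x. R (orbit k x) = (\<Sum>e\<in>E. poly (smult (c e) (orbit_poly e x)) (of_nat k) * base e ^ k)"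
    by (rule poly_fun_orbit_expansion[OF R]) (rule that)
  have base_m: "base e ^ m = (\<Prod>i\<in>mid. l i ^ (m * e i))" for e
  proof -
    have "base e ^ m = (\<Prod>i<n + 1. l i ^ (m * e i))"
      unfolding base_def prod_power_distrib by (simp only: power_mult[symmetric] mult.commute)
    also have "\<dots> = (\<Prod>i\<in>mid. l i ^ (m * e i))"
    proof (rule prod.mono_neutral_right)
      show "\<forall>i\<in>{..<n + 1} - mid. l i ^ (m * e i) = 1"
      proof
        fix i assume "i \<in> {..<n + 1} - mid"
        then have "i = 0 \<or> i = n \<or> i = 1 \<and> \<epsilon> \<noteq> 0" unfolding mid_def by (auto split: if_splits)
        then show "l i ^ (m * e i) = 1" using l0 l1 m(2) by (auto simp: power_mult)
      qed
    qed (auto simp: mid_def)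
    finally show ?thesis .
  qed
  \<comment> \<open>The parameter for which the unipotent shift takes x_1 to z_1. It need not be a
    natural number.\<close>
  define T where "T = (if \<epsilon> = 0 then 0 else (z $ 1 - x $ 1) / (\<epsilon> * x $ 0))"
  have fibre: "(\<Sum>e\<in>{e\<in>E. base e ^ m = \<beta>}. c e * monomial_fun (n + 1) e (shift T x)) = 0" for \<beta>
  proof -
    let ?p = "\<lambda>e. pcompose (smult (c e) (orbit_poly e x)) [:0, of_nat m:]"
    have "(\<Sum>e\<in>{e\<in>E. base e ^ m = \<beta>}. ?p e) = 0"
    proof (rule exp_poly_fibres[OF E(1)])
      show "base e ^ m \<noteq> 0" for e using base_nonzero by simp
      show "(\<Sum>e\<in>E. poly (?p e) (of_nat k) * (base e ^ m) ^ k) = 0" for k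
        using orb[of k] unfolding E(3)
        by (simp add: poly_pcompose power_mult mult.commute[of "of_nat k" "of_nat m"])
    qed
    \<comment> \<open>The total coefficient is zero as a polynomial, so it may be evaluated
      anywhere; T is divided by m because the orbit is sampled at multiples of m.\<close>
    then have "poly (\<Sum>e\<in>{e\<in>E. base e ^ m = \<beta>}. ?p e) (T / of_nat m) = 0" by simp
    then show ?thesis using m(1) by (simp add: poly_sum poly_pcompose poly_orbit_poly)
  qed
  \<comment> \<open>The factors contributed by the free coordinates of x and of z. Exponents in one
    fibre of \<open>base e ^ m\<close> agree on \<open>mid\<close>, so within a fibre both factors
    are constant and can be exchanged.\<close>
  define X where "X e = (\<Prod>i\<in>mid. x $ i ^ e i)" for e :: "nat \<Rightarrow> nat"
  define Z where "Z e = (\<Prod>i\<in>mid. z $ i ^ e i)" for e :: "nat \<Rightarrow> nat"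
  have X_nz: "X e \<noteq> 0" for e
    using torus_nonzero[OF x] by (auto simp: X_def mid_def)
  have mon: "X e * monomial_fun (n + 1) e z = Z e * monomial_fun (n + 1) e (shift T x)" for e
  proof -
    have split: "monomial_fun (n + 1) e w = (\<Prod>i\<in>{..<n + 1} - mid. w $ i ^ e i) * (\<Prod>i\<in>mid. w $ i ^ e i)"
      for w :: "'a vec"
      unfolding monomial_fun_def by (rule prod.subset_diff) (auto simp: mid_def)
    have "shift T x $ i = z $ i" if "i \<in> {..<n + 1} - mid" for i
    proof -
      have "i = 0 \<or> i = n \<or> i = 1 \<and> \<epsilon> \<noteq> 0" using that unfolding mid_def by (auto split: if_splits)
      moreover have "n \<noteq> 1 \<or> \<epsilon> = 0" using n by (auto split: if_splits)
      ultimately show ?thesis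
        using that z torus_nonzero[OF x, of 0] by (auto simp: shift_def T_def)
    qed
    then have "(\<Prod>i\<in>{..<n + 1} - mid. shift T x $ i ^ e i) = (\<Prod>i\<in>{..<n + 1} - mid. z $ i ^ e i)" by simp
    moreover have "(\<Prod>i\<in>mid. shift T x $ i ^ e i) = X e"
      unfolding X_def by (intro prod.cong) (auto simp: shift_def mid_def split: if_splits)
    ultimately show ?thesis unfolding split Z_def[symmetric] by simp
  qed
  have zero: "(\<Sum>e\<in>{e\<in>E. base e ^ m = \<beta>}. c e * monomial_fun (n + 1) e z) = 0" for \<beta>
  proof (cases "{e\<in>E. base e ^ m = \<beta>} = {}")
    case False
    then obtain e0 where e0: "e0 \<in> E" "base e0 ^ m = \<beta>" by blast
    have XZ: "X e = X e0" "Z e = Z e0" if "base e ^ m = \<beta>" for e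
    proof -
      have "(\<Prod>i\<in>mid. l i ^ (m * e i)) = (\<Prod>i\<in>mid. l i ^ (m * e0 i))"
        using that e0(2) by (simp only: base_m[symmetric])
      then have "\<forall>i\<in>mid. e i = e0 i"
        by (rule indep[unfolded mid_independent_def, THEN spec, THEN spec, THEN mp])
      then show "X e = X e0" "Z e = Z e0" by (simp_all add: X_def Z_def)
    qed
    have "X e0 * (\<Sum>e\<in>{e\<in>E. base e ^ m = \<beta>}. c e * monomial_fun (n + 1) e z) =
      (\<Sum>e\<in>{e\<in>E. base e ^ m = \<beta>}. c e * (X e * monomial_fun (n + 1) e z))"
      unfolding sum_distrib_left by (intro sum.cong refl) (simp add: XZ mult_ac)
    also have "\<dots> = Z e0 * (\<Sum>e\<in>{e\<in>E. base e ^ m = \<beta>}. c e * monomial_fun (n + 1) e (shift T x))"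
      unfolding sum_distrib_left mon by (intro sum.cong refl) (simp add: XZ mult_ac)
    finally show ?thesis using fibre[of \<beta>] X_nz[of e0] by simp
  qed (simp only: sum.empty)
  have "R z = (\<Sum>\<beta>\<in>(\<lambda>e. base e ^ m) ` E. \<Sum>e\<in>{e\<in>E. base e ^ m = \<beta>}. c e * monomial_fun (n + 1) e z)"
    unfolding E(2)[OF z(1)] by (rule sum.image_gen[OF E(1)])
  then show ?thesis using zero by simp
qed

text \<open>Since a^m = 1, the function w \<mapsto> P(w) Q(x) - P(x) Q(w) vanishes on the orbit of x
  under M^m. By density it vanishes wherever the first and last coordinates agree with those of x,
  so P / Q depends on the last coordinate only.\<close>

lemma semi_invariant_last:
  assumes P: "poly_fun (n + 1) P" and Q: "poly_fun (n + 1) Q" "\<exists>y\<in>carrier_vec n. Q (chart0_inv n y) \<noteq> 0"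
    and rel: "\<And>x. x \<in> carrier_vec (n + 1) \<Longrightarrow> P (M x) * Q x = a * P x * Q (M x)"
    and n: "(if \<epsilon> = 0 then 1 else 2) \<le> n" and m: "m > 0" "l n ^ m = 1" "a ^ m = 1"
    and indep: "mid_independent m"
  shows "\<exists>p q. q \<noteq> 0 \<and> (\<forall>y\<in>carrier_vec n.
    P (chart0_inv n y) * poly q (y $ (n - 1)) = Q (chart0_inv n y) * poly p (y $ (n - 1)))"
proof -
  have n1: "n \<ge> 1" using n by (auto split: if_splits)
  have Q': "\<exists>x\<in>carrier_vec (n + 1). Q x \<noteq> 0" using Q(2) chart0_inv_carrier by blast
  obtain y0 where y0: "y0 \<in> carrier_vec n" "Q (chart0_inv n y0) \<noteq> 0" using Q(2) by blast
  \<comment> \<open>The point y0, where Q does not vanish, with its last coordinate made variable.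
    Hence Q restricted to this line is a nonzero polynomial q.\<close>
  define z where "z t = vec (n + 1) (\<lambda>i. poly (if i = n then [:0, 1:] else [:chart0_inv n y0 $ i:]) t)" for t
  let ?c = "\<lambda>i. if i = n then [:0, 1:] else [:chart0_inv n y0 $ i:]"
  obtain p where p: "\<And>t. poly p t = P (z t)"
    using poly_fun_on_curve[OF P, of ?c] unfolding z_def by blast
  obtain q where q: "\<And>t. poly q t = Q (z t)"
    using poly_fun_on_curve[OF Q(1), of ?c] unfolding z_def by blast
  have z: "z t \<in> carrier_vec (n + 1)" "z t $ 0 = 1" "z t $ n = t" for t
    using n1 by (auto simp: z_def chart0_inv_def)
  have "z (y0 $ (n - 1)) = chart0_inv n y0"
    using n1 by (intro eq_vecI) (auto simp: z_def chart0_inv_def)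
  then have "poly q (y0 $ (n - 1)) \<noteq> 0" using q y0 by simp
  then have "q \<noteq> 0" by auto
  have torus: "P (chart0_inv n y) * poly q (y $ (n - 1)) = Q (chart0_inv n y) * poly p (y $ (n - 1))"
    if y: "y \<in> torus n" for y
  proof -
    let ?x = "chart0_inv n y" and ?t = "y $ (n - 1)"
    have x: "?x \<in> torus (n + 1)" by (rule chart0_inv_torus[OF y])
    have xn: "?x $ 0 = 1" "?x $ n = ?t" using n1 by (auto simp: chart0_inv_def)
    have "P (z ?t) * Q ?x - P ?x * Q (z ?t) = 0"
    proof (rule orbit_dense[where R = "\<lambda>w. P w * Q ?x - P ?x * Q w", OF _ n m(1,2) indep x _ z(1)])
      show "poly_fun (n + 1) (\<lambda>w. P w * Q ?x - P ?x * Q w)"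
        by (intro poly_fun_diff poly_fun_mult poly_fun_const P Q(1))
      show "P (orbit (m * k) ?x) * Q ?x - P ?x * Q (orbit (m * k) ?x) = 0" for k
        using orbit_relation[OF P Q(1) Q', of a 0 ?x "m * k"] rel torus_carrier[OF x] m(3)
        by (simp add: power_mult)
    qed (simp_all add: z xn)
    then show ?thesis by (simp add: p q mult.commute)
  qed
  have last: "poly_fun n (\<lambda>y. y $ (n - 1))" using n1 by (intro poly_fun_coord) simp
  have "P (chart0_inv n y) * poly q (y $ (n - 1)) = Q (chart0_inv n y) * poly p (y $ (n - 1))"
    if y: "y \<in> carrier_vec n" for y
  proof (rule poly_fun_eq_if_generic[OF _ _ poly_fun_prod_coords prod_coords_nonzero _ y])
    show "poly_fun n (\<lambda>y. P (chart0_inv n y) * poly q (y $ (n - 1)))"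
      "poly_fun n (\<lambda>y. Q (chart0_inv n y) * poly p (y $ (n - 1)))"
      by (rule poly_fun_mult[OF poly_fun_chart0_inv[OF P] poly_fun_upoly[OF last]]
          poly_fun_mult[OF poly_fun_chart0_inv[OF Q(1)] poly_fun_upoly[OF last]])+
    fix w :: "'a vec" assume "w \<in> carrier_vec n" "(\<Prod>i<n. w $ i) \<noteq> 0"
    then show "P (chart0_inv n w) * poly q (w $ (n - 1)) = Q (chart0_inv n w) * poly p (w $ (n - 1))"
      using torus torus_points_generic by blast
  qed
  with \<open>q \<noteq> 0\<close> show ?thesis by blast
qed

end

subsection \<open>Orders at the origin\<close>

lemma order_X_power_mult:
  fixes g :: "'a::field poly"
  assumes "poly g 0 \<noteq> 0"
  shows "order 0 ([:0, 1:] ^ k * g) = k" "[:0, 1:] ^ k * g \<noteq> 0"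
proof -
  have g: "g \<noteq> 0" "order 0 g = 0" using assms by (auto simp: order_root)
  have "[:0, 1:] ^ k * g \<noteq> (0 :: 'a poly)" using g by simp
  then show "[:0, 1:] ^ k * g \<noteq> 0" "order 0 ([:0, 1:] ^ k * g) = k"
    using order_power_n_n[of "0::'a" k] g by (simp_all add: order_mult)
qed

lemma order_X_decomp:
  fixes p :: "'a::field poly"
  assumes "p \<noteq> 0"
  obtains p0 where "p = [:0, 1:] ^ order 0 p * p0" "poly p0 0 \<noteq> 0"
proof -
  obtain p0 where "p = [:- 0, 1:] ^ order 0 p * p0" "\<not> [:- 0, 1:] dvd p0"
    using order_decomp[OF assms, of 0] by blast
  then show thesis using that by (simp add: poly_eq_0_iff_dvd)
qed

text \<open>The orders of the summands at the origin are the multiples s i, so the least i with c_i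
  \<noteq> 0 determines the order of the sum.\<close>

lemma order_homogenized:
  fixes u v :: "'a::field poly"
  assumes s: "s > 0" and u: "poly u 0 \<noteq> 0" and v: "poly v 0 \<noteq> 0" and c: "\<exists>i\<le>N. c i \<noteq> 0"
  shows "\<exists>j g. (\<Sum>i\<le>N. [:c i:] * ([:0, 1:] ^ s * u) ^ i * v ^ (N - i)) = [:0, 1:] ^ (s * j) * g \<and> poly g 0 \<noteq> 0"
proof -
  define j where "j = (LEAST i. c i \<noteq> 0)"
  obtain i0 where "c i0 \<noteq> 0" using c by blast
  then have cj: "c j \<noteq> 0" unfolding j_def by (rule LeastI)
  have below: "c i = 0" if "i < j" for i using not_less_Least that unfolding j_def by blast
  have jN: "j \<le> N" using c below by (meson leI le_trans)
  define g where "g = (\<Sum>i\<in>{j..N}. [:c i:] * [:0, 1:] ^ (s * (i - j)) * u ^ i * v ^ (N - i))"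
  have "(\<Sum>i\<le>N. [:c i:] * ([:0, 1:] ^ s * u) ^ i * v ^ (N - i)) =
      (\<Sum>i\<in>{j..N}. [:c i:] * ([:0, 1:] ^ s * u) ^ i * v ^ (N - i))"
    using below by (intro sum.mono_neutral_right) auto
  also have "\<dots> = [:0, 1:] ^ (s * j) * g"
    unfolding g_def sum_distrib_left
  proof (intro sum.cong refl)
    fix i assume "i \<in> {j..N}"
    then have "s * i = s * j + s * (i - j)" by (simp flip: distrib_left)
    then have "([:0, 1:] ^ s) ^ i = [:0, 1:] ^ (s * j) * [:0, 1 :: 'a:] ^ (s * (i - j))"
      by (simp only: power_mult[symmetric] power_add[symmetric])
    then show "[:c i:] * ([:0, 1:] ^ s * u) ^ i * v ^ (N - i) =
      [:0, 1:] ^ (s * j) * ([:c i:] * [:0, 1:] ^ (s * (i - j)) * u ^ i * v ^ (N - i))"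
      by (simp only: power_mult_distrib mult_ac)
  qed
  finally have "(\<Sum>i\<le>N. [:c i:] * ([:0, 1:] ^ s * u) ^ i * v ^ (N - i)) = [:0, 1:] ^ (s * j) * g" .
  moreover have "poly g 0 = c j * poly u 0 ^ j * poly v 0 ^ (N - j)"
  proof -
    have "poly g 0 = (\<Sum>i\<in>{j..N}. if i = j then c j * poly u 0 ^ j * poly v 0 ^ (N - j) else 0)"
      unfolding g_def poly_sum using s by (intro sum.cong refl) (auto simp: power_0_left)
    then show ?thesis using jN by (simp add: sum.delta)
  qed
  ultimately show ?thesis using cj u v by (intro exI[of _ j] exI[of _ g]) auto
qed

text \<open>The hypothesis says that \<open>(p' / q') \<circ> (p / q)\<close> is the identity. Its order at the origin is
  the order of \<open>p / q\<close> times an integer.\<close>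

lemma order_of_univariate_birational:
  fixes p q p' q' :: "'a::field poly"
  assumes pq: "p \<noteq> 0" "q \<noteq> 0" and q': "q' \<noteq> 0" "degree q' \<le> N" "degree p' \<le> N"
    and eq: "(\<Sum>i\<le>N. [:coeff p' i:] * p ^ i * q ^ (N - i)) =
      [:0, 1:] * (\<Sum>i\<le>N. [:coeff q' i:] * p ^ i * q ^ (N - i))"
  shows "order 0 p = order 0 q \<or> order 0 p = order 0 q + 1 \<or> order 0 q = order 0 p + 1"
proof -
  obtain p0 where p0: "p = [:0, 1:] ^ order 0 p * p0" "poly p0 0 \<noteq> 0" using order_X_decomp[OF pq(1)] .
  obtain q0 where q0: "q = [:0, 1:] ^ order 0 q * q0" "poly q0 0 \<noteq> 0" using order_X_decomp[OF pq(2)] .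
  define a b where "a = order 0 p" and "b = order 0 q"
  define H where "H r = (\<Sum>i\<le>N. [:coeff r i:] * p ^ i * q ^ (N - i))" for r
  have nz: "\<exists>i\<le>N. coeff r i \<noteq> 0" if "r \<noteq> 0" "degree r \<le> N" for r :: "'a poly"
    using that by (intro exI[of _ "degree r"]) auto
  \<comment> \<open>The orders of H p' and H q' at the origin are congruent modulo s, yet they
    differ by the factor X, that is, by 1. So s divides 1.\<close>
  have key: "s = 1" if s: "s > 0" and H: "\<And>r. r \<noteq> 0 \<Longrightarrow> degree r \<le> N \<Longrightarrow>
      \<exists>j g. H r = [:0, 1:] ^ (d + s * j) * g \<and> poly g 0 \<noteq> 0" for s d
  proof -
    obtain j' g' where g': "H q' = [:0, 1:] ^ (d + s * j') * g'" "poly g' 0 \<noteq> 0" using H q' by blast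
    have Hp': "H p' = [:0, 1:] ^ (d + s * j' + 1) * g'"
      using eq unfolding H_def[symmetric] g'(1) by (simp add: mult_ac)
    then have "H p' \<noteq> 0" using order_X_power_mult(2)[OF g'(2)] by simp
    then have "p' \<noteq> 0" by (auto simp: H_def)
    then obtain j g where g: "H p' = [:0, 1:] ^ (d + s * j) * g" "poly g 0 \<noteq> 0" using H q'(3) by blast
    have "d + s * j' + 1 = d + s * j"
      using order_X_power_mult(1)[OF g'(2), of "d + s * j' + 1"] order_X_power_mult(1)[OF g(2), of "d + s * j"]
        Hp' g(1) by simp
    then have "s * j' + 1 = s * j" by simp
    then have "s dvd 1" by (metis dvd_add_right_iff dvd_triv_left)
    then show ?thesis by simp
  qed
  consider "a = b" | "a > b" | "b > a" by linarith
  then show ?thesis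
  proof cases
    case 2
    \<comment> \<open>The common factor X^b of p and q contributes X^(b N). The cofactors have
      orders a - b and 0.\<close>
    have "\<exists>j g. H r = [:0, 1:] ^ (b * N + (a - b) * j) * g \<and> poly g 0 \<noteq> 0"
      if r: "r \<noteq> 0" "degree r \<le> N" for r
    proof -
      obtain j g where g: "(\<Sum>i\<le>N. [:coeff r i:] * ([:0, 1:] ^ (a - b) * p0) ^ i * q0 ^ (N - i)) =
        [:0, 1:] ^ ((a - b) * j) * g" "poly g 0 \<noteq> 0"
        using order_homogenized[of "a - b" p0 q0 N "coeff r"] 2 p0(2) q0(2) nz[OF r] by auto
      have "H r = [:0, 1:] ^ (b * N) * (\<Sum>i\<le>N. [:coeff r i:] * ([:0, 1:] ^ (a - b) * p0) ^ i * q0 ^ (N - i))"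
        unfolding H_def sum_distrib_left
      proof (intro sum.cong refl)
        fix i assume i: "i \<in> {..N}"
        have p: "p = [:0, 1:] ^ b * ([:0, 1:] ^ (a - b) * p0)"
          using 2 p0(1) by (simp add: a_def[symmetric] mult.assoc[symmetric] power_add[symmetric])
        have q: "q = [:0, 1:] ^ b * q0" using q0(1) by (simp add: b_def)
        have "b * N = b * i + b * (N - i)" using i by (simp flip: distrib_left)
        then have "[:0, 1:] ^ (b * N) = ([:0, 1 :: 'a:] ^ b) ^ i * ([:0, 1:] ^ b) ^ (N - i)"
          by (simp only: power_mult[symmetric] power_add[symmetric])
        then show "[:coeff r i:] * p ^ i * q ^ (N - i) =
          [:0, 1:] ^ (b * N) * ([:coeff r i:] * ([:0, 1:] ^ (a - b) * p0) ^ i * q0 ^ (N - i))"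
          by (subst p, subst q) (simp only: power_mult_distrib mult_ac)
      qed
      then show ?thesis using g by (intro exI[of _ j] exI[of _ g]) (simp add: power_add mult.assoc)
    qed
    from key[OF _ this] 2 show ?thesis by (simp add: a_def b_def)
  next
    case 3
    have "\<exists>j g. H r = [:0, 1:] ^ (a * N + (b - a) * j) * g \<and> poly g 0 \<noteq> 0"
      if r: "r \<noteq> 0" "degree r \<le> N" for r
    proof -
      \<comment> \<open>Reversing the summation index exchanges the roles of p and q, which is
        passage to the reciprocal q / p.\<close>
      have "\<exists>i\<le>N. coeff r (N - i) \<noteq> 0"
        using nz[OF r] by (metis diff_diff_cancel diff_le_self)
      then obtain j g where g: "(\<Sum>i\<le>N. [:coeff r (N - i):] * ([:0, 1:] ^ (b - a) * q0) ^ i * p0 ^ (N - i)) =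
        [:0, 1:] ^ ((b - a) * j) * g" "poly g 0 \<noteq> 0"
        using order_homogenized[of "b - a" q0 p0 N "\<lambda>i. coeff r (N - i)"] 3 p0(2) q0(2) by auto
      have "H r = (\<Sum>i\<le>N. [:coeff r (N - i):] * p ^ (N - i) * q ^ i)"
        unfolding H_def atMost_atLeast0 by (subst sum.atLeastAtMost_rev) (intro sum.cong refl, simp)
      also have "\<dots> = [:0, 1:] ^ (a * N) * (\<Sum>i\<le>N. [:coeff r (N - i):] * ([:0, 1:] ^ (b - a) * q0) ^ i * p0 ^ (N - i))"
        unfolding sum_distrib_left
      proof (intro sum.cong refl)
        fix i assume i: "i \<in> {..N}"
        have q: "q = [:0, 1:] ^ a * ([:0, 1:] ^ (b - a) * q0)"
          using 3 q0(1) by (simp add: b_def[symmetric] mult.assoc[symmetric] power_add[symmetric])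
        have p: "p = [:0, 1:] ^ a * p0" using p0(1) by (simp add: a_def)
        have "a * N = a * i + a * (N - i)" using i by (simp flip: distrib_left)
        then have "[:0, 1:] ^ (a * N) = ([:0, 1 :: 'a:] ^ a) ^ i * ([:0, 1:] ^ a) ^ (N - i)"
          by (simp only: power_mult[symmetric] power_add[symmetric])
        then show "[:coeff r (N - i):] * p ^ (N - i) * q ^ i =
          [:0, 1:] ^ (a * N) * ([:coeff r (N - i):] * ([:0, 1:] ^ (b - a) * q0) ^ i * p0 ^ (N - i))"
          by (subst p, subst q) (simp only: power_mult_distrib mult_ac)
      qed
      finally show ?thesis using g by (intro exI[of _ j] exI[of _ g]) (simp add: power_add mult.assoc)
    qed
    from key[OF _ this] 3 show ?thesis by (simp add: a_def b_def)
  qed (simp add: a_def b_def)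
qed

subsection \<open>Invariants of birational conjugacy\<close>

text \<open>A birational map is dominant: composed with its inverse it returns x up to a scalar, so
  none of its components vanishes identically.\<close>

lemma birational_coord_nonzero:
  fixes F :: "'a::field_char_0 vec \<Rightarrow> 'a vec"
  assumes F: "birational_tuple n F" and i: "i \<le> n"
  shows "\<exists>x\<in>carrier_vec (n + 1). F x $ i \<noteq> 0"
proof -
  obtain G where G: "birational_tuple n G" "homogeneous_tuple n (F \<circ> G)" "same_rational_map n (F \<circ> G) id"
    using birational_tupleE[OF F] by blast
  obtain q where q: "poly_fun (n + 1) q" "\<exists>x\<in>carrier_vec (n + 1). q x \<noteq> 0"
    "\<And>x. x \<in> carrier_vec (n + 1) \<Longrightarrow> q x \<noteq> 0 \<Longrightarrow> \<exists>c. c \<noteq> 0 \<and> (F \<circ> G) x = c \<cdot>\<^sub>v x"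
    using same_rational_map_id_generic[OF G(2,3)] by blast
  have "poly_fun (n + 1) (\<lambda>x :: 'a vec. x $ i)" "\<exists>x\<in>carrier_vec (n + 1). x $ i \<noteq> (0::'a)"
    using i poly_fun_coord_nonzero[of i "n + 1"] by (auto intro!: poly_fun_coord)
  from poly_fun_common_nonzero[OF q(1,2) this]
  obtain x where x: "x \<in> carrier_vec (n + 1)" "q x \<noteq> 0" "x $ i \<noteq> 0" by blast
  obtain c where c: "c \<noteq> 0" "F (G x) = c \<cdot>\<^sub>v x" using q(3) x by auto
  then have "F (G x) $ i \<noteq> 0" using x i by simp
  then show ?thesis using homogeneous_tuple_carrier[OF birational_tuple_homogeneous[OF G(1)] x(1)] by blast
qed

lemma birational_inverse_equivariant:
  fixes F P Q :: "'a::field_char_0 vec \<Rightarrow> 'a vec"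
  assumes F: "birational_tuple n F" and P: "birational_tuple n P" and Q: "birational_tuple n Q"
    and FP: "same_rational_map n (F \<circ> P) (Q \<circ> F)"
  obtains G where "birational_tuple n G" "homogeneous_tuple n (G \<circ> F)" "same_rational_map n (G \<circ> F) id"
    "homogeneous_tuple n (F \<circ> G)" "same_rational_map n (F \<circ> G) id"
    "same_rational_map n (G \<circ> Q) (P \<circ> G)"
proof -
  obtain G where G: "birational_tuple n G"
    "homogeneous_tuple n (F \<circ> G)" "same_rational_map n (F \<circ> G) id"
    "homogeneous_tuple n (G \<circ> F)" "same_rational_map n (G \<circ> F) id"
    using birational_tupleE[OF F] .
  interpret group "Bir_proj n :: 'a rational_map monoid" by (rule group_Bir_proj)
  let ?f = "rational_map_of n F" and ?g = "rational_map_of n G"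
    and ?p = "rational_map_of n P" and ?q = "rational_map_of n Q"
  have carr: "?f \<in> carrier (Bir_proj n)" "?g \<in> carrier (Bir_proj n)"
    "?p \<in> carrier (Bir_proj n)" "?q \<in> carrier (Bir_proj n)"
    using F G(1) P Q by auto
  have gf: "?g \<otimes>\<^bsub>Bir_proj n\<^esub> ?f = \<one>\<^bsub>Bir_proj n\<^esub>"
    unfolding Bir_proj_mult[OF G(1) F] Bir_proj_simps(2)
    using rational_map_of_eq_iff[OF G(4) homogeneous_tuple_id] G(5) by blast
  have fg: "?f \<otimes>\<^bsub>Bir_proj n\<^esub> ?g = \<one>\<^bsub>Bir_proj n\<^esub>"
    unfolding Bir_proj_mult[OF F G(1)] Bir_proj_simps(2)
    using rational_map_of_eq_iff[OF G(2) homogeneous_tuple_id] G(3) by blast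
  note hom = birational_tuple_homogeneous[OF birational_tuple_comp]
  have "?f \<otimes>\<^bsub>Bir_proj n\<^esub> ?p = ?q \<otimes>\<^bsub>Bir_proj n\<^esub> ?f"
    unfolding Bir_proj_mult[OF F P] Bir_proj_mult[OF Q F]
    using rational_map_of_eq_iff[OF hom[OF F P] hom[OF Q F]] FP by blast
  then have "?g \<otimes>\<^bsub>Bir_proj n\<^esub> (?f \<otimes>\<^bsub>Bir_proj n\<^esub> ?p) \<otimes>\<^bsub>Bir_proj n\<^esub> ?g =
      ?g \<otimes>\<^bsub>Bir_proj n\<^esub> (?q \<otimes>\<^bsub>Bir_proj n\<^esub> ?f) \<otimes>\<^bsub>Bir_proj n\<^esub> ?g" by simp
  moreover have "?g \<otimes>\<^bsub>Bir_proj n\<^esub> (?f \<otimes>\<^bsub>Bir_proj n\<^esub> ?p) \<otimes>\<^bsub>Bir_proj n\<^esub> ?g = ?p \<otimes>\<^bsub>Bir_proj n\<^esub> ?g"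
    unfolding m_assoc[OF carr(2,1,3), symmetric] gf l_one[OF carr(3)] ..
  moreover have "?g \<otimes>\<^bsub>Bir_proj n\<^esub> (?q \<otimes>\<^bsub>Bir_proj n\<^esub> ?f) \<otimes>\<^bsub>Bir_proj n\<^esub> ?g = ?g \<otimes>\<^bsub>Bir_proj n\<^esub> ?q"
    unfolding m_assoc[OF carr(2) m_closed[OF carr(4,1)] carr(2)] m_assoc[OF carr(4,1,2)] fg r_one[OF carr(4)] ..
  ultimately have "?g \<otimes>\<^bsub>Bir_proj n\<^esub> ?q = ?p \<otimes>\<^bsub>Bir_proj n\<^esub> ?g" by simp
  then have "same_rational_map n (G \<circ> Q) (P \<circ> G)"
    unfolding Bir_proj_mult[OF G(1) Q] Bir_proj_mult[OF P G(1)]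
    using rational_map_of_eq_iff[OF hom[OF G(1) Q] hom[OF P G(1)]] by blast
  then show thesis using that G by blast
qed

text \<open>For f = F_i / F_0 this is f \<circ> M = l'_i f, with \<epsilon>' added for i = 1,
  cleared of denominators.\<close>

lemma equivariant_coord:
  assumes FM: "same_rational_map n (F \<circ> lin_tuple n \<epsilon> l) (lin_tuple n \<epsilon>' l' \<circ> F)"
    and l': "l' 0 = 1" and i: "i \<le> n" and x: "x \<in> carrier_vec (n + 1)"
  shows "F (lin_tuple n \<epsilon> l x) $ i * F x $ 0 =
    (l' i * F x $ i + (if i = 1 then \<epsilon>' * F x $ 0 else 0)) * F (lin_tuple n \<epsilon> l x) $ 0"
proof -
  have "F (lin_tuple n \<epsilon> l x) $ i * lin_tuple n \<epsilon>' l' (F x) $ 0 =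
      F (lin_tuple n \<epsilon> l x) $ 0 * lin_tuple n \<epsilon>' l' (F x) $ i"
    using FM x i unfolding same_rational_map_def comp_def by blast
  then show ?thesis using i l' by (simp add: lin_tuple_def mult.commute)
qed

lemma birational_affine_diagonal:
  "affine_diagonal n \<epsilon> l \<Longrightarrow> birational_tuple n (lin_tuple n \<epsilon> l)"
  by (rule birational_lin_tuple) (simp add: affine_diagonal.l_nonzero)

lemma conjugate_weight:
  assumes A: "affine_diagonal n \<epsilon> l" and A': "affine_diagonal n \<epsilon>' l'"
    and F: "birational_tuple n F" and FM: "same_rational_map n (F \<circ> lin_tuple n \<epsilon> l) (lin_tuple n \<epsilon>' l' \<circ> F)"
    and i: "i \<le> n" "i \<noteq> 1 \<or> \<epsilon>' = 0"
  shows "\<exists>e e'. affine_diagonal.base n l e = l' i * affine_diagonal.base n l e'"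
proof -
  note hom = homogeneous_tuple_poly_fun[OF birational_tuple_homogeneous[OF F]]
  show ?thesis
  proof (rule affine_diagonal.semi_invariant_eigenvalue[OF A hom[OF i(1)] birational_coord_nonzero[OF F i(1)]
        hom[of 0] birational_coord_nonzero[OF F, of 0]])
    show "l' i \<noteq> 0" using affine_diagonal.l_nonzero[OF A'] i(1) by blast
    show "F (lin_tuple n \<epsilon> l x) $ i * F x $ 0 = l' i * F x $ i * F (lin_tuple n \<epsilon> l x) $ 0"
      if "x \<in> carrier_vec (n + 1)" for x
      using equivariant_coord[OF FM affine_diagonal.l0[OF A'] i(1) that] i(2) by auto
  qed simp_all
qed

lemma diagonal_not_conjugate_almost_diagonal:
  fixes l l' :: "nat \<Rightarrow> 'a::field_char_0"
  assumes A: "affine_diagonal n 0 l" and A': "affine_diagonal n 1 l'" and n: "n \<ge> 1"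
    and F: "birational_tuple n F" and FM: "same_rational_map n (F \<circ> lin_tuple n 0 l) (lin_tuple n 1 l' \<circ> F)"
  shows False
proof -
  note hom = homogeneous_tuple_poly_fun[OF birational_tuple_homogeneous[OF F]]
  have l1: "l' 1 = 1" using affine_diagonal.l1[OF A'] by simp
  show False
  proof (rule affine_diagonal.no_additive_semi_invariant[OF A hom[OF n] hom[of 0] birational_coord_nonzero[OF F, of 0]])
    show "F (lin_tuple n 0 l x) $ 1 * F x $ 0 = (F x $ 1 + F x $ 0) * F (lin_tuple n 0 l x) $ 0"
      if "x \<in> carrier_vec (n + 1)" for x
      using equivariant_coord[OF FM affine_diagonal.l0[OF A'] n that] l1 by simp
  qed simp_all
qed

lemma poly_homogenized:
  fixes r :: "'a::field poly"
  assumes "degree r \<le> N" "poly q t \<noteq> 0"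
  shows "poly (\<Sum>i\<le>N. [:coeff r i:] * p ^ i * q ^ (N - i)) t = poly q t ^ N * poly r (poly p t / poly q t)"
proof -
  have "poly r x = (\<Sum>i\<le>N. coeff r i * x ^ i)" for x
    unfolding poly_altdef using assms(1)
    by (intro sum.mono_neutral_left) (auto simp: coeff_eq_0)
  then have r: "poly q t ^ N * poly r (poly p t / poly q t) =
      (\<Sum>i\<le>N. poly q t ^ N * (coeff r i * (poly p t / poly q t) ^ i))"
    by (simp only: sum_distrib_left)
  show ?thesis
    unfolding poly_sum r
  proof (intro sum.cong refl)
    fix i assume "i \<in> {..N}"
    then have "poly q t ^ N = poly q t ^ (N - i) * poly q t ^ i" by (simp flip: power_add)
    then show "poly ([:coeff r i:] * p ^ i * q ^ (N - i)) t =
        poly q t ^ N * (coeff r i * (poly p t / poly q t) ^ i)"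
      using assms(2) by (simp add: power_divide)
  qed
qed

text \<open>Here the last component of a conjugating map is a function of the last coordinate alone, and
  the same holds for its inverse, so it is a rational function of degree 1 in one variable.\<close>

lemma conjugate_torsion_weight:
  fixes l l' :: "nat \<Rightarrow> 'a::field_char_0"
  assumes A: "affine_diagonal n \<epsilon> l" and A': "affine_diagonal n \<epsilon> l'"
    and F: "birational_tuple n F" and FM: "same_rational_map n (F \<circ> lin_tuple n \<epsilon> l) (lin_tuple n \<epsilon> l' \<circ> F)"
    and n: "(if \<epsilon> = 0 then 1 else 2) \<le> n"
    and m: "m > 0" "l n ^ m = 1" "l' n ^ m = 1"
    and indep: "affine_diagonal.mid_independent n \<epsilon> l m" "affine_diagonal.mid_independent n \<epsilon> l' m"
  shows "l' n = 1 \<or> l' n = l n \<or> l n * l' n = 1"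
proof -
  let ?M = "lin_tuple n \<epsilon> l" and ?M' = "lin_tuple n \<epsilon> l'"
  note M = birational_affine_diagonal[OF A] and M' = birational_affine_diagonal[OF A']
  obtain G where G: "birational_tuple n G" "homogeneous_tuple n (G \<circ> F)" "same_rational_map n (G \<circ> F) id"
    "same_rational_map n (G \<circ> ?M') (?M \<circ> G)"
    using birational_inverse_equivariant[OF F M M' FM] by blast
  note hF = birational_tuple_homogeneous[OF F] and hG = birational_tuple_homogeneous[OF G(1)]
  have n1: "n \<ge> 1" "n \<noteq> 1 \<or> \<epsilon> = 0" using n by (auto split: if_splits)
  have chart: "\<exists>y\<in>carrier_vec n. H (chart0_inv n y) $ i \<noteq> 0" if "birational_tuple n H" "i \<le> n"
    for H :: "'a vec \<Rightarrow> 'a vec" and i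
    using homogeneous_tuple_chart[OF birational_tuple_homogeneous[OF that(1)] that(2)]
      birational_coord_nonzero[OF that] by blast
  have relF: "F (?M x) $ n * F x $ 0 = l' n * F x $ n * F (?M x) $ 0" if "x \<in> carrier_vec (n + 1)" for x
    using equivariant_coord[OF FM affine_diagonal.l0[OF A'] _ that, of n] n1(2) by auto
  have relG: "G (?M' x) $ n * G x $ 0 = l n * G x $ n * G (?M' x) $ 0" if "x \<in> carrier_vec (n + 1)" for x
    using equivariant_coord[OF G(4) affine_diagonal.l0[OF A] _ that, of n] n1(2) by auto
  let ?f = "\<lambda>i y. F (chart0_inv n y) $ i" and ?g = "\<lambda>i y. G (chart0_inv n y) $ i"
  \<comment> \<open>h = p / q is the last affine coordinate of F, and p' / q' below plays the same
    part for the inverse.\<close>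
  obtain p q where q: "q \<noteq> 0" and pq: "\<And>y. y \<in> carrier_vec n \<Longrightarrow>
      ?f n y * poly q (y $ (n - 1)) = ?f 0 y * poly p (y $ (n - 1))"
    using affine_diagonal.semi_invariant_last[OF A homogeneous_tuple_poly_fun[OF hF, of n]
        homogeneous_tuple_poly_fun[OF hF, of 0] chart[OF F, of 0] relF n m indep(1)] by auto
  obtain p' q' where q': "q' \<noteq> 0" and pq': "\<And>y. y \<in> carrier_vec n \<Longrightarrow>
      ?g n y * poly q' (y $ (n - 1)) = ?g 0 y * poly p' (y $ (n - 1))"
    using affine_diagonal.semi_invariant_last[OF A' homogeneous_tuple_poly_fun[OF hG, of n]
        homogeneous_tuple_poly_fun[OF hG, of 0] chart[OF G(1), of 0] relG n m(1,3,2) indep(2)] by auto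
  have last: "poly_fun n (\<lambda>y :: 'a vec. y $ (n - 1))" using n1(1) by (intro poly_fun_coord) simp
  have last_nz: "\<exists>y\<in>carrier_vec n. poly r (y $ (n - 1)) \<noteq> 0" if r: "r \<noteq> 0" for r :: "'a poly"
  proof -
    obtain t where "poly r t \<noteq> 0" using poly_all_0_iff_0[of r] r by auto
    then show ?thesis using n1(1) by (intro bexI[of _ "vec n (\<lambda>_. t)"]) auto
  qed
  \<comment> \<open>Univariate identities are tested at the last coordinates of general
    points.\<close>
  have poly_eqI: "r = s"
    if gen: "poly_fun n g" "\<exists>y\<in>carrier_vec n. g y \<noteq> 0"
      and eq: "\<And>y. y \<in> carrier_vec n \<Longrightarrow> g y \<noteq> 0 \<Longrightarrow> poly r (y $ (n - 1)) = poly s (y $ (n - 1))"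
    for r s :: "'a poly" and g
  proof (rule ccontr)
    assume "r \<noteq> s"
    then have "r - s \<noteq> 0" by simp
    from poly_fun_common_nonzero[OF gen poly_fun_upoly[OF last] last_nz[OF this]]
    show False using eq by auto
  qed
  have f_poly: "poly_fun n (?f i)" if "i \<le> n" for i
    using poly_fun_chart0_inv[OF homogeneous_tuple_poly_fun[OF hF that]] .
  have p: "p \<noteq> 0"
  proof
    assume "p = 0"
    have "\<exists>y\<in>carrier_vec n. ?f n y \<noteq> 0 \<and> poly q (y $ (n - 1)) \<noteq> 0"
      by (rule poly_fun_common_nonzero[OF f_poly chart[OF F] poly_fun_upoly[OF last] last_nz[OF q]]) simp_all
    then show False using pq \<open>p = 0\<close> by auto
  qed
  \<comment> \<open>The functional equation h(l_n t) = l'_n h(t) without denominators.\<close>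
  have rel: "pcompose p [:0, l n:] * q = smult (l' n) (p * pcompose q [:0, l n:])"
  proof -
    let ?FM = "F \<circ> ?M"
    have FM_bir: "birational_tuple n ?FM" by (rule birational_tuple_comp[OF F M])
    have FM_poly: "poly_fun n (\<lambda>y. ?FM (chart0_inv n y) $ 0)"
      using poly_fun_chart0_inv[OF homogeneous_tuple_poly_fun[OF birational_tuple_homogeneous[OF FM_bir], of 0]] by simp
    show ?thesis
    proof (rule poly_eqI[OF generic_conj[OF f_poly[of 0] chart[OF F, of 0] FM_poly chart[OF FM_bir, of 0]]])
      fix y :: "'a vec" assume y: "y \<in> carrier_vec n" "?f 0 y * ?FM (chart0_inv n y) $ 0 \<noteq> 0"
      let ?y' = "aff n \<epsilon> l y" and ?t = "y $ (n - 1)"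
      have My: "?M (chart0_inv n y) = chart0_inv n ?y'"
        by (rule lin_tuple_chart0_inv[of l, OF affine_diagonal.l0[OF A]])
      have y': "?y' \<in> carrier_vec n" "?y' $ (n - 1) = l n * ?t"
        using n1 by (auto simp: aff_def)
      have nz: "?f 0 y \<noteq> 0" "?f 0 ?y' \<noteq> 0" using y(2) My by auto
      have 1: "?f n y * poly q ?t = ?f 0 y * poly p ?t" by (rule pq[OF y(1)])
      have 2: "?f n ?y' * poly q (l n * ?t) = ?f 0 ?y' * poly p (l n * ?t)" using pq[OF y'(1)] y'(2) by simp
      have 3: "?f n ?y' * ?f 0 y = l' n * ?f n y * ?f 0 ?y'" using relF[OF chart0_inv_carrier, of y] My by simp
      have "(?f 0 y * ?f 0 ?y') * (poly p (l n * ?t) * poly q ?t) =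
          (?f n ?y' * ?f 0 y) * (poly q (l n * ?t) * poly q ?t)"
        using 2 by (simp add: mult_ac)
      also have "\<dots> = (l' n * ?f 0 ?y' * poly q (l n * ?t)) * (?f n y * poly q ?t)"
        unfolding 3 by (simp add: mult_ac)
      also have "\<dots> = (?f 0 y * ?f 0 ?y') * (l' n * (poly p ?t * poly q (l n * ?t)))"
        unfolding 1 by (simp add: mult_ac)
      finally have "poly p (l n * ?t) * poly q ?t = l' n * (poly p ?t * poly q (l n * ?t))"
        using nz by simp
      then show "poly (pcompose p [:0, l n:] * q) ?t = poly (smult (l' n) (p * pcompose q [:0, l n:])) ?t"
        by (simp add: poly_pcompose mult.commute)
    qed simp_all
  qed
  define N where "N = max (degree p') (degree q')"
  \<comment> \<open>As G \<circ> F is the identity, (p' / q')(h(t)) = t; homogenizing with degree N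
    gives a polynomial identity.\<close>
  have orders: "order 0 p = order 0 q \<or> order 0 p = order 0 q + 1 \<or> order 0 q = order 0 p + 1"
  proof (rule order_of_univariate_birational[OF p q q', of N p'])
    obtain d where d: "\<And>x c. x \<in> carrier_vec (n + 1) \<Longrightarrow> G (c \<cdot>\<^sub>v x) = c ^ d \<cdot>\<^sub>v G x"
      using homogeneous_tuple_smult[OF hG] by blast
    have GF_bir: "birational_tuple n (G \<circ> F)" by (rule birational_tuple_comp[OF G(1) F])
    have GF_poly: "poly_fun n (\<lambda>y. (G \<circ> F) (chart0_inv n y) $ 0)"
      using poly_fun_chart0_inv[OF homogeneous_tuple_poly_fun[OF G(2), of 0]] by simp
    note gen1 = generic_conj[OF GF_poly chart[OF GF_bir, of 0] poly_fun_upoly[OF last] last_nz[OF q]]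
    note gen = generic_conj[OF f_poly[of 0] chart[OF F, of 0] gen1]
    show "(\<Sum>i\<le>N. [:coeff p' i:] * p ^ i * q ^ (N - i)) =
      [:0, 1:] * (\<Sum>i\<le>N. [:coeff q' i:] * p ^ i * q ^ (N - i))"
    proof (rule poly_eqI[OF gen])
      fix y :: "'a vec"
      assume y: "y \<in> carrier_vec n" "?f 0 y * ((G \<circ> F) (chart0_inv n y) $ 0 * poly q (y $ (n - 1))) \<noteq> 0"
      let ?x = "chart0_inv n y" and ?t = "y $ (n - 1)"
      let ?w = "chart0 n (F ?x)"
      have nz: "?f 0 y \<noteq> 0" "G (F ?x) $ 0 \<noteq> 0" "poly q ?t \<noteq> 0" using y(2) by auto
      have Fx: "F ?x \<in> carrier_vec (n + 1)" by (rule homogeneous_tuple_carrier[OF hF chart0_inv_carrier])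
      have w: "?w \<in> carrier_vec n" by (rule chart0_carrier)
      have wl: "?w $ (n - 1) = poly p ?t / poly q ?t"
        using pq[OF y(1)] nz n1(1) by (simp add: chart0_def field_simps)
      have GFx: "G (F ?x) = (?f 0 y) ^ d \<cdot>\<^sub>v G (chart0_inv n ?w)"
        using arg_cong[OF chart0_inv_chart0[OF Fx nz(1)], of G] unfolding d[OF chart0_inv_carrier] .
      have GFi: "G (F ?x) $ i = (?f 0 y) ^ d * ?g i ?w" if "i \<le> n" for i
        unfolding GFx using homogeneous_tuple_carrier[OF hG chart0_inv_carrier, of ?w] that by simp
      have g0: "?g 0 ?w \<noteq> 0" using nz(2) GFi[of 0] by auto
      have "G (F ?x) $ n * ?x $ 0 = G (F ?x) $ 0 * ?x $ n"
        using G(3) chart0_inv_carrier unfolding same_rational_map_def comp_def id_apply by blast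
      then have "?g n ?w = ?g 0 ?w * ?t"
        using nz(1) n1(1) GFi[of n] GFi[of 0] by (simp add: chart0_inv_def)
      with pq'[OF w] g0 have key: "poly p' (?w $ (n - 1)) = ?t * poly q' (?w $ (n - 1))" by simp
      show "poly (\<Sum>i\<le>N. [:coeff p' i:] * p ^ i * q ^ (N - i)) ?t =
        poly ([:0, 1:] * (\<Sum>i\<le>N. [:coeff q' i:] * p ^ i * q ^ (N - i))) ?t"
        unfolding poly_mult poly_homogenized[OF max.cobounded1[of "degree p'" "degree q'", folded N_def] nz(3)]
          poly_homogenized[OF max.cobounded2[of "degree q'" "degree p'", folded N_def] nz(3)]
        using key unfolding wl by simp
    qed simp_all
  qed (simp_all add: N_def)
  obtain p0 where p0: "p = [:0, 1:] ^ order 0 p * p0" "poly p0 0 \<noteq> 0" using order_X_decomp[OF p] .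
  obtain q0 where q0: "q = [:0, 1:] ^ order 0 q * q0" "poly q0 0 \<noteq> 0" using order_X_decomp[OF q] .
  define a b where "a = order 0 p" and "b = order 0 q"
  \<comment> \<open>Comparison of the lowest terms of \<open>rel\<close> at the origin: p
    contributes l_n^a and q contributes l_n^b. Since a and b differ by at most 1, the three
    alternatives follow.\<close>
  have "l n ^ a = l' n * l n ^ b"
  proof -
    have pt: "poly p t = t ^ a * poly p0 t" for t
      using arg_cong[OF p0(1), of "\<lambda>p. poly p t"] by (simp add: a_def)
    have qt: "poly q t = t ^ b * poly q0 t" for t
      using arg_cong[OF q0(1), of "\<lambda>p. poly p t"] by (simp add: b_def)
    have "[:0, 1:] ^ (a + b) * smult (l n ^ a) (pcompose p0 [:0, l n:] * q0) =
        [:0, 1:] ^ (a + b) * smult (l' n * l n ^ b) (p0 * pcompose q0 [:0, l n:])"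
    proof (intro poly_eq_poly_eq_iff[THEN iffD1] ext)
      fix t
      have "poly p (t * l n) * poly q t = l' n * (poly p t * poly q (t * l n))"
        using arg_cong[OF rel, of "\<lambda>p. poly p t"] by (simp add: poly_pcompose)
      then show "poly ([:0, 1:] ^ (a + b) * smult (l n ^ a) (pcompose p0 [:0, l n:] * q0)) t =
          poly ([:0, 1:] ^ (a + b) * smult (l' n * l n ^ b) (p0 * pcompose q0 [:0, l n:])) t"
        unfolding pt qt by (simp add: poly_pcompose power_add power_mult_distrib mult_ac)
    qed
    moreover have "[:0, 1 :: 'a:] ^ (a + b) \<noteq> 0" by simp
    ultimately have "smult (l n ^ a) (pcompose p0 [:0, l n:] * q0) = smult (l' n * l n ^ b) (p0 * pcompose q0 [:0, l n:])"
      using mult_left_cancel by blast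
    then have "poly (smult (l n ^ a) (pcompose p0 [:0, l n:] * q0)) 0 =
        poly (smult (l' n * l n ^ b) (p0 * pcompose q0 [:0, l n:])) 0" by simp
    then show ?thesis using p0(2) q0(2) by (simp add: poly_pcompose)
  qed
  moreover have "l n \<noteq> 0" using affine_diagonal.l_nonzero[OF A] by blast
  ultimately show ?thesis
    using orders unfolding a_def[symmetric] b_def[symmetric] by (auto simp: mult.commute)
qed

subsection \<open>Roots of unity\<close>

text \<open>X^M - 1 splits into linear factors, and all roots are simple because the derivative M
  X^(M-1) vanishes only at 0.\<close>

lemma card_roots_of_unity:
  assumes "M > 0"
  shows "card {x :: 'a::{alg_closed_field, field_char_0}. x ^ M = 1} = M"
proof -
  define p where "p = (monom 1 M + [:- 1:] :: 'a poly)"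
  have deg: "degree p = M" unfolding p_def using assms
    by (subst degree_add_eq_left) (simp_all add: degree_monom_eq)
  have p0: "p \<noteq> 0" using deg assms by auto
  have roots: "poly p x = 0 \<longleftrightarrow> x ^ M = 1" for x by (simp add: p_def poly_monom)
  have "poly (pderiv p) x \<noteq> 0" if "poly p x = 0" for x
  proof -
    have "x \<noteq> 0" using that assms by (auto simp: roots power_0_left)
    then show ?thesis using assms by (simp add: p_def pderiv_add pderiv_pCons pderiv_monom poly_monom)
  qed
  then have "rsquarefree p" by (auto simp: rsquarefree_roots)
  then have "order x p = 1" if "poly p x = 0" for x
    using that rsquarefree_root_order p0 by blast
  then have "count (proots p) x = 1" if "x \<in># proots p" for x
    using that p0 by (simp add: set_count_proots)
  then have "card (set_mset (proots p)) = size (proots p)"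
    by (simp add: size_multiset_overloaded_eq)
  moreover have "size (proots p) = M"
  proof -
    obtain A where A: "size A = degree p" "p = smult (lead_coeff p) (\<Prod>x\<in>#A. [:-x, 1:])"
      using alg_closed_imp_factorization[OF p0] by blast
    have nz: "(\<Prod>x\<in>#B. [:- x, 1:]) \<noteq> 0" for B :: "'a multiset" by (auto simp: prod_mset_zero_iff)
    have "proots (\<Prod>x\<in>#B. [:- x, 1:]) = B" for B :: "'a multiset"
    proof (induction B)
      case (add x B)
      have "proots ([:- x, 1:] * (\<Prod>x\<in>#B. [:- x, 1:])) = proots [:- x, 1:] + proots (\<Prod>x\<in>#B. [:- x, 1:])"
        by (rule proots_mult[OF _ nz]) simp
      then show ?case using add by (simp del: mult_pCons_left)
    qed simp
    then have "proots p = A" by (subst A(2)) (use p0 in simp)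
    then show ?thesis using A(1) deg by simp
  qed
  moreover have "set_mset (proots p) = {x. x ^ M = 1}" using p0 roots by (simp add: set_count_proots)
  ultimately show ?thesis by simp
qed

lemma finite_roots_of_unity:
  "M > 0 \<Longrightarrow> finite {x :: 'a::{alg_closed_field, field_char_0}. x ^ M = 1}"
  using card_roots_of_unity[of M, where 'a = 'a] by (intro card_ge_0_finite) simp

definition root_order :: "'a::field \<Rightarrow> nat" where
  "root_order x = (LEAST d. d > 0 \<and> x ^ d = 1)"

lemma root_order:
  fixes x :: "'a::field"
  assumes "x ^ M = 1" "M > 0"
  shows "root_order x > 0" "x ^ k = 1 \<longleftrightarrow> root_order x dvd k"
proof -
  have *: "root_order x > 0 \<and> x ^ root_order x = 1"
    unfolding root_order_def using assms by (intro LeastI[of "\<lambda>d. d > 0 \<and> x ^ d = 1" M]) auto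
  then show "root_order x > 0" by blast
  have "x ^ k = x ^ (k mod root_order x)"
  proof -
    have "x ^ k = (x ^ root_order x) ^ (k div root_order x) * x ^ (k mod root_order x)"
      by (simp flip: power_mult power_add)
    then show ?thesis using * by simp
  qed
  moreover have "x ^ j \<noteq> 1" if "0 < j" "j < root_order x" for j
    using not_less_Least[of j "\<lambda>d. d > 0 \<and> x ^ d = 1"] that unfolding root_order_def by blast
  ultimately show "x ^ k = 1 \<longleftrightarrow> root_order x dvd k"
    using * by (metis dvd_eq_mod_eq_0 mod_less_divisor neq0_conv power_0)
qed

text \<open>The powers w^0, ..., w^(M-1) are distinct M-th roots of unity, and there are only M of
  these.\<close>

lemma powers_of_primitive_root:
  fixes w :: "'a::{alg_closed_field, field_char_0}"
  assumes M: "M > 0" and w: "\<And>k. w ^ k = 1 \<longleftrightarrow> M dvd k" and x: "x ^ M = 1"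
  shows "\<exists>k. x = w ^ k"
proof -
  have w0: "w \<noteq> 0" using w[of M] M by (auto simp: power_0_left)
  have inj: "inj_on (\<lambda>k. w ^ k) {..<M}"
  proof (rule inj_onI)
    fix i j assume ij: "i \<in> {..<M}" "j \<in> {..<M}" "w ^ i = w ^ j"
    have le: "i = j" if "i \<le> j" "j < M" "w ^ i = w ^ j" for i j
    proof -
      have "w ^ j = w ^ i * w ^ (j - i)" using that(1) by (simp flip: power_add)
      then have "w ^ (j - i) = 1" using that(3) w0 by simp
      then have "M dvd j - i" using w by blast
      then show ?thesis using that by (auto dest: dvd_imp_le)
    qed
    show "i = j"
    proof (cases "i \<le> j")
      case True
      then show ?thesis using le[of i j] ij by simp
    next
      case False
      then show ?thesis using le[of j i] ij(1) ij(3)[symmetric] by simp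
    qed
  qed
  have "(\<lambda>k. w ^ k) ` {..<M} \<subseteq> {x. x ^ M = 1}"
  proof
    fix y assume "y \<in> (\<lambda>k. w ^ k) ` {..<M}"
    then obtain k where "y = w ^ k" by blast
    moreover have "w ^ (k * M) = 1" unfolding w by simp
    ultimately show "y \<in> {x. x ^ M = 1}" by (simp add: power_mult)
  qed
  moreover have "card ((\<lambda>k. w ^ k) ` {..<M}) = card {x :: 'a. x ^ M = 1}"
    using card_image[OF inj] card_roots_of_unity[OF M, where 'a = 'a] by simp
  moreover have "finite {x :: 'a. x ^ M = 1}" by (rule finite_roots_of_unity[OF M])
  ultimately have "(\<lambda>k. w ^ k) ` {..<M} = {x. x ^ M = 1}" by (intro card_subset_eq)
  then show ?thesis using x by blast
qed

text \<open>Counting the \<open>M\<close>-th roots of unity by their orders and comparing with \<open>\<Sum>\<^sub>d \<phi>(d) = M\<close>.\<close>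

lemma card_root_order:
  assumes "M > 0"
  shows "card {x :: 'a::{alg_closed_field, field_char_0}. x ^ M = 1 \<and> root_order x = M} = totient M"
  using assms
proof (induction M rule: less_induct)
  case (less M)
  define N where "N d = {x :: 'a. x ^ d = 1 \<and> root_order x = d}" for d
  have fin: "finite (N d)" if "d > 0" for d
    using finite_subset[OF _ finite_roots_of_unity[OF that, where 'a = 'a]] by (auto simp: N_def)
  have dpos: "d > 0" if "d dvd M" for d using that less.prems by (auto intro: dvd_pos_nat)
  have findvd: "finite {d. d dvd M}" using less.prems by simp
  have union: "{x :: 'a. x ^ M = 1} = (\<Union>d\<in>{d. d dvd M}. N d)"
  proof (intro equalityI subsetI)
    fix x :: 'a assume "x \<in> {x. x ^ M = 1}"
    then have x: "x ^ M = 1" by simp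
    have "root_order x dvd M" "x ^ root_order x = 1"
      using root_order(2)[OF x less.prems] x by auto
    then show "x \<in> (\<Union>d\<in>{d. d dvd M}. N d)" by (auto simp: N_def)
  next
    fix x assume "x \<in> (\<Union>d\<in>{d. d dvd M}. N d)"
    then obtain d where "d dvd M" "x ^ d = 1" by (auto simp: N_def)
    then show "x \<in> {x. x ^ M = 1}" by (auto simp: power_mult elim!: dvdE)
  qed
  have "M = card {x :: 'a. x ^ M = 1}" by (rule card_roots_of_unity[OF less.prems, symmetric])
  also have "\<dots> = card (\<Union>d\<in>{d. d dvd M}. N d)" by (simp only: union)
  also have "\<dots> = (\<Sum>d | d dvd M. card (N d))"
  proof (rule card_UN_disjoint[OF findvd])
    show "\<forall>d\<in>{d. d dvd M}. finite (N d)" using fin dpos by blast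
    show "\<forall>d\<in>{d. d dvd M}. \<forall>d'\<in>{d. d dvd M}. d \<noteq> d' \<longrightarrow> N d \<inter> N d' = {}"
      unfolding N_def by blast
  qed

  also have "\<dots> = card (N M) + (\<Sum>d\<in>{d. d dvd M} - {M}. card (N d))"
    using findvd by (intro sum.remove) auto
  also have "(\<Sum>d\<in>{d. d dvd M} - {M}. card (N d)) = (\<Sum>d\<in>{d. d dvd M} - {M}. totient d)"
  proof (rule sum.cong[OF refl])
    fix d assume "d \<in> {d. d dvd M} - {M}"
    then have d: "d dvd M" "d \<noteq> M" by blast+
    have "d < M" using dvd_imp_le[OF d(1) less.prems] d(2) by linarith
    from less.IH[OF this dpos[OF d(1)]] show "card (N d) = totient d" unfolding N_def .
  qed
  finally have "M = card (N M) + (\<Sum>d\<in>{d. d dvd M} - {M}. totient d)" .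
  moreover have "M = totient M + (\<Sum>d\<in>{d. d dvd M} - {M}. totient d)"
    by (rule trans[OF totient_divisor_sum[symmetric]]) (use findvd in \<open>auto intro: sum.remove\<close>)
  ultimately have "card (N M) = totient M" by linarith
  then show ?case by (simp only: N_def)
qed

lemma primitive_root_exists:
  assumes "M > 0"
  shows "\<exists>w :: 'a::{alg_closed_field, field_char_0}. w ^ M = 1 \<and> (\<forall>x. x ^ M = 1 \<longrightarrow> (\<exists>k. x = w ^ k))"
proof -
  have "card {x :: 'a. x ^ M = 1 \<and> root_order x = M} > 0"
    unfolding card_root_order[OF assms] using assms by simp
  then have "{x :: 'a. x ^ M = 1 \<and> root_order x = M} \<noteq> {}" by (auto simp del: Collect_empty_eq)
  then obtain w :: 'a where w: "w ^ M = 1" "root_order w = M" by auto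
  have "w ^ k = 1 \<longleftrightarrow> M dvd k" for k using root_order(2)[OF w(1) assms] w(2) by simp
  from powers_of_primitive_root[OF assms this] show ?thesis using w(1) by blast
qed

subsection \<open>Tori modulo monomial automorphisms\<close>

definition torus_equiv :: "nat \<Rightarrow> 'a::field vec \<Rightarrow> 'a vec \<Rightarrow> bool" where
  "torus_equiv m \<mu> \<nu> \<longleftrightarrow> \<mu> \<in> torus m \<and> (\<exists>A\<in>GL_mat m. \<nu> = monomial_act A \<mu>)"

lemma torus_equiv_torus: "torus_equiv m \<mu> \<nu> \<Longrightarrow> \<mu> \<in> torus m \<and> \<nu> \<in> torus m"
  unfolding torus_equiv_def using monomial_act_torus[OF GL_mat_carrier] by blast

lemma torus_equiv_refl: "\<mu> \<in> torus m \<Longrightarrow> torus_equiv m \<mu> \<mu>"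
  unfolding torus_equiv_def using monomial_act_one[OF torus_carrier] GL_mat_one by metis

lemma torus_equiv_trans:
  assumes "torus_equiv m \<mu> \<nu>" "torus_equiv m \<nu> \<rho>"
  shows "torus_equiv m \<mu> \<rho>"
proof -
  obtain A B where A: "A \<in> GL_mat m" "\<nu> = monomial_act A \<mu>" and B: "B \<in> GL_mat m" "\<rho> = monomial_act B \<nu>"
    and \<mu>: "\<mu> \<in> torus m" using assms unfolding torus_equiv_def by blast
  have "\<rho> = monomial_act (B * A) \<mu>"
    unfolding A(2) B(2) by (rule monomial_act_mult[symmetric, OF GL_mat_carrier[OF B(1)] GL_mat_carrier[OF A(1)] \<mu>])
  then show ?thesis unfolding torus_equiv_def using GL_mat_mult[OF B(1) A(1)] \<mu> by blast
qed

lemma torus_equiv_sym: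
  assumes "torus_equiv m \<mu> \<nu>"
  shows "torus_equiv m \<nu> \<mu>"
proof -
  obtain A where A: "A \<in> GL_mat m" "\<nu> = monomial_act A \<mu>" and \<mu>: "\<mu> \<in> torus m"
    using assms unfolding torus_equiv_def by blast
  obtain B where B: "B \<in> GL_mat m" "B * A = 1\<^sub>m m" using GL_mat_inverse[OF A(1)] by blast
  have "monomial_act B \<nu> = \<mu>"
    unfolding A(2) monomial_act_mult[symmetric, OF GL_mat_carrier[OF B(1)] GL_mat_carrier[OF A(1)] \<mu>] B(2)
    by (rule monomial_act_one[OF torus_carrier[OF \<mu>]])
  then show ?thesis unfolding torus_equiv_def using B(1) torus_equiv_torus[OF assms] by blast
qed

section \<open>Elementary integral operations on tuples of weights\<close>

definition upd :: "'a vec \<Rightarrow> nat \<Rightarrow> 'a \<Rightarrow> 'a vec" where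
  "upd \<mu> i a = vec (dim_vec \<mu>) (\<lambda>j. if j = i then a else \<mu> $ j)"

lemma upd_simps [simp]:
  "dim_vec (upd \<mu> i a) = dim_vec \<mu>"
  "j < dim_vec \<mu> \<Longrightarrow> upd \<mu> i a $ j = (if j = i then a else \<mu> $ j)"
  by (auto simp: upd_def)

lemma torus_equiv_addrow:
  assumes \<mu>: "\<mu> \<in> torus m" and ij: "i < m" "j < m" "i \<noteq> j"
  shows "torus_equiv m \<mu> (upd \<mu> i (\<mu> $ i * \<mu> $ j powi k))"
proof -
  have dim: "dim_vec \<mu> = m" using torus_carrier[OF \<mu>] by simp
  have GL: "addrow_mat m k i j \<in> GL_mat m"
    by (rule GL_matI[OF _ _ addrow_mat_inv[OF ij, of k] addrow_mat_inv[OF ij, of "- k", simplified]]) auto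
  have "monomial_act (addrow_mat m k i j) \<mu> = upd \<mu> i (\<mu> $ i * \<mu> $ j powi k)"
  proof (rule eq_vecI)
    fix r assume "r < dim_vec (upd \<mu> i (\<mu> $ i * \<mu> $ j powi k))"
    then have r: "r < m" by (simp add: dim)
    have "monomial_act (addrow_mat m k i j) \<mu> $ r =
        (\<Prod>c<m. \<mu> $ c powi (if r = c then 1 else 0) * \<mu> $ c powi (if j = c then if r = i then k else 0 else 0))"
    proof -
      have "monomial_act (addrow_mat m k i j) \<mu> $ r = (\<Prod>c<m. \<mu> $ c powi (addrow_mat m k i j $$ (r, c)))"
        using r by (intro monomial_act_index) simp_all
      also have "\<dots> = (\<Prod>c<m. \<mu> $ c powi (if r = c then 1 else 0) * \<mu> $ c powi (if j = c then if r = i then k else 0 else 0))"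
        by (rule prod.cong[OF refl]) (use r ij in auto)
      finally show ?thesis .
    qed
    also have "\<dots> = \<mu> $ r * \<mu> $ j powi (if r = i then k else 0)"
      unfolding prod.distrib prod_powi_delta[OF r, of "\<lambda>c. \<mu> $ c"] prod_powi_delta[OF ij(2), of "\<lambda>c. \<mu> $ c"] by simp
    finally show "monomial_act (addrow_mat m k i j) \<mu> $ r = upd \<mu> i (\<mu> $ i * \<mu> $ j powi k) $ r"
      using r by (simp add: dim)
  qed (simp add: dim)
  then show ?thesis unfolding torus_equiv_def using GL \<mu> by metis
qed

lemma torus_equiv_swap:
  assumes \<mu>: "\<mu> \<in> torus m" and ij: "i < m" "j < m"
  shows "torus_equiv m \<mu> (vec m (\<lambda>r. \<mu> $ Transposition.transpose i j r))"
proof -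
  have GL: "swaprows_mat m i j \<in> GL_mat m"
    by (rule GL_matI[OF _ _ swaprows_mat_inv[OF ij] swaprows_mat_inv[OF ij]]) auto
  have "monomial_act (swaprows_mat m i j) \<mu> = vec m (\<lambda>r. \<mu> $ Transposition.transpose i j r)"
  proof (rule eq_vecI)
    fix r assume "r < dim_vec (vec m (\<lambda>r. \<mu> $ Transposition.transpose i j r))"
    then have r: "r < m" by simp
    have tr: "Transposition.transpose i j r < m" using r ij by (auto simp: Transposition.transpose_def)
    have "monomial_act (swaprows_mat m i j) \<mu> $ r = (\<Prod>c<m. \<mu> $ c powi (if Transposition.transpose i j r = c then 1 else 0))"
      using r ij by (subst monomial_act_index[of _ m m]) (auto simp: Transposition.transpose_def intro!: prod.cong)
    then show "monomial_act (swaprows_mat m i j) \<mu> $ r = vec m (\<lambda>r. \<mu> $ Transposition.transpose i j r) $ r"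
      using r unfolding prod_powi_delta[OF tr, of "\<lambda>c. \<mu> $ c"] by simp
  qed simp
  then show ?thesis unfolding torus_equiv_def using GL \<mu> by metis
qed

lemma torus_equiv_inverse:
  assumes \<mu>: "\<mu> \<in> torus m" and i: "i < m"
  shows "torus_equiv m \<mu> (upd \<mu> i (inverse (\<mu> $ i)))"
proof -
  have dim: "dim_vec \<mu> = m" using torus_carrier[OF \<mu>] by simp
  define D :: "int mat" where "D = mat m m (\<lambda>(r, c). if r = c then if r = i then - 1 else 1 else 0)"
  have D: "D \<in> carrier_mat m m" by (simp add: D_def)
  have "D * D = 1\<^sub>m m"
  proof (rule eq_matI)
    fix r c assume "r < dim_row (1\<^sub>m m :: int mat)" "c < dim_col (1\<^sub>m m :: int mat)"
    then have rc: "r < m" "c < m" by auto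
    have "(D * D) $$ (r, c) = (\<Sum>k<m. D $$ (r, k) * D $$ (k, c))"
      using D rc by (simp add: scalar_prod_def lessThan_atLeast0)
    also have "\<dots> = (\<Sum>k<m. if k = r then if r = c then 1 else 0 else 0)"
      using rc by (intro sum.cong) (auto simp: D_def)
    finally show "(D * D) $$ (r, c) = 1\<^sub>m m $$ (r, c)" using rc by simp
  qed (use D in auto)
  then have GL: "D \<in> GL_mat m" using GL_matI[OF D D] by blast
  have "monomial_act D \<mu> = upd \<mu> i (inverse (\<mu> $ i))"
  proof (rule eq_vecI)
    fix r assume "r < dim_vec (upd \<mu> i (inverse (\<mu> $ i)))"
    then have r: "r < m" by (simp add: dim)
    have "monomial_act D \<mu> $ r = (\<Prod>c<m. \<mu> $ c powi (if r = c then if r = i then - 1 else 1 else 0))"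
      using r by (subst monomial_act_index[OF D]) (auto simp: D_def intro!: prod.cong)
    then show "monomial_act D \<mu> $ r = upd \<mu> i (inverse (\<mu> $ i)) $ r"
      using r unfolding prod_powi_delta[OF r, of "\<lambda>c. \<mu> $ c"] by (simp add: dim power_int_minus)
  qed (simp add: dim D_def)
  then show ?thesis unfolding torus_equiv_def using GL \<mu> by metis
qed

text \<open>Used to move powers of the torsion entry into the free entries. As j lies outside I, the
  multiplying entry stays the same throughout.\<close>

lemma torus_equiv_shear:
  assumes \<mu>: "\<mu> \<in> torus m" and j: "j < m" and I: "finite I" "I \<subseteq> {..<m} - {j}"
  shows "torus_equiv m \<mu> (vec m (\<lambda>i. if i \<in> I then \<mu> $ i * \<mu> $ j powi k i else \<mu> $ i))"
  using I
proof (induction I rule: finite_induct)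
  case empty
  have "vec m (\<lambda>i. \<mu> $ i) = \<mu>" using torus_carrier[OF \<mu>] by (intro eq_vecI) auto
  then show ?case using torus_equiv_refl[OF \<mu>] by simp
next
  case (insert i I)
  let ?v = "vec m (\<lambda>i. if i \<in> I then \<mu> $ i * \<mu> $ j powi k i else \<mu> $ i)"
  have IH: "torus_equiv m \<mu> ?v" using insert by blast
  have ij: "i < m" "i \<noteq> j" "j \<notin> I" using insert.prems by auto
  have "upd ?v i (?v $ i * ?v $ j powi k i) =
      vec m (\<lambda>r. if r \<in> insert i I then \<mu> $ r * \<mu> $ j powi k r else \<mu> $ r)"
    using ij j insert.hyps(2) by (intro eq_vecI) auto
  then show ?case
    using torus_equiv_trans[OF IH torus_equiv_addrow[of ?v m i j "k i"]] torus_equiv_torus[OF IH] ij j by simp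
qed

text \<open>Both reductions are Euclid's algorithm on the exponents.\<close>

lemma reduce_pair:
  fixes e :: "nat \<Rightarrow> int"
  assumes S: "finite S" "i \<in> S" "j \<in> S" "i \<noteq> j" and e: "e i \<noteq> 0" "e j \<noteq> 0" "\<bar>e j\<bar> \<le> \<bar>e i\<bar>"
  shows "(\<Sum>r\<in>S. \<bar>(e(i := e i - sgn (e i) * sgn (e j) * e j)) r\<bar>) < (\<Sum>r\<in>S. \<bar>e r\<bar>)"
proof (rule sum_strict_mono_ex1[OF S(1)])
  have "\<bar>e i - sgn (e i) * sgn (e j) * e j\<bar> < \<bar>e i\<bar>"
    using e by (auto simp: sgn_if abs_if split: if_splits)
  then show "\<forall>x\<in>S. \<bar>(e(i := e i - sgn (e i) * sgn (e j) * e j)) x\<bar> \<le> \<bar>e x\<bar>"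
    "\<exists>a\<in>S. \<bar>(e(i := e i - sgn (e i) * sgn (e j) * e j)) a\<bar> < \<bar>e a\<bar>"
    using S(2) by auto
qed

lemma relation_gives_torsion:
  fixes \<mu> :: "'a::field vec"
  assumes "\<mu> \<in> torus m" "S \<subseteq> {..<m}" "\<exists>i\<in>S. e i \<noteq> 0" "(\<Prod>i\<in>S. \<mu> $ i powi e i) = 1"
  shows "\<exists>\<nu>. torus_equiv m \<mu> \<nu> \<and> (\<forall>i<m. i \<notin> S \<longrightarrow> \<nu> $ i = \<mu> $ i) \<and>
    (\<exists>j\<in>S. \<exists>c. c \<noteq> 0 \<and> \<nu> $ j powi c = 1)"
  using assms(1,3,4)
proof (induction "nat (\<Sum>i\<in>S. \<bar>e i\<bar>)" arbitrary: \<mu> e rule: less_induct)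
  case less
  note \<mu> = less.prems(1)
  have fin: "finite S" using assms(2) finite_subset by blast
  \<comment> \<open>The smallest nonzero exponent, so that any other nonzero exponent can be reduced
    by it.\<close>
  obtain j where j: "j \<in> S" "e j \<noteq> 0" "\<forall>i\<in>S. e i \<noteq> 0 \<longrightarrow> \<bar>e j\<bar> \<le> \<bar>e i\<bar>"
  proof -
    have "finite {i\<in>S. e i \<noteq> 0}" "{i\<in>S. e i \<noteq> 0} \<noteq> {}" using fin less.prems(2) by auto
    from arg_min_if_finite[OF this, of "\<lambda>i. \<bar>e i\<bar>"]
    show thesis using that[of "arg_min_on (\<lambda>i. \<bar>e i\<bar>) {i\<in>S. e i \<noteq> 0}"] by (auto simp: not_less)
  qed
  show ?case
  proof (cases "\<exists>i\<in>S. i \<noteq> j \<and> e i \<noteq> 0")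
    case False
    then have "(\<Prod>i\<in>S. \<mu> $ i powi e i) = \<mu> $ j powi e j"
      using fin j(1) by (subst prod.remove[of _ j]) (auto intro!: prod.neutral)
    then show ?thesis using torus_equiv_refl[OF \<mu>] j less.prems(3) by metis
  next
    case True
    then obtain i where i: "i \<in> S" "i \<noteq> j" "e i \<noteq> 0" by blast
    define s where "s = sgn (e i) * sgn (e j)"
    define e' where "e' = e(i := e i - s * e j)"
    \<comment> \<open>Exponents transform contragrediently: multiplying \<mu>_j by \<mu>_i^s is
      compensated by subtracting s e_j from e_i, so the relation persists.\<close>
    define \<nu> where "\<nu> = upd \<mu> j (\<mu> $ j * \<mu> $ i powi s)"
    have m: "i < m" "j < m" using i j assms(2) by auto
    have dim: "dim_vec \<mu> = m" using torus_carrier[OF \<mu>] by simp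
    have eq: "torus_equiv m \<mu> \<nu>" unfolding \<nu>_def by (rule torus_equiv_addrow[OF \<mu> m(2,1)]) (use i in simp)
    have "(\<Sum>r\<in>S. \<bar>e' r\<bar>) < (\<Sum>r\<in>S. \<bar>e r\<bar>)"
      unfolding e'_def s_def using i j by (intro reduce_pair[OF fin i(1) j(1)]) auto
    moreover have "0 \<le> (\<Sum>r\<in>S. \<bar>e' r\<bar>)" by (intro sum_nonneg) simp
    ultimately have lt: "nat (\<Sum>r\<in>S. \<bar>e' r\<bar>) < nat (\<Sum>r\<in>S. \<bar>e r\<bar>)"
      by (simp only: nat_less_eq_zless)
    have "\<exists>i\<in>S. e' i \<noteq> 0" using j i(2) by (intro bexI[of _ j]) (auto simp: e'_def)
    moreover have "(\<Prod>r\<in>S. \<nu> $ r powi e' r) = 1"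
    proof -
      have split: "(\<Prod>r\<in>S. f r) = f i * (f j * (\<Prod>r\<in>S - {i} - {j}. f r))" for f :: "nat \<Rightarrow> 'a"
        using fin i j by (simp add: prod.remove[of S i] prod.remove[of "S - {i}" j])
      have rest: "(\<Prod>r\<in>S - {i} - {j}. \<nu> $ r powi e' r) = (\<Prod>r\<in>S - {i} - {j}. \<mu> $ r powi e r)"
        using assms(2) by (intro prod.cong) (auto simp: \<nu>_def e'_def dim)
      have nz: "\<mu> $ i \<noteq> 0" using torus_nonzero[OF \<mu> m(1)] .
      have "\<nu> $ i powi e' i * \<nu> $ j powi e' j =
          (\<mu> $ i powi (e i - s * e j) * \<mu> $ i powi (s * e j)) * \<mu> $ j powi e j"
        using i m by (simp add: \<nu>_def e'_def dim power_int_mult_distrib power_int_mult mult_ac)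
      also have "\<mu> $ i powi (e i - s * e j) * \<mu> $ i powi (s * e j) = \<mu> $ i powi e i"
        using nz by (simp flip: power_int_add)
      finally have "\<nu> $ i powi e' i * \<nu> $ j powi e' j = \<mu> $ i powi e i * \<mu> $ j powi e j" .
      then have "(\<Prod>r\<in>S. \<nu> $ r powi e' r) = (\<Prod>r\<in>S. \<mu> $ r powi e r)"
        unfolding split rest by (simp add: mult.assoc[symmetric])
      then show ?thesis using less.prems(3) by simp
    qed
    ultimately obtain \<rho> where \<rho>: "torus_equiv m \<nu> \<rho>" "\<forall>i<m. i \<notin> S \<longrightarrow> \<rho> $ i = \<nu> $ i"
      "\<exists>j\<in>S. \<exists>c. c \<noteq> 0 \<and> \<rho> $ j powi c = 1"
      using less.hyps[OF lt, of \<nu>] torus_equiv_torus[OF eq] by blast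
    have "\<forall>i<m. i \<notin> S \<longrightarrow> \<rho> $ i = \<mu> $ i"
      using \<rho>(2) j(1) by (auto simp: \<nu>_def dim)
    then show ?thesis using torus_equiv_trans[OF eq \<rho>(1)] \<rho>(3) by blast
  qed
qed

lemma powers_reduce:
  fixes \<mu> :: "'a::field vec"
  assumes "\<mu> \<in> torus m" "S \<subseteq> {..<m}" "S \<noteq> {}" "w \<noteq> 0" "\<forall>i\<in>S. \<mu> $ i = w powi e i"
  shows "\<exists>\<nu>. torus_equiv m \<mu> \<nu> \<and> (\<forall>i<m. i \<notin> S \<longrightarrow> \<nu> $ i = \<mu> $ i) \<and>
    (\<exists>j\<in>S. (\<exists>c. \<nu> $ j = w powi c) \<and> (\<forall>i\<in>S - {j}. \<nu> $ i = 1))"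
  using assms(1,5)
proof (induction "nat (\<Sum>i\<in>S. \<bar>e i\<bar>)" arbitrary: \<mu> e rule: less_induct)
  case less
  note \<mu> = less.prems(1)
  have fin: "finite S" using assms(2) finite_subset by blast
  show ?case
  proof (cases "\<exists>i\<in>S. \<exists>j\<in>S. i \<noteq> j \<and> e i \<noteq> 0 \<and> e j \<noteq> 0")
    case False
    obtain j where j: "j \<in> S" "\<forall>i\<in>S - {j}. e i = 0"
    proof (cases "\<exists>j\<in>S. e j \<noteq> 0")
      case True
      then show thesis using that False by blast
    next
      case False
      then show thesis using that assms(3) by blast
    qed
    have "\<forall>i\<in>S - {j}. \<mu> $ i = 1" using j less.prems(2) by simp
    then show ?thesis using torus_equiv_refl[OF \<mu>] j(1) less.prems(2) by blast
  next
    case True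
    then obtain a b where ab: "a \<in> S" "b \<in> S" "a \<noteq> b" "e a \<noteq> 0" "e b \<noteq> 0" by blast
    obtain i j where ij: "i \<in> S" "j \<in> S" "i \<noteq> j" "e i \<noteq> 0" "e j \<noteq> 0" "\<bar>e j\<bar> \<le> \<bar>e i\<bar>"
    proof (cases "\<bar>e b\<bar> \<le> \<bar>e a\<bar>")
      case True
      then show thesis using that[OF ab] by blast
    next
      case False
      then show thesis using that[of b a] ab by simp
    qed
    define s where "s = sgn (e i) * sgn (e j)"
    define e' where "e' = e(i := e i - s * e j)"
    \<comment> \<open>Here the e_i are exponents of the entries in w, so reducing e_i by s e_j means
      dividing \<mu>_i by \<mu>_j^s.\<close>
    define \<nu> where "\<nu> = upd \<mu> i (\<mu> $ i * \<mu> $ j powi (- s))"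
    have m: "i < m" "j < m" using ij assms(2) by auto
    have dim: "dim_vec \<mu> = m" using torus_carrier[OF \<mu>] by simp
    have eq: "torus_equiv m \<mu> \<nu>" unfolding \<nu>_def by (rule torus_equiv_addrow[OF \<mu> m ij(3)])
    have "(\<Sum>r\<in>S. \<bar>e' r\<bar>) < (\<Sum>r\<in>S. \<bar>e r\<bar>)"
      unfolding e'_def s_def by (rule reduce_pair[OF fin ij])
    moreover have "0 \<le> (\<Sum>r\<in>S. \<bar>e' r\<bar>)" by (intro sum_nonneg) simp
    ultimately have lt: "nat (\<Sum>r\<in>S. \<bar>e' r\<bar>) < nat (\<Sum>r\<in>S. \<bar>e r\<bar>)"
      by (simp only: nat_less_eq_zless)
    have "\<nu> $ r = w powi e' r" if r: "r \<in> S" for r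
    proof (cases "r = i")
      case True
      have "\<nu> $ i = w powi e i * (w powi e j) powi (- s)"
        using less.prems(2) ij m by (simp add: \<nu>_def dim)
      also have "\<dots> = w powi (e i + e j * - s)"
        unfolding power_int_mult[symmetric] using assms(4) by (simp flip: power_int_add)
      finally show ?thesis using True by (simp add: e'_def mult.commute)
    next
      case False
      then show ?thesis using r less.prems(2) assms(2) by (auto simp: \<nu>_def e'_def dim)
    qed
    then obtain \<rho> where \<rho>: "torus_equiv m \<nu> \<rho>" "\<forall>i<m. i \<notin> S \<longrightarrow> \<rho> $ i = \<nu> $ i"
      "\<exists>j\<in>S. (\<exists>c. \<rho> $ j = w powi c) \<and> (\<forall>i\<in>S - {j}. \<rho> $ i = 1)"
      using less.hyps[OF lt, of \<nu>] torus_equiv_torus[OF eq] by blast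
    have "\<forall>i<m. i \<notin> S \<longrightarrow> \<rho> $ i = \<mu> $ i"
      using \<rho>(2) ij(1) by (auto simp: \<nu>_def dim)
    then show ?thesis using torus_equiv_trans[OF eq \<rho>(1)] \<rho>(3) by blast
  qed
qed

section \<open>The subgroup generated by the weights, and normal tuples\<close>

definition tspan :: "nat \<Rightarrow> 'a::field vec \<Rightarrow> 'a \<Rightarrow> bool" where
  "tspan m \<mu> x \<longleftrightarrow> (\<exists>e :: nat \<Rightarrow> int. x = (\<Prod>i<m. \<mu> $ i powi e i))"

lemma prod_powi_compose:
  fixes x :: "nat \<Rightarrow> 'a::field"
  assumes "\<And>j. j < k \<Longrightarrow> x j \<noteq> 0"
  shows "(\<Prod>i<m. (\<Prod>j<k. x j powi a i j) powi b i) = (\<Prod>j<k. x j powi (\<Sum>i<m. a i j * b i))"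
proof -
  have "(\<Prod>i<m. (\<Prod>j<k. x j powi a i j) powi b i) = (\<Prod>i<m. \<Prod>j<k. x j powi (a i j * b i))"
    by (simp add: prod_powi power_int_mult)
  also have "\<dots> = (\<Prod>j<k. \<Prod>i<m. x j powi (a i j * b i))" by (rule prod.swap)
  also have "\<dots> = (\<Prod>j<k. x j powi (\<Sum>i<m. a i j * b i))"
    using assms by (intro prod.cong refl) (simp add: powi_sum)
  finally show ?thesis .
qed

definition torsion :: "'a::field \<Rightarrow> bool" where
  "torsion x \<longleftrightarrow> (\<exists>M>0. x ^ M = 1)"

definition independent_upto :: "nat \<Rightarrow> 'a::field vec \<Rightarrow> bool" where
  "independent_upto r \<mu> \<longleftrightarrow> (\<forall>e :: nat \<Rightarrow> int. (\<Prod>i<r. \<mu> $ i powi e i) = 1 \<longrightarrow> (\<forall>i<r. e i = 0))"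

text \<open>For r < m the torsion entry at index r may itself be 1; for r = m there is none.\<close>

definition normal_tuple :: "nat \<Rightarrow> nat \<Rightarrow> 'a::field vec \<Rightarrow> bool" where
  "normal_tuple m r \<mu> \<longleftrightarrow> \<mu> \<in> torus m \<and> r \<le> m \<and> independent_upto r \<mu> \<and>
    (r < m \<longrightarrow> torsion (\<mu> $ r)) \<and> (\<forall>i. r < i \<longrightarrow> i < m \<longrightarrow> \<mu> $ i = 1)"

lemma torsion_powi:
  assumes "x powi c = 1" "c \<noteq> 0"
  shows "torsion x"
proof -
  have "x ^ nat \<bar>c\<bar> = 1"
    using assms by (cases "c > 0") (auto simp: power_int_def power_inverse split: if_splits)
  then show ?thesis using assms(2) unfolding torsion_def by (intro exI[of _ "nat \<bar>c\<bar>"]) auto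
qed

lemma torsion_common:
  assumes "finite S" "\<forall>i\<in>S. torsion (x i)"
  shows "\<exists>M>0. \<forall>i\<in>S. x i ^ M = 1"
  using assms
proof (induction S rule: finite_induct)
  case (insert i S)
  obtain M where M: "M > 0" "\<forall>i\<in>S. x i ^ M = 1" using insert by auto
  obtain N where N: "N > 0" "x i ^ N = 1" using insert.prems unfolding torsion_def by auto
  have "\<forall>j\<in>insert i S. x j ^ (M * N) = 1"
    using M N by (auto simp: power_mult) (metis N(2) mult.commute power_mult power_one)
  then show ?case using M N by (intro exI[of _ "M * N"]) auto
qed auto

lemma independent_upto_cong:
  "(\<And>i. i < r \<Longrightarrow> \<mu> $ i = \<nu> $ i) \<Longrightarrow> independent_upto r \<mu> = independent_upto r \<nu>"
  unfolding independent_upto_def by simp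

text \<open>r is chosen least such that all entries from index r on can be made torsion. A relation
  among the first r entries would make one of them torsion, and a swap to index r - 1 would
  contradict minimality.\<close>

lemma independent_torsion_form:
  fixes \<mu> :: "'a::{alg_closed_field, field_char_0} vec"
  assumes "\<mu> \<in> torus m"
  obtains r \<nu> where "torus_equiv m \<mu> \<nu>" "r \<le> m" "independent_upto r \<nu>"
    "\<forall>i. r \<le> i \<longrightarrow> i < m \<longrightarrow> torsion (\<nu> $ i)"
proof -
  define P where "P r \<longleftrightarrow> (\<exists>\<nu>. torus_equiv m \<mu> \<nu> \<and> (\<forall>i. r \<le> i \<longrightarrow> i < m \<longrightarrow> torsion (\<nu> $ i)))" for r
  define r where "r = (LEAST r. P r)"
  have "P m" unfolding P_def using torus_equiv_refl[OF assms] by (intro exI[of _ \<mu>]) auto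
  then have r: "P r" "r \<le> m" unfolding r_def by (rule LeastI, rule Least_le)
  then obtain \<nu> where \<nu>: "torus_equiv m \<mu> \<nu>" "\<forall>i. r \<le> i \<longrightarrow> i < m \<longrightarrow> torsion (\<nu> $ i)"
    unfolding P_def by blast
  have "independent_upto r \<nu>"
  proof (rule ccontr)
    assume "\<not> independent_upto r \<nu>"
    then obtain e :: "nat \<Rightarrow> int" where e: "(\<Prod>i<r. \<nu> $ i powi e i) = 1" "\<exists>i\<in>{..<r}. e i \<noteq> 0"
      unfolding independent_upto_def by blast
    have S: "{..<r} \<subseteq> {..<m}" using r(2) by auto
    obtain \<rho> j c where \<rho>: "torus_equiv m \<nu> \<rho>" "\<forall>i<m. i \<notin> {..<r} \<longrightarrow> \<rho> $ i = \<nu> $ i"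
      "j < r" "c \<noteq> 0" "\<rho> $ j powi c = 1"
      using relation_gives_torsion[OF _ S e(2,1)] torus_equiv_torus[OF \<nu>(1)] by blast
    let ?\<sigma> = "vec m (\<lambda>i. \<rho> $ Transposition.transpose j (r - 1) i)"
    have m: "j < m" "r - 1 < m" using \<rho>(3) r(2) by auto
    have "torus_equiv m \<rho> ?\<sigma>"
      using torus_equiv_swap[OF _ m] torus_equiv_torus[OF \<rho>(1)] by blast
    then have \<sigma>: "torus_equiv m \<mu> ?\<sigma>" using torus_equiv_trans \<nu>(1) \<rho>(1) by blast
    have "torsion (?\<sigma> $ i)" if i: "r - 1 \<le> i" "i < m" for i
    proof (cases "i = r - 1")
      case True
      then show ?thesis using i \<rho>(4,5) torsion_powi by simp
    next
      case False
      then have "r \<le> i" using i by simp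
      then have "Transposition.transpose j (r - 1) i = i" using \<rho>(3) by (simp add: Transposition.transpose_def)
      then show ?thesis using \<open>r \<le> i\<close> i \<rho>(2) \<nu>(2) by simp
    qed
    then have "P (r - 1)" unfolding P_def using \<sigma> by blast
    then show False using not_less_Least[of "r - 1" P] \<rho>(3) unfolding r_def[symmetric] by simp
  qed
  then show thesis using that \<nu> r(2) by blast
qed

text \<open>All torsion entries are powers of one root of unity w, so \<open>powers_reduce\<close>
  gathers them into a single entry, which is swapped to index r.\<close>

lemma normal_tuple_exists:
  fixes \<mu> :: "'a::{alg_closed_field, field_char_0} vec"
  assumes "\<mu> \<in> torus m"
  shows "\<exists>r \<nu>. torus_equiv m \<mu> \<nu> \<and> normal_tuple m r \<nu>"
proof -
  obtain r \<nu> where \<nu>: "torus_equiv m \<mu> \<nu>" "r \<le> m" "independent_upto r \<nu>"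
    "\<forall>i. r \<le> i \<longrightarrow> i < m \<longrightarrow> torsion (\<nu> $ i)" using independent_torsion_form[OF assms] .
  note \<nu>t = conjunct2[OF torus_equiv_torus[OF \<nu>(1)]]
  show ?thesis
  proof (cases "r = m")
    case True
    then have "normal_tuple m r \<nu>" using \<nu> \<nu>t by (auto simp: normal_tuple_def)
    then show ?thesis using \<nu>(1) by blast
  next
    case False
    then have rm: "r < m" using \<nu>(2) by simp
    have "\<forall>i\<in>{r..<m}. torsion (\<nu> $ i)" using \<nu>(4) by simp
    then obtain M where M: "M > 0" "\<forall>i\<in>{r..<m}. (\<nu> $ i) ^ M = 1"
      using torsion_common[of "{r..<m}" "\<lambda>i. \<nu> $ i"] by blast
    obtain w :: 'a where w: "w ^ M = 1" "\<forall>x. x ^ M = 1 \<longrightarrow> (\<exists>k. x = w ^ k)"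
      using primitive_root_exists[OF M(1)] by blast
    have w0: "w \<noteq> 0" using w(1) M(1) by (auto simp: power_0_left)
    have "\<forall>i\<in>{r..<m}. \<exists>k. \<nu> $ i = w ^ k" using M(2) w(2) by blast
    then obtain k where k: "\<forall>i\<in>{r..<m}. \<nu> $ i = w ^ k i" by metis
    have S: "{r..<m} \<subseteq> {..<m}" "{r..<m} \<noteq> {}" "\<forall>i\<in>{r..<m}. \<nu> $ i = w powi int (k i)"
      using rm k by auto
    obtain \<rho> j c where \<rho>: "torus_equiv m \<nu> \<rho>" "\<forall>i<m. i \<notin> {r..<m} \<longrightarrow> \<rho> $ i = \<nu> $ i"
      "j \<in> {r..<m}" "\<rho> $ j = w powi c" "\<forall>i\<in>{r..<m} - {j}. \<rho> $ i = 1"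
      using powers_reduce[OF \<nu>t S(1,2) w0 S(3)] by blast
    let ?\<sigma> = "vec m (\<lambda>i. \<rho> $ Transposition.transpose j r i)"
    have j: "j < m" "r \<le> j" using \<rho>(3) by auto
    have eq: "torus_equiv m \<rho> ?\<sigma>"
      using torus_equiv_swap[OF _ j(1) rm] torus_equiv_torus[OF \<rho>(1)] by blast
    have "normal_tuple m r ?\<sigma>"
      unfolding normal_tuple_def
    proof (intro conjI impI allI)
      show "?\<sigma> \<in> torus m" using torus_equiv_torus[OF eq] by blast
      have "?\<sigma> $ i = \<nu> $ i" if "i < r" for i
        using that rm j \<rho>(2) by (simp add: Transposition.transpose_def)
      then show "independent_upto r ?\<sigma>" using \<nu>(3) independent_upto_cong by metis
      have "(w powi c) ^ M = (w ^ M) powi c"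
        by (metis power_int_mult power_int_of_nat mult.commute)
      then show "torsion (?\<sigma> $ r)" unfolding torsion_def using rm \<rho>(4) w(1) M(1) by auto
      show "?\<sigma> $ i = 1" if "r < i" "i < m" for i
        using that j rm \<rho>(5) by (auto simp: Transposition.transpose_def)
    qed (use rm in simp)
    then show ?thesis using torus_equiv_trans[OF \<nu>(1) torus_equiv_trans[OF \<rho>(1) eq]] by blast
  qed
qed

lemma independent_uptoD:
  assumes ind: "independent_upto r \<mu>" and nz: "\<And>i. i < r \<Longrightarrow> \<mu> $ i \<noteq> 0" and K: "K > 0"
    and eq: "(\<Prod>i<r. \<mu> $ i powi (a i * int K)) = (\<Prod>i<r. \<mu> $ i powi (b i * int K))" and i: "i < r"
  shows "a i = b i"
proof -
  have "(\<Prod>i<r. \<mu> $ i powi ((a i - b i) * int K)) = (\<Prod>i<r. \<mu> $ i powi (a i * int K)) / (\<Prod>i<r. \<mu> $ i powi (b i * int K))"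
    unfolding prod_dividef[symmetric] using nz
    by (intro prod.cong refl) (simp add: left_diff_distrib power_int_diff)
  also have "\<dots> = 1" unfolding eq using nz by (auto simp: power_int_not_zero)
  finally have "(a i - b i) * int K = 0"
    using ind[unfolded independent_upto_def, rule_format, of "\<lambda>i. (a i - b i) * int K"] i by blast
  then show ?thesis using K by simp
qed

text \<open>The default 1 lets the case r = m share the formulas of the case r < m.\<close>

definition torsion_part :: "nat \<Rightarrow> nat \<Rightarrow> 'a::field vec \<Rightarrow> 'a" where
  "torsion_part m r \<mu> = (if r < m then \<mu> $ r else 1)"

lemma normal_tuple_tspan:
  assumes "normal_tuple m r \<mu>" "tspan m \<mu> x"
  shows "\<exists>e c. x = (\<Prod>i<r. \<mu> $ i powi e i) * torsion_part m r \<mu> powi c"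
proof -
  obtain e where e: "x = (\<Prod>i<m. \<mu> $ i powi e i)" using assms(2) unfolding tspan_def by blast
  show ?thesis
  proof (cases "r < m")
    case True
    have "x = (\<Prod>i\<in>{..<Suc r}. \<mu> $ i powi e i)"
      unfolding e using assms(1) True
      by (intro prod.mono_neutral_right) (auto simp: normal_tuple_def)
    then show ?thesis using True by (auto simp: torsion_part_def)
  next
    case False
    then have "r = m" using assms(1) by (simp add: normal_tuple_def)
    then show ?thesis using e by (auto simp: torsion_part_def)
  qed
qed

text \<open>Each tuple is expanded in the other and one expansion is substituted into the other. The
  K-th power removes the roots of unity, and independence then compares exponents: the exponent
  matrices of the free parts are inverse to each other.\<close>

lemma normal_tuple_coefficients:
  assumes \<mu>: "normal_tuple m r \<mu>" and \<nu>: "normal_tuple m s \<nu>" and K: "K > 0"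
    and K\<mu>: "torsion_part m r \<mu> ^ K = 1" and K\<nu>: "torsion_part m s \<nu> ^ K = 1"
    and e: "\<And>i. i < m \<Longrightarrow> \<nu> $ i = (\<Prod>j<r. \<mu> $ j powi e i j) * torsion_part m r \<mu> powi c i"
    and f: "\<And>i. i < m \<Longrightarrow> \<mu> $ i = (\<Prod>j<s. \<nu> $ j powi f i j) * torsion_part m s \<nu> powi d i"
    and i: "i < r" and l: "l < r"
  shows "(\<Sum>j<s. f i j * e j l) = (if i = l then 1 else 0)"
proof -
  have rm: "r \<le> m" "s \<le> m" using \<mu> \<nu> by (auto simp: normal_tuple_def)
  have nz: "\<mu> $ j \<noteq> 0" if "j < r" for j
    using \<mu> that rm torus_nonzero[of \<mu> m j] by (auto simp: normal_tuple_def)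
  have kill: "(t powi k) powi int K = 1" "t powi (int K * k) = 1" if "t ^ K = 1" for t :: 'a and k
    using that by (metis power_int_mult power_int_of_nat mult.commute power_int_1_left)+
  have 1: "\<nu> $ j powi int K = (\<Prod>l<r. \<mu> $ l powi (e j l * int K))" if "j < m" for j
    by (subst e[OF that])
      (simp add: power_int_mult_distrib kill[OF K\<mu>] prod_powi power_int_mult del: power_int_of_nat)
  have "\<mu> $ i powi int K = (\<Prod>j<s. (\<nu> $ j powi int K) powi f i j)"
    using i rm
    by (subst f)
      (simp_all add: power_int_mult_distrib kill[OF K\<nu>] prod_powi power_int_mult[symmetric] mult.commute
        del: power_int_of_nat)
  also have "\<dots> = (\<Prod>j<s. (\<Prod>l<r. \<mu> $ l powi (e j l * int K)) powi f i j)"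
    using rm by (intro prod.cong refl) (simp only: 1 lessThan_iff)
  also have "\<dots> = (\<Prod>l<r. \<mu> $ l powi (\<Sum>j<s. e j l * int K * f i j))"
    by (rule prod_powi_compose) (rule nz)
  also have "\<dots> = (\<Prod>l<r. \<mu> $ l powi ((\<Sum>j<s. f i j * e j l) * int K))"
  proof -
    have "(\<Sum>j<s. e j l * int K * f i j) = (\<Sum>j<s. f i j * e j l) * int K" for l
      unfolding sum_distrib_right by (intro sum.cong refl) simp
    then show ?thesis by (simp only:)
  qed
  finally have "(\<Prod>l<r. \<mu> $ l powi ((\<Sum>j<s. f i j * e j l) * int K)) = \<mu> $ i powi int K" by (rule sym)
  also have "\<dots> = (\<Prod>l<r. \<mu> $ l powi (if i = l then int K else 0))"
    by (rule prod_powi_delta[OF i, symmetric])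
  also have "\<dots> = (\<Prod>l<r. \<mu> $ l powi ((if i = l then 1 else 0) * int K))"
    by (intro prod.cong refl) simp
  finally have eq: "(\<Prod>l<r. \<mu> $ l powi ((\<Sum>j<s. f i j * e j l) * int K)) =
    (\<Prod>l<r. \<mu> $ l powi ((if i = l then 1 else 0) * int K))" .
  have ind: "independent_upto r \<mu>" using \<mu> by (simp add: normal_tuple_def)
  show ?thesis
    by (rule independent_uptoD[where a = "\<lambda>l. \<Sum>j<s. f i j * e j l" and b = "\<lambda>l. if i = l then 1 else 0",
          OF ind nz K eq l])
qed

text \<open>The inverse exponent matrices give an element of GL(r, Z) that matches the free parts up
  to powers of the torsion entry, and a shear by that entry corrects these. Only the torsion entries
  themselves may still differ.\<close>

lemma normal_tuple_compare:
  fixes \<mu> \<nu> :: "'a::field vec"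
  assumes \<mu>: "normal_tuple m r \<mu>" and \<nu>: "normal_tuple m s \<nu>"
    and \<mu>\<nu>: "\<forall>i<m. tspan m \<mu> (\<nu> $ i)" and \<nu>\<mu>: "\<forall>i<m. tspan m \<nu> (\<mu> $ i)"
  shows "r = s" "torus_equiv m \<mu> (upd \<nu> r (\<mu> $ r))" "r < m \<Longrightarrow> \<exists>k. \<nu> $ r = \<mu> $ r powi k"
proof -
  have rm: "r \<le> m" "s \<le> m" and t: "\<mu> \<in> torus m" "\<nu> \<in> torus m"
    using \<mu> \<nu> by (auto simp: normal_tuple_def)
  have dims: "dim_vec \<mu> = m" "dim_vec \<nu> = m"
    using torus_carrier[OF t(1)] torus_carrier[OF t(2)] by simp_all
  have "\<forall>i. \<exists>e c. i < m \<longrightarrow> \<nu> $ i = (\<Prod>j<r. \<mu> $ j powi e j) * torsion_part m r \<mu> powi c"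
    using normal_tuple_tspan[OF \<mu>] \<mu>\<nu> by blast
  then obtain e c where e: "\<And>i. i < m \<Longrightarrow> \<nu> $ i = (\<Prod>j<r. \<mu> $ j powi e i j) * torsion_part m r \<mu> powi c i"
    by metis
  have "\<forall>i. \<exists>f d. i < m \<longrightarrow> \<mu> $ i = (\<Prod>j<s. \<nu> $ j powi f j) * torsion_part m s \<nu> powi d"
    using normal_tuple_tspan[OF \<nu>] \<nu>\<mu> by blast
  then obtain f d where f: "\<And>i. i < m \<Longrightarrow> \<mu> $ i = (\<Prod>j<s. \<nu> $ j powi f i j) * torsion_part m s \<nu> powi d i"
    by metis
  have tors: "torsion (torsion_part m r \<mu>)" "torsion (torsion_part m s \<nu>)"
    using \<mu> \<nu> by (auto simp: torsion_part_def normal_tuple_def torsion_def)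
  obtain K where K: "K > 0" "torsion_part m r \<mu> ^ K = 1" "torsion_part m s \<nu> ^ K = 1"
    using torsion_common[of "{torsion_part m r \<mu>, torsion_part m s \<nu>}" "\<lambda>x. x"] tors by auto
  have fe: "(\<Sum>j<s. f i j * e j l) = (if i = l then 1 else 0)" if "i < r" "l < r" for i l
    by (rule normal_tuple_coefficients[OF \<mu> \<nu> K e f that])
  have ef: "(\<Sum>j<r. e i j * f j l) = (if i = l then 1 else 0)" if "i < s" "l < s" for i l
    by (rule normal_tuple_coefficients[OF \<nu> \<mu> K(1,3,2) f e that])
  \<comment> \<open>The two products of the rectangular exponent matrices are identity matrices and
    have the same trace, so their sizes agree.\<close>
  have "int r = (\<Sum>i<r. \<Sum>j<s. f i j * e j i)" using fe by simp
  also have "\<dots> = (\<Sum>j<s. \<Sum>i<r. e j i * f i j)" by (subst sum.swap) (simp add: mult.commute)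
  also have "\<dots> = int s" using ef by simp
  finally show rs: "r = s" by simp
  define C where "C = mat r r (\<lambda>(i, j). e i j)"
  define D where "D = mat r r (\<lambda>(i, j). f i j)"
  have CD: "C \<in> carrier_mat r r" "D \<in> carrier_mat r r" by (simp_all add: C_def D_def)
  have "C * D = 1\<^sub>m r"
    using ef rs by (intro eq_matI) (auto simp: C_def D_def scalar_prod_def lessThan_atLeast0)
  moreover have "D * C = 1\<^sub>m r"
    using fe rs by (intro eq_matI) (auto simp: C_def D_def scalar_prod_def lessThan_atLeast0)
  ultimately have C: "C \<in> GL_mat r" using GL_matI[OF CD] by blast
  define A where "A = four_block_mat C (0\<^sub>m r (m - r)) (0\<^sub>m (m - r) r) (1\<^sub>m (m - r))"
  have A: "A \<in> GL_mat m"
    using GL_mat_four_block[OF C GL_mat_one[of "m - r"]] rm(1) by (simp add: A_def)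
  have entry: "A $$ (i, j) = (if i < r \<and> j < r then e i j else if i = j then 1 else 0)" if "i < m" "j < m" for i j
    using that rm(1) by (auto simp: A_def C_def)
  let ?v = "monomial_act A \<mu>"
  have v: "?v $ i = (if i < r then \<Prod>j<r. \<mu> $ j powi e i j else \<mu> $ i)" if i: "i < m" for i
  proof (cases "i < r")
    case True
    have "?v $ i = (\<Prod>j<m. \<mu> $ j powi A $$ (i, j))" by (rule monomial_act_index[OF GL_mat_carrier[OF A] i])
    also have "\<dots> = (\<Prod>j<r. \<mu> $ j powi A $$ (i, j))"
      using rm(1) i True by (intro prod.mono_neutral_right) (auto simp: entry)
    also have "\<dots> = (\<Prod>j<r. \<mu> $ j powi e i j)" using rm(1) i True by (intro prod.cong) (auto simp: entry)
    finally show ?thesis using True by simp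
  next
    case False
    have "?v $ i = (\<Prod>j<m. \<mu> $ j powi A $$ (i, j))" by (rule monomial_act_index[OF GL_mat_carrier[OF A] i])
    also have "\<dots> = (\<Prod>j<m. \<mu> $ j powi (if i = j then 1 else 0))"
      using i False by (intro prod.cong refl) (simp add: entry)
    also have "\<dots> = \<mu> $ i" by (simp only: prod_powi_delta[OF i, of "\<lambda>j. \<mu> $ j"] power_int_1_right)
    finally show ?thesis using False by simp
  qed
  have eqv: "torus_equiv m \<mu> ?v" unfolding torus_equiv_def using A t(1) by blast
  show "torus_equiv m \<mu> (upd \<nu> r (\<mu> $ r))"
  proof (cases "r < m")
    case True
    have I: "finite {..<r}" "{..<r} \<subseteq> {..<m} - {r}" using rm(1) by auto
    have "torus_equiv m ?v (vec m (\<lambda>i. if i \<in> {..<r} then ?v $ i * ?v $ r powi c i else ?v $ i))"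
      using torus_equiv_torus[OF eqv] by (intro torus_equiv_shear[OF _ True I]) blast
    moreover have "vec m (\<lambda>i. if i \<in> {..<r} then ?v $ i * ?v $ r powi c i else ?v $ i) = upd \<nu> r (\<mu> $ r)"
    proof (rule eq_vecI)
      fix i assume "i < dim_vec (upd \<nu> r (\<mu> $ r))"
      then have i: "i < m" by (simp add: dims)
      have "\<mu> $ i = 1" "\<nu> $ i = 1" if "r < i" using \<mu> \<nu> that i rs by (auto simp: normal_tuple_def)
      then show "vec m (\<lambda>i. if i \<in> {..<r} then ?v $ i * ?v $ r powi c i else ?v $ i) $ i = upd \<nu> r (\<mu> $ r) $ i"
        using i True e[OF i] by (auto simp: v dims torsion_part_def)
    qed (simp add: dims)
    ultimately show ?thesis using torus_equiv_trans[OF eqv] by simp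
  next
    case False
    then have "r = m" using rm by simp
    have "?v = upd \<nu> r (\<mu> $ r)"
    proof (rule eq_vecI)
      fix i assume "i < dim_vec (upd \<nu> r (\<mu> $ r))"
      then have i: "i < m" by (simp add: dims)
      then show "?v $ i = upd \<nu> r (\<mu> $ r) $ i"
        using \<open>r = m\<close> e[OF i] by (simp add: v dims torsion_part_def)
    qed (use carrier_matD(1)[OF GL_mat_carrier[OF A]] in \<open>simp add: dims\<close>)
    then show ?thesis using eqv by simp
  qed
  show "\<exists>k. \<nu> $ r = \<mu> $ r powi k" if r: "r < m"
  proof -
    have nz: "\<mu> $ j \<noteq> 0" if "j < r" for j using torus_nonzero[OF t(1)] that r by simp
    have kill: "(x powi k) powi int K = 1" if "x ^ K = 1" for x :: 'a and k
      using that by (metis power_int_mult power_int_of_nat mult.commute power_int_1_left)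
    \<comment> \<open>The K-th power kills torsion on both sides, so by independence the expansion
      of \<nu>_r in terms of \<mu> has no free part.\<close>
    have "\<nu> $ r ^ K = 1" using K(3) r rs by (simp add: torsion_part_def)
    then have "1 = \<nu> $ r powi int K" by simp
    also have "\<dots> = (\<Prod>j<r. \<mu> $ j powi (e r j * int K))"
      by (subst e[OF r]) (simp add: power_int_mult_distrib kill[OF K(2)] prod_powi power_int_mult del: power_int_of_nat)
    finally have "(\<Prod>j<r. \<mu> $ j powi (e r j * int K)) = (\<Prod>j<r. \<mu> $ j powi (0 * int K))" by simp
    note eq = this
    have ind: "independent_upto r \<mu>" using \<mu> by (simp add: normal_tuple_def)
    have "e r j = 0" if "j < r" for j
      by (rule independent_uptoD[where a = "e r" and b = "\<lambda>_. 0", OF ind nz K(1) eq that])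
    then have "\<nu> $ r = \<mu> $ r powi c r" using e[OF r] r by (simp add: torsion_part_def)
    then show ?thesis by blast
  qed
qed

lemma normal_tuple_equiv:
  fixes \<mu> \<nu> :: "'a::field vec"
  assumes \<mu>: "normal_tuple m r \<mu>" and \<nu>: "normal_tuple m s \<nu>"
    and \<mu>\<nu>: "\<forall>i<m. tspan m \<mu> (\<nu> $ i)" and \<nu>\<mu>: "\<forall>i<m. tspan m \<nu> (\<mu> $ i)"
    and r: "r + 1 \<noteq> m"
  shows "torus_equiv m \<mu> \<nu>"
proof -
  note cmp = normal_tuple_compare[OF \<mu> \<nu> \<mu>\<nu> \<nu>\<mu>] and cmp' = normal_tuple_compare[OF \<nu> \<mu> \<nu>\<mu> \<mu>\<nu>]
  have t: "\<mu> \<in> torus m" "\<nu> \<in> torus m" and rm: "r \<le> m" using \<mu> \<nu> by (auto simp: normal_tuple_def)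
  have dim: "dim_vec \<nu> = m" using torus_carrier[OF t(2)] by simp
  show ?thesis
  proof (cases "r = m")
    case True
    have "upd \<nu> r (\<mu> $ r) = \<nu>" using True dim by (intro eq_vecI) auto
    then show ?thesis using cmp(2) by simp
  next
    case False
    then have r1: "r + 1 < m" using r rm by simp
    then have rm': "r < m" "s < m" using cmp(1) by simp_all
    obtain k where k: "\<nu> $ r = \<mu> $ r powi k" using cmp(3)[OF rm'(1)] by blast
    obtain l where l: "\<mu> $ r = \<nu> $ r powi l" using cmp'(3)[OF rm'(2)] unfolding cmp(1) by blast
    note kl = k l
    let ?u = "upd \<nu> r (\<mu> $ r)"
    let ?u1 = "upd ?u (r + 1) (?u $ (r + 1) * ?u $ r powi k)"
    let ?u2 = "upd ?u1 r (?u1 $ r * ?u1 $ (r + 1) powi - l)"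
    let ?u3 = "vec m (\<lambda>i. ?u2 $ Transposition.transpose r (r + 1) i)"
    have 1: "torus_equiv m ?u ?u1"
      using torus_equiv_torus[OF cmp(2)] r1 by (intro torus_equiv_addrow) auto
    have 2: "torus_equiv m ?u1 ?u2"
      using torus_equiv_torus[OF 1] r1 by (intro torus_equiv_addrow) auto
    have 3: "torus_equiv m ?u2 ?u3"
      using torus_equiv_torus[OF 2] r1 by (intro torus_equiv_swap) auto
    have one: "\<nu> $ (r + 1) = 1" using \<nu> r1 cmp(1) by (simp add: normal_tuple_def)
    have u1: "?u1 $ r = \<mu> $ r" "?u1 $ (r + 1) = \<nu> $ r" using r1 dim one kl(1) by simp_all
    have nz: "\<nu> $ r \<noteq> 0" using torus_nonzero[OF t(2)] r1 by simp
    have "?u2 $ r = ?u1 $ r * ?u1 $ (r + 1) powi - l" using r1 dim by simp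
    also have "\<dots> = \<mu> $ r * inverse (\<mu> $ r)"
      unfolding u1 power_int_minus l[symmetric] ..
    finally have u2r: "?u2 $ r = 1" using r1 torus_nonzero[OF t(1), of r] by simp
    have "?u3 = \<nu>"
    proof (rule eq_vecI)
      fix i assume "i < dim_vec \<nu>"
      then have i: "i < m" by (simp add: dim)
      consider "i = r" | "i = r + 1" | "i \<noteq> r" "i \<noteq> r + 1" by blast
      then show "?u3 $ i = \<nu> $ i"
      proof cases
        case 1
        then have "?u3 $ i = ?u1 $ (r + 1)" using i r1 dim by simp
        then show ?thesis using u1(2) 1 by simp
      next
        case 2
        then have "?u3 $ i = ?u2 $ r" using i by simp
        then show ?thesis using u2r one 2 by simp
      next
        case 3
        then show ?thesis using i r1 dim by (simp add: Transposition.transpose_def)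
      qed
    qed (simp add: dim)
    then show ?thesis using torus_equiv_trans[OF cmp(2) torus_equiv_trans[OF 1 torus_equiv_trans[OF 2 3]]] by simp
  qed
qed

subsection \<open>Conjugacy of standard automorphisms\<close>

text \<open>\<open>h = 1\<close> gives the diagonal automorphisms and \<open>h = 2\<close> the almost-diagonal ones.\<close>

definition std_weights :: "nat \<Rightarrow> 'a::field vec \<Rightarrow> nat \<Rightarrow> 'a" where
  "std_weights h \<mu> i = (if i < h then 1 else \<mu> $ (i - h))"

definition std_eps :: "nat \<Rightarrow> 'a::field" where
  "std_eps h = (if h = 1 then 0 else 1)"

definition std_aut :: "nat \<Rightarrow> nat \<Rightarrow> 'a::field vec \<Rightarrow> 'a rational_map" where
  "std_aut n h \<mu> = rational_map_of n (lin_tuple n (std_eps h) (std_weights h \<mu>))"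

lemma diagonal_aut_std: "diagonal_aut n \<mu> = std_aut n 1 \<mu>"
proof -
  have "diag_weights \<mu> = std_weights 1 \<mu>" by (auto simp: diag_weights_def std_weights_def)
  then show ?thesis by (simp add: diagonal_aut_eq std_aut_def std_eps_def)
qed

lemma almost_diagonal_aut_std: "almost_diagonal_aut n \<nu> = std_aut n 2 \<nu>"
proof -
  have "almost_diag_weights \<nu> = std_weights 2 \<nu>" by (auto simp: almost_diag_weights_def std_weights_def)
  then show ?thesis by (simp add: almost_diagonal_aut_eq std_aut_def std_eps_def)
qed

text \<open>m is the number of free weights. The remaining h of the n + 1 homogeneous weights are
  1.\<close>

locale standard =
  fixes n h m :: nat
  assumes h: "h = 1 \<or> h = 2" and m: "m + h = n + 1"
begin

lemma affine_diagonal_std: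
  "\<mu> \<in> torus m \<Longrightarrow> affine_diagonal n (std_eps h) (std_weights h \<mu> :: nat \<Rightarrow> 'a::field_char_0)"
  using h m by unfold_locales (auto simp: std_weights_def std_eps_def torus_def)

lemma birational_std:
  "\<mu> \<in> torus m \<Longrightarrow> birational_tuple n (lin_tuple n (std_eps h) (std_weights h \<mu> :: nat \<Rightarrow> 'a::field_char_0))"
  by (rule birational_affine_diagonal[OF affine_diagonal_std])

lemma std_aut_carrier:
  "\<mu> \<in> torus m \<Longrightarrow> (std_aut n h \<mu> :: 'a::field_char_0 rational_map) \<in> carrier (Bir_proj n)"
  unfolding std_aut_def using birational_std by auto

lemma base_std:
  fixes \<mu> :: "'a::field_char_0 vec"
  assumes "\<mu> \<in> torus m"
  shows "affine_diagonal.base n (std_weights h \<mu>) e = (\<Prod>i<m. \<mu> $ i ^ e (i + h))"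
proof -
  have "affine_diagonal.base n (std_weights h \<mu>) e = (\<Prod>i<n + 1. std_weights h \<mu> i ^ e i)"
    by (rule affine_diagonal.base_def[OF affine_diagonal_std[OF assms]])
  also have "\<dots> = (\<Prod>i\<in>{0 + h..<m + h}. std_weights h \<mu> i ^ e i)"
    using m by (intro prod.mono_neutral_right) (auto simp: std_weights_def)
  also have "\<dots> = (\<Prod>i<m. \<mu> $ i ^ e (i + h))"
    unfolding prod.shift_bounds_nat_ivl by (simp add: std_weights_def lessThan_atLeast0)
  finally show ?thesis .
qed

lemma conjugate_std_iff:
  fixes \<mu> \<nu> :: "'a::field_char_0 vec"
  assumes "\<mu> \<in> torus m" "\<nu> \<in> torus m"
  shows "conjugate_in (Bir_proj n) (std_aut n h \<mu>) (std_aut n h \<nu>) \<longleftrightarrow>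
    (\<exists>F. birational_tuple n F \<and> same_rational_map n (F \<circ> lin_tuple n (std_eps h) (std_weights h \<mu>))
      (lin_tuple n (std_eps h) (std_weights h \<nu>) \<circ> F))"
  unfolding std_aut_def by (rule conjugate_in_Bir_proj_iff[OF birational_std[OF assms(1)] birational_std[OF assms(2)]])

lemma conjugate_std_tspan:
  fixes \<mu> \<nu> :: "'a::field_char_0 vec"
  assumes \<mu>: "\<mu> \<in> torus m" and \<nu>: "\<nu> \<in> torus m"
    and conj: "conjugate_in (Bir_proj n) (std_aut n h \<mu>) (std_aut n h \<nu>)" and i: "i < m"
  shows "tspan m \<mu> (\<nu> $ i)"
proof -
  obtain F where F: "birational_tuple n F" "same_rational_map n (F \<circ> lin_tuple n (std_eps h) (std_weights h \<mu>))
      (lin_tuple n (std_eps h) (std_weights h \<nu>) \<circ> F)"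
    using conj unfolding conjugate_std_iff[OF \<mu> \<nu>] by blast
  \<comment> \<open>The homogeneous index i + h is never the index 1 of the additive coordinate when
    h = 2, so the multiplicative relation applies.\<close>
  have ih: "i + h \<le> n" "i + h \<noteq> 1 \<or> std_eps h = (0 :: 'a)" using i m h by (auto simp: std_eps_def)
  have w: "std_weights h \<nu> (i + h) = \<nu> $ i" by (simp add: std_weights_def)
  obtain e e' where "affine_diagonal.base n (std_weights h \<mu>) e = \<nu> $ i * affine_diagonal.base n (std_weights h \<mu>) e'"
    using conjugate_weight[OF affine_diagonal_std[OF \<mu>] affine_diagonal_std[OF \<nu>] F ih] unfolding w by blast
  then have eq: "(\<Prod>i<m. \<mu> $ i ^ e (i + h)) = \<nu> $ i * (\<Prod>i<m. \<mu> $ i ^ e' (i + h))"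
    unfolding base_std[OF \<mu>] .
  have nz: "(\<Prod>i<m. \<mu> $ i ^ e' (i + h)) \<noteq> 0" using torus_nonzero[OF \<mu>] by auto
  have "\<nu> $ i = (\<Prod>i<m. \<mu> $ i ^ e (i + h)) / (\<Prod>i<m. \<mu> $ i ^ e' (i + h))"
    using eq nz by (simp add: field_simps)
  also have "\<dots> = (\<Prod>i<m. \<mu> $ i powi (int (e (i + h)) - int (e' (i + h))))"
    unfolding prod_dividef[symmetric] using torus_nonzero[OF \<mu>]
    by (intro prod.cong refl) (simp add: power_int_diff)
  finally show ?thesis
    unfolding tspan_def by (rule exI[of _ "\<lambda>i. int (e (i + h)) - int (e' (i + h))"])
qed

lemma torus_equiv_conjugate_std:
  fixes \<mu> \<nu> :: "'a::field_char_0 vec"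
  assumes "torus_equiv m \<mu> \<nu>"
  shows "conjugate_in (Bir_proj n) (std_aut n h \<mu>) (std_aut n h \<nu>)"
proof -
  obtain A where A: "A \<in> GL_mat m" "\<nu> = monomial_act A \<mu>" and \<mu>: "\<mu> \<in> torus m"
    using assms unfolding torus_equiv_def by blast
  show ?thesis
  proof (cases "h = 1")
    case True
    then have "m = n" using m by simp
    then have "conj_by (Bir_proj n) (T_map n A) (std_aut n h \<mu>) (std_aut n h \<nu>)"
      using conj_by_T_map[of A n \<mu>] A \<mu> True by (simp add: diagonal_aut_std)
    then show ?thesis unfolding conjugate_in_def using T_map_carrier A(1) \<open>m = n\<close> by blast
  next
    case False
    then have h2: "h = 2" using h by blast
    then have mn: "m = n - 1" "n \<ge> 1" using m by auto
    then have "conj_by (Bir_proj n) (S_map n A) (std_aut n h \<mu>) (std_aut n h \<nu>)"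
      using conj_by_S_map[of n A \<mu>] A \<mu> h2 by (simp add: almost_diagonal_aut_std)
    then show ?thesis unfolding conjugate_in_def using S_map_carrier A(1) mn by blast
  qed
qed

lemma mid_independent_std:
  fixes \<mu> :: "'a::field_char_0 vec"
  assumes \<mu>: "normal_tuple m r \<mu>" and r: "r + 1 = m" and K: "K > 0"
  shows "affine_diagonal.mid_independent n (std_eps h) (std_weights h \<mu>) K"
proof -
  have t: "\<mu> \<in> torus m" and ind: "independent_upto r \<mu>" using \<mu> by (auto simp: normal_tuple_def)
  note A = affine_diagonal_std[OF t]
  \<comment> \<open>With r + 1 = m the last homogeneous index is n = r + h, so \<open>mid\<close>
    consists exactly of the positions of the r independent weights.\<close>
  have mid: "affine_diagonal.mid n (std_eps h :: 'a) = {0 + h..<r + h}"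
    unfolding affine_diagonal.mid_def[OF A] using h m r by (auto simp: std_eps_def)
  have prod: "(\<Prod>i\<in>{0 + h..<r + h}. std_weights h \<mu> i ^ (K * e i)) = (\<Prod>i<r. \<mu> $ i powi (int (e (i + h)) * int K))" for e
    unfolding prod.shift_bounds_nat_ivl
    by (intro prod.cong)
      (auto simp: std_weights_def lessThan_atLeast0 mult.commute simp flip: of_nat_mult)
  show ?thesis
    unfolding affine_diagonal.mid_independent_def[OF A] mid
  proof (intro allI impI ballI)
    fix e e' i
    assume eq: "(\<Prod>i\<in>{0 + h..<r + h}. std_weights h \<mu> i ^ (K * e i)) =
      (\<Prod>i\<in>{0 + h..<r + h}. std_weights h \<mu> i ^ (K * e' i))" and i: "i \<in> {0 + h..<r + h}"
    have nz: "\<mu> $ i \<noteq> 0" if "i < r" for i using torus_nonzero[OF t] that r by simp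
    have "int (e ((i - h) + h)) = int (e' ((i - h) + h))"
      by (rule independent_uptoD[OF ind nz K eq[unfolded prod]]) (use i in auto)
    then show "e i = e' i" using i by simp
  qed
qed

lemma conjugate_std_imp_torus_equiv:
  fixes \<mu> \<mu>' :: "'a::{alg_closed_field, field_char_0} vec"
  assumes \<mu>: "\<mu> \<in> torus m" and \<mu>': "\<mu>' \<in> torus m"
    and conj: "conjugate_in (Bir_proj n) (std_aut n h \<mu>) (std_aut n h \<mu>')"
  shows "torus_equiv m \<mu> \<mu>'"
proof -
  note trans = group.conjugate_in_trans[OF group_Bir_proj] and sym = group.conjugate_in_sym[OF group_Bir_proj]
  obtain r \<nu> where \<nu>: "torus_equiv m \<mu> \<nu>" "normal_tuple m r \<nu>" using normal_tuple_exists[OF \<mu>] by blast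
  obtain r' \<nu>' where \<nu>': "torus_equiv m \<mu>' \<nu>'" "normal_tuple m r' \<nu>'" using normal_tuple_exists[OF \<mu>'] by blast
  have t: "\<nu> \<in> torus m" "\<nu>' \<in> torus m" using \<nu>(2) \<nu>'(2) by (auto simp: normal_tuple_def)
  note carr = std_aut_carrier[OF \<mu>] std_aut_carrier[OF \<mu>'] std_aut_carrier[OF t(1)] std_aut_carrier[OF t(2)]
  have 1: "conjugate_in (Bir_proj n) (std_aut n h \<nu>) (std_aut n h \<mu>)"
    by (rule torus_equiv_conjugate_std[OF torus_equiv_sym[OF \<nu>(1)]])
  have 2: "conjugate_in (Bir_proj n) (std_aut n h \<mu>') (std_aut n h \<nu>')"
    by (rule torus_equiv_conjugate_std[OF \<nu>'(1)])
  have c: "conjugate_in (Bir_proj n) (std_aut n h \<nu>) (std_aut n h \<nu>')"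
    by (rule trans[OF trans[OF 1 conj carr(3,1,2)] 2 carr(3,2,4)])
  have c': "conjugate_in (Bir_proj n) (std_aut n h \<nu>') (std_aut n h \<nu>)"
    by (rule sym[OF c carr(3,4)])
  have sp: "\<forall>i<m. tspan m \<nu> (\<nu>' $ i)" and sp': "\<forall>i<m. tspan m \<nu>' (\<nu> $ i)"
    using conjugate_std_tspan[OF t c] conjugate_std_tspan[OF t(2,1) c'] by blast+
  have "torus_equiv m \<nu> \<nu>'"
  proof (cases "r + 1 = m")
    case False
    then show ?thesis using normal_tuple_equiv[OF \<nu>(2) \<nu>'(2) sp sp'] by blast
  next
    case True
    note cmp = normal_tuple_compare[OF \<nu>(2) \<nu>'(2) sp sp'] and cmp' = normal_tuple_compare[OF \<nu>'(2) \<nu>(2) sp' sp]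
    have dim: "dim_vec \<nu>' = m" using torus_carrier[OF t(2)] by simp
    \<comment> \<open>The tuple \<nu>' with the torsion entry of \<nu>. It is equivalent to \<nu>,
      so only one torsion entry remains to be compared by means of the conjugating map.\<close>
    let ?u = "upd \<nu>' r (\<nu> $ r)"
    have u: "torus_equiv m \<nu> ?u" by (rule cmp(2))
    have ut: "?u \<in> torus m" using torus_equiv_torus[OF u] by blast
    have r: "r < m" "r' = r" using True cmp(1) by auto
    have tors: "torsion (\<nu> $ r)" "torsion (\<nu>' $ r)" using \<nu>(2) \<nu>'(2) r by (auto simp: normal_tuple_def)
    then obtain K where K: "K > 0" "(\<nu> $ r) ^ K = 1" "(\<nu>' $ r) ^ K = 1"
      using torsion_common[of "{\<nu> $ r, \<nu>' $ r}" "\<lambda>x. x"] by auto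
    have "?u $ i = \<nu>' $ i" if "i < r" for i using that r dim by simp
    then have "independent_upto r ?u"
      using independent_upto_cong[of r ?u \<nu>'] \<nu>'(2) r(2) by (simp add: normal_tuple_def)
    then have nu: "normal_tuple m r ?u"
      unfolding normal_tuple_def using ut r tors(1) dim True by auto
    have "conjugate_in (Bir_proj n) (std_aut n h ?u) (std_aut n h \<nu>')"
      by (rule trans[OF torus_equiv_conjugate_std[OF torus_equiv_sym[OF u]] c std_aut_carrier[OF ut] carr(3,4)])
    then obtain F where F: "birational_tuple n F"
      "same_rational_map n (F \<circ> lin_tuple n (std_eps h) (std_weights h ?u))
        (lin_tuple n (std_eps h) (std_weights h \<nu>') \<circ> F)"
      unfolding conjugate_std_iff[OF ut t(2)] by blast
    have last: "std_weights h v n = v $ r" for v :: "'a vec"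
      using m True by (auto simp: std_weights_def intro!: arg_cong[of _ _ "\<lambda>i. v $ i"])
    have ur: "?u $ r = \<nu> $ r" using r dim by simp
    have "std_weights h \<nu>' n = 1 \<or> std_weights h \<nu>' n = std_weights h ?u n \<or>
      std_weights h ?u n * std_weights h \<nu>' n = 1"
    proof (rule conjugate_torsion_weight[OF affine_diagonal_std[OF ut] affine_diagonal_std[OF t(2)] F _ K(1)])
      show "(if std_eps h = (0 :: 'a) then 1 else 2) \<le> n" using h m True by (auto simp: std_eps_def)
      show "std_weights h ?u n ^ K = 1" "std_weights h \<nu>' n ^ K = 1" unfolding last ur using K by auto
      show "affine_diagonal.mid_independent n (std_eps h) (std_weights h ?u) K"
        by (rule mid_independent_std[OF nu True K(1)])
      show "affine_diagonal.mid_independent n (std_eps h) (std_weights h \<nu>') K"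
        by (rule mid_independent_std[OF _ True K(1)]) (use \<nu>'(2) r in simp)
    qed
    then consider "\<nu>' $ r = 1" | "\<nu>' $ r = \<nu> $ r" | "\<nu> $ r * \<nu>' $ r = 1" unfolding last ur by blast
    then have "?u = \<nu>' \<or> \<nu>' = upd ?u r (inverse (?u $ r))"
    proof cases
      case 1
      \<comment> \<open>The torsion entries are powers of each other, so if one is 1 then so is the
        other.\<close>
      obtain k where "\<nu> $ r = \<nu>' $ r powi k" using cmp'(3) r by auto
      then have "\<nu> $ r = \<nu>' $ r" using 1 by simp
      then have "?u = \<nu>'" using dim by (intro eq_vecI) auto
      then show ?thesis by blast
    next
      case 2
      then have "?u = \<nu>'" using dim by (intro eq_vecI) auto
      then show ?thesis by blast
    next
      case 3
      then have "\<nu>' $ r = inverse (\<nu> $ r)" by (metis inverse_unique)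
      then have "\<nu>' = upd ?u r (inverse (?u $ r))" using dim r by (intro eq_vecI) auto
      then show ?thesis by blast
    qed
    then have "torus_equiv m ?u \<nu>'"
      using torus_equiv_refl[OF ut] torus_equiv_inverse[OF ut r(1)] by metis
    then show ?thesis using torus_equiv_trans[OF u] by blast
  qed
  then show ?thesis
    using torus_equiv_trans[OF \<nu>(1)] torus_equiv_trans[OF _ torus_equiv_sym[OF \<nu>'(1)]] by blast
qed

section \<open>Powers and orders of standard automorphisms\<close>

lemma std_aut_power:
  fixes \<mu> :: "'a::field_char_0 vec"
  assumes \<mu>: "\<mu> \<in> torus m"
  shows "std_aut n h \<mu> [^]\<^bsub>Bir_proj n\<^esub> k =
    rational_map_of n (affine_diagonal.orbit n (std_eps h) (std_weights h \<mu>) k)"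
proof -
  interpret A: affine_diagonal n "std_eps h :: 'a" "std_weights h \<mu>" by (rule affine_diagonal_std[OF \<mu>])
  interpret G: group "Bir_proj n :: 'a rational_map monoid" by (rule group_Bir_proj)
  have orb: "birational_tuple n (A.orbit k)" for k
    unfolding A.orbit_def using A.l_nonzero by (intro birational_lin_tuple) auto
  show ?thesis
  proof (induction k)
    case 0
    have "same_rational_map n id (A.orbit 0)"
      unfolding same_rational_map_def using A.orbit_0 by (simp add: mult.commute)
    then show ?case
      using rational_map_of_eq_iff[OF homogeneous_tuple_id birational_tuple_homogeneous[OF orb]] by simp
  next
    case (Suc k)
    have "std_aut n h \<mu> [^]\<^bsub>Bir_proj n\<^esub> Suc k = std_aut n h \<mu> \<otimes>\<^bsub>Bir_proj n\<^esub> (std_aut n h \<mu> [^]\<^bsub>Bir_proj n\<^esub> k)"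
      by (rule G.nat_pow_Suc2[OF std_aut_carrier[OF \<mu>]])
    also have "\<dots> = rational_map_of n (A.M \<circ> A.orbit k)"
      unfolding Suc unfolding std_aut_def by (rule Bir_proj_mult[OF birational_std[OF \<mu>] orb])
    also have "A.M \<circ> A.orbit k = A.orbit (Suc k)" by (rule ext) (simp add: A.orbit_Suc)
    finally show ?case .
  qed
qed

lemma std_aut_power_one:
  fixes \<mu> :: "'a::field_char_0 vec"
  assumes \<mu>: "\<mu> \<in> torus m" and n: "n \<ge> 1"
  shows "std_aut n h \<mu> [^]\<^bsub>Bir_proj n\<^esub> k = \<one>\<^bsub>Bir_proj n\<^esub> \<longleftrightarrow>
    (h = 1 \<or> k = 0) \<and> (\<forall>i<m. \<mu> $ i ^ k = 1)"
proof -
  interpret A: affine_diagonal n "std_eps h :: 'a" "std_weights h \<mu>" by (rule affine_diagonal_std[OF \<mu>])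
  have orb: "birational_tuple n (A.orbit k)"
    unfolding A.orbit_def using A.l_nonzero by (intro birational_lin_tuple) auto
  have "std_aut n h \<mu> [^]\<^bsub>Bir_proj n\<^esub> k = \<one>\<^bsub>Bir_proj n\<^esub> \<longleftrightarrow> same_rational_map n (A.orbit k) id"
    unfolding std_aut_power[OF \<mu>] Bir_proj_simps
    by (rule rational_map_of_eq_iff[OF birational_tuple_homogeneous[OF orb] homogeneous_tuple_id])
  also have "\<dots> \<longleftrightarrow> (h = 1 \<or> k = 0) \<and> (\<forall>i<m. \<mu> $ i ^ k = 1)"
  proof
    assume same: "same_rational_map n (A.orbit k) id"
    \<comment> \<open>Two test points: (1 : 0 : ... : 0) detects the additive term k \<epsilon>, and
      (1 : ... : 1) then detects the weights.\<close>
    let ?e = "vec (n + 1) (\<lambda>i. if i = 0 then 1 else 0) :: 'a vec" and ?one = "vec (n + 1) (\<lambda>_. 1) :: 'a vec"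
    have "A.orbit k ?e $ 0 * ?e $ 1 = A.orbit k ?e $ 1 * ?e $ 0"
      using same n unfolding same_rational_map_def by (metis id_apply vec_carrier le0)
    then have eps: "of_nat k * std_eps h = (0 :: 'a)"
      using n A.l0 by (simp add: A.orbit_def lin_tuple_def)
    then have hk: "h = 1 \<or> k = 0" by (auto simp: std_eps_def split: if_splits)
    have "\<mu> $ i ^ k = 1" if "i < m" for i
    proof -
      have ih: "i + h \<le> n" using that m by simp
      have "A.orbit k ?one $ (i + h) * ?one $ 0 = A.orbit k ?one $ 0 * ?one $ (i + h)"
        using same ih unfolding same_rational_map_def by (metis id_apply vec_carrier le0)
      then show ?thesis
        using ih eps A.l0
        by (simp add: A.orbit_def lin_tuple_def) (simp add: std_weights_def split: if_splits)
    qed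
    with hk show "(h = 1 \<or> k = 0) \<and> (\<forall>i<m. \<mu> $ i ^ k = 1)" by blast
  next
    assume *: "(h = 1 \<or> k = 0) \<and> (\<forall>i<m. \<mu> $ i ^ k = 1)"
    have "std_weights h \<mu> i ^ k = 1" if "i \<le> n" for i
    proof (cases "i < h")
      case False
      then have "i - h < m" using that m by simp
      then show ?thesis using * False by (simp add: std_weights_def)
    qed (simp add: std_weights_def)
    moreover have "of_nat k * std_eps h = (0 :: 'a)" using * by (auto simp: std_eps_def)
    ultimately have "A.orbit k x = x" if "x \<in> carrier_vec (n + 1)" for x
      using that by (intro eq_vecI) (auto simp: A.orbit_def lin_tuple_def less_Suc_eq_le)
    then show "same_rational_map n (A.orbit k) id"
      unfolding same_rational_map_def by (simp add: mult.commute)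
  qed
  finally show ?thesis .
qed

end

lemma (in group) conjugate_in_pow:
  assumes "conjugate_in G f g" "f \<in> carrier G" "g \<in> carrier G"
  shows "f [^] (k :: nat) = \<one> \<longleftrightarrow> g [^] k = \<one>"
proof -
  obtain \<phi> where \<phi>: "\<phi> \<in> carrier G" "\<phi> \<otimes> f = g \<otimes> \<phi>"
    using assms conj_by_iff unfolding conjugate_in_def by blast
  have "\<phi> \<otimes> f [^] k = g [^] k \<otimes> \<phi>"
  proof (induction k)
    case (Suc k)
    have "\<phi> \<otimes> f [^] Suc k = (\<phi> \<otimes> f [^] k) \<otimes> f" using \<phi> assms by (simp add: m_assoc)
    also have "\<dots> = g [^] k \<otimes> (\<phi> \<otimes> f)" unfolding Suc using \<phi>(1) assms by (simp add: m_assoc)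
    also have "\<dots> = g [^] Suc k \<otimes> \<phi>" unfolding \<phi>(2) using \<phi>(1) assms by (simp add: m_assoc)
    finally show ?case .
  qed (use \<phi> in simp)
  then show ?thesis using \<phi>(1) assms by (metis l_cancel_one l_cancel_one' nat_pow_closed r_cancel_one r_cancel_one')
qed

text \<open>Almost-diagonal maps have infinite order in characteristic 0, and a free weight would
  satisfy no relation. What is left is the tuple (\<zeta>, 1, ..., 1) with a root of unity \<zeta>
  of order exactly K.\<close>

lemma finite_order_normal_form:
  fixes f :: "'a::{alg_closed_field, field_char_0} rational_map"
  assumes f: "f \<in> Aut_proj n" and n: "n \<ge> 1" and K: "group.ord (Bir_proj n) f = K" "K > 0"
  obtains \<nu> where "normal_tuple n 0 \<nu>" "conjugate_in (Bir_proj n) f (std_aut n 1 \<nu>)"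
    "\<And>k. (\<nu> $ 0) ^ k = 1 \<longleftrightarrow> K dvd k"
proof -
  interpret G: group "Bir_proj n :: 'a rational_map monoid" by (rule group_Bir_proj)
  interpret S1: standard n 1 n by unfold_locales simp_all
  interpret S2: standard n 2 "n - 1" using n by unfold_locales simp_all
  have fc: "f \<in> carrier (Bir_proj n)" using f Aut_proj_subset by blast
  have ord: "f [^]\<^bsub>Bir_proj n\<^esub> k = \<one>\<^bsub>Bir_proj n\<^esub> \<longleftrightarrow> K dvd k" for k
    using G.pow_eq_id[OF fc] K(1) by blast
  have "\<not> (\<exists>\<nu>\<in>torus (n - 1). conjugate_in (Bir_proj n) f (almost_diagonal_aut n \<nu>))"
  proof
    assume "\<exists>\<nu>\<in>torus (n - 1). conjugate_in (Bir_proj n) f (almost_diagonal_aut n \<nu>)"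
    then obtain \<nu> where \<nu>: "\<nu> \<in> torus (n - 1)" "conjugate_in (Bir_proj n) f (std_aut n 2 \<nu>)"
      unfolding almost_diagonal_aut_std by blast
    then show False
      using G.conjugate_in_pow[OF \<nu>(2) fc S2.std_aut_carrier[OF \<nu>(1)], of K] ord[of K]
        S2.std_aut_power_one[OF \<nu>(1) n, of K] K(2) by simp
  qed
  then obtain \<mu> where \<mu>: "\<mu> \<in> torus n" "conjugate_in (Bir_proj n) f (std_aut n 1 \<mu>)"
    using Aut_proj_normal_form[OF f] unfolding diagonal_aut_std by blast
  obtain r \<nu> where \<nu>: "torus_equiv n \<mu> \<nu>" "normal_tuple n r \<nu>" using normal_tuple_exists[OF \<mu>(1)] by blast
  have t: "\<nu> \<in> torus n" using \<nu>(2) by (simp add: normal_tuple_def)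
  have conj: "conjugate_in (Bir_proj n) f (std_aut n 1 \<nu>)"
    by (rule G.conjugate_in_trans[OF \<mu>(2) S1.torus_equiv_conjugate_std[OF \<nu>(1)] fc
          S1.std_aut_carrier[OF \<mu>(1)] S1.std_aut_carrier[OF t]])
  have pow: "(\<forall>i<n. \<nu> $ i ^ k = 1) \<longleftrightarrow> K dvd k" for k
    using G.conjugate_in_pow[OF conj fc S1.std_aut_carrier[OF t], of k] ord[of k]
      S1.std_aut_power_one[OF t n, of k] by simp
  have "r = 0"
  proof (rule ccontr)
    assume "r \<noteq> 0"
    then have r: "0 < r" "r \<le> n" using \<nu>(2) by (auto simp: normal_tuple_def)
    have "\<forall>i<n. \<nu> $ i ^ K = 1" using pow[of K] by simp
    \<comment> \<open>The equation \<nu>_0^K = 1, written as a nontrivial relation among the first r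
      entries.\<close>
    then have "(\<Prod>i<r. \<nu> $ i powi (if 0 = i then int K else 0)) = 1"
      using r prod_powi_delta[OF r(1), of "\<lambda>i. \<nu> $ i" "int K"] by simp
    moreover have "independent_upto r \<nu>" using \<nu>(2) by (simp add: normal_tuple_def)
    ultimately have "(if 0 = (0 :: nat) then int K else 0) = 0"
      using r(1) unfolding independent_upto_def
      by (elim allE[of _ "\<lambda>i. if 0 = i then int K else 0"]) blast
    then show False using K(2) by simp
  qed
  then have norm: "normal_tuple n 0 \<nu>" using \<nu>(2) by simp
  have "(\<nu> $ 0) ^ k = 1 \<longleftrightarrow> K dvd k" for k
  proof -
    have "(\<forall>i<n. \<nu> $ i ^ k = 1) \<longleftrightarrow> (\<nu> $ 0) ^ k = 1"
    proof (intro iffI allI impI)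
      fix i assume "(\<nu> $ 0) ^ k = 1" "i < n"
      then show "\<nu> $ i ^ k = 1" using norm by (cases "i = 0") (auto simp: normal_tuple_def)
    qed (use n in simp)
    then show ?thesis using pow by simp
  qed
  then show thesis using that norm conj by blast
qed

lemma tspan_one_generator:
  assumes "normal_tuple n 0 \<mu>" "n \<ge> 1" "\<exists>k. x = (\<mu> $ 0) ^ k"
  shows "tspan n \<mu> x"
proof -
  obtain k where k: "x = (\<mu> $ 0) ^ k" using assms(3) by blast
  have "(\<Prod>i<n. \<mu> $ i powi (if 0 = i then int k else 0)) = x"
    using prod_powi_delta[of 0 n "\<lambda>i. \<mu> $ i" "int k"] assms(2) k by simp
  then show ?thesis unfolding tspan_def by (intro exI[of _ "\<lambda>i. if 0 = i then int k else 0"]) (rule sym)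
qed

text \<open>Both maps reduce to (\<zeta>, 1, ..., 1) and (\<zeta>', 1, ..., 1) with \<zeta>,
  \<zeta>' generating the same cyclic group, and n > 1 provides the spare entry 1. As
  \<open>group.ord\<close> is 0 for infinite order, positivity expresses finiteness.\<close>

lemma conjugate_same_finite_order:
  fixes f g :: "'a::{alg_closed_field, field_char_0} rational_map"
  assumes f: "f \<in> Aut_proj n" and g: "g \<in> Aut_proj n" and n: "n > 1"
    and ord: "group.ord (Bir_proj n) f = group.ord (Bir_proj n) g" "group.ord (Bir_proj n) f > 0"
  shows "conjugate_in (Bir_proj n) f g"
proof -
  interpret G: group "Bir_proj n :: 'a rational_map monoid" by (rule group_Bir_proj)
  interpret S1: standard n 1 n by unfold_locales simp_all
  have n1: "n \<ge> 1" using n by simp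
  let ?K = "group.ord (Bir_proj n) f"
  obtain \<mu> where \<mu>: "normal_tuple n 0 \<mu>" "conjugate_in (Bir_proj n) f (std_aut n 1 \<mu>)"
    "\<And>k. (\<mu> $ 0) ^ k = 1 \<longleftrightarrow> ?K dvd k"
    by (rule finite_order_normal_form[OF f n1 refl ord(2)]) (rule that)
  obtain \<nu> where \<nu>: "normal_tuple n 0 \<nu>" "conjugate_in (Bir_proj n) g (std_aut n 1 \<nu>)"
    "\<And>k. (\<nu> $ 0) ^ k = 1 \<longleftrightarrow> ?K dvd k"     by (rule finite_order_normal_form[OF g n1 ord(1)[symmetric] ord(2)]) (rule that)
  have powers: "\<exists>k. y $ i = (x $ 0) ^ k"
    if x: "\<And>k. (x $ 0) ^ k = 1 \<longleftrightarrow> ?K dvd k" and y: "\<And>k. (y $ 0) ^ k = 1 \<longleftrightarrow> ?K dvd k"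
      and ny: "normal_tuple n 0 y" and i: "i < n" for x y :: "'a vec" and i
  proof (cases "i = 0")
    case True
    have "(y $ 0) ^ ?K = 1" using y by simp
    then show ?thesis using powers_of_primitive_root[OF ord(2) x] True by blast
  next
    case False
    then have "y $ i = (x $ 0) ^ 0" using ny i by (simp add: normal_tuple_def)
    then show ?thesis by blast
  qed
  have t: "\<mu> \<in> torus n" "\<nu> \<in> torus n" using \<mu>(1) \<nu>(1) by (auto simp: normal_tuple_def)
  have "torus_equiv n \<mu> \<nu>"
  proof (rule normal_tuple_equiv[OF \<mu>(1) \<nu>(1)])
    show "\<forall>i<n. tspan n \<mu> (\<nu> $ i)" "\<forall>i<n. tspan n \<nu> (\<mu> $ i)"
      using tspan_one_generator[OF \<mu>(1) n1] powers[OF \<mu>(3) \<nu>(3,1)]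
        tspan_one_generator[OF \<nu>(1) n1] powers[OF \<nu>(3) \<mu>(3,1)] by simp_all
  qed (use n in simp)
  then have c: "conjugate_in (Bir_proj n) (std_aut n 1 \<mu>) (std_aut n 1 \<nu>)"
    by (rule S1.torus_equiv_conjugate_std)
  have fg: "f \<in> carrier (Bir_proj n)" "g \<in> carrier (Bir_proj n)" using f g Aut_proj_subset by blast+
  note carr = S1.std_aut_carrier[OF t(1)] S1.std_aut_carrier[OF t(2)]
  show ?thesis
    by (rule G.conjugate_in_trans[OF G.conjugate_in_trans[OF \<mu>(2) c fg(1) carr]
          G.conjugate_in_sym[OF \<nu>(2) fg(2) carr(2)] fg(1) carr(2) fg(2)])
qed

lemma not_conjugate_diagonal_almost_diagonal:
  fixes \<mu> \<nu> :: "'a::field_char_0 vec"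
  assumes n: "n \<ge> 1" and \<mu>: "\<mu> \<in> torus n" and \<nu>: "\<nu> \<in> torus (n - 1)"
  shows "\<not> conjugate_in (Bir_proj n) (diagonal_aut n \<mu>) (almost_diagonal_aut n \<nu>)"
proof
  interpret S1: standard n 1 n by unfold_locales simp_all
  interpret S2: standard n 2 "n - 1" using n by unfold_locales simp_all
  assume "conjugate_in (Bir_proj n) (diagonal_aut n \<mu>) (almost_diagonal_aut n \<nu>)"
  then obtain F where F: "birational_tuple n F"
    "same_rational_map n (F \<circ> lin_tuple n 0 (std_weights 1 \<mu>)) (lin_tuple n 1 (std_weights 2 \<nu>) \<circ> F)"
    using conjugate_in_Bir_proj_iff[OF S1.birational_std[OF \<mu>] S2.birational_std[OF \<nu>]]
    unfolding diagonal_aut_std almost_diagonal_aut_std std_aut_def by (auto simp: std_eps_def)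
  show False
    using diagonal_not_conjugate_almost_diagonal[OF _ _ n F] S1.affine_diagonal_std[OF \<mu>]
      S2.affine_diagonal_std[OF \<nu>] by (simp add: std_eps_def)
qed

theorem theorem2:
  fixes n :: nat
  assumes "n \<ge> 1"
  shows
    "(\<forall>f \<in> (Aut_proj n :: 'a::{alg_closed_field, field_char_0} rational_map set).
        ((\<exists>\<mu>\<in>torus n. conjugate_in (Bir_proj n) f (diagonal_aut n \<mu>)) \<or>
         (\<exists>\<nu>\<in>torus (n - 1). conjugate_in (Bir_proj n) f (almost_diagonal_aut n \<nu>))) \<and>
        \<not> ((\<exists>\<mu>\<in>torus n. conjugate_in (Bir_proj n) f (diagonal_aut n \<mu>)) \<and>
           (\<exists>\<nu>\<in>torus (n - 1). conjugate_in (Bir_proj n) f (almost_diagonal_aut n \<nu>))))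
     \<and>
     (\<forall>\<mu> \<in> (torus n :: 'a vec set). \<forall>\<mu>' \<in> torus n.
        (conjugate_in (Bir_proj n) (diagonal_aut n \<mu>) (diagonal_aut n \<mu>')
          \<longleftrightarrow> (\<exists>A\<in>GL_mat n. \<mu>' = monomial_act A \<mu>)) \<and>
        (conjugate_in (Bir_proj n) (diagonal_aut n \<mu>) (diagonal_aut n \<mu>')
          \<longleftrightarrow> (\<exists>A\<in>GL_mat n.
                conj_by (Bir_proj n) (T_map n A) (diagonal_aut n \<mu>) (diagonal_aut n \<mu>'))))
     \<and>
     (\<forall>\<nu> \<in> (torus (n - 1) :: 'a vec set). \<forall>\<nu>' \<in> torus (n - 1).
        (conjugate_in (Bir_proj n) (almost_diagonal_aut n \<nu>) (almost_diagonal_aut n \<nu>')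
          \<longleftrightarrow> (\<exists>B\<in>GL_mat (n - 1). \<nu>' = monomial_act B \<nu>)) \<and>
        (conjugate_in (Bir_proj n) (almost_diagonal_aut n \<nu>) (almost_diagonal_aut n \<nu>')
          \<longleftrightarrow> (\<exists>B\<in>GL_mat (n - 1).
                conj_by (Bir_proj n) (S_map n B)
                  (almost_diagonal_aut n \<nu>) (almost_diagonal_aut n \<nu>'))))
     \<and>
     (n > 1 \<longrightarrow>
       (\<forall>f \<in> (Aut_proj n :: 'a rational_map set). \<forall>g \<in> Aut_proj n.
          group.ord (Bir_proj n) f = group.ord (Bir_proj n) g \<and> group.ord (Bir_proj n) f > 0
          \<longrightarrow> conjugate_in (Bir_proj n) f g))"
proof (intro conjI)
  interpret G: group "Bir_proj n :: 'a rational_map monoid" by (rule group_Bir_proj)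
  interpret S1: standard n 1 n by unfold_locales simp_all
  interpret S2: standard n 2 "n - 1" using assms by unfold_locales simp_all
  show "\<forall>f \<in> (Aut_proj n :: 'a rational_map set).
        ((\<exists>\<mu>\<in>torus n. conjugate_in (Bir_proj n) f (diagonal_aut n \<mu>)) \<or>
         (\<exists>\<nu>\<in>torus (n - 1). conjugate_in (Bir_proj n) f (almost_diagonal_aut n \<nu>))) \<and>
        \<not> ((\<exists>\<mu>\<in>torus n. conjugate_in (Bir_proj n) f (diagonal_aut n \<mu>)) \<and>
           (\<exists>\<nu>\<in>torus (n - 1). conjugate_in (Bir_proj n) f (almost_diagonal_aut n \<nu>)))"
  proof (intro ballI conjI notI)
    fix f :: "'a rational_map" assume f: "f \<in> Aut_proj n"
    show "(\<exists>\<mu>\<in>torus n. conjugate_in (Bir_proj n) f (diagonal_aut n \<mu>)) \<or>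
         (\<exists>\<nu>\<in>torus (n - 1). conjugate_in (Bir_proj n) f (almost_diagonal_aut n \<nu>))"
      by (rule Aut_proj_normal_form[OF f])
    assume "(\<exists>\<mu>\<in>torus n. conjugate_in (Bir_proj n) f (diagonal_aut n \<mu>)) \<and>
         (\<exists>\<nu>\<in>torus (n - 1). conjugate_in (Bir_proj n) f (almost_diagonal_aut n \<nu>))"
    then obtain \<mu> \<nu> where \<mu>: "\<mu> \<in> torus n" "conjugate_in (Bir_proj n) f (diagonal_aut n \<mu>)"
      and \<nu>: "\<nu> \<in> torus (n - 1)" "conjugate_in (Bir_proj n) f (almost_diagonal_aut n \<nu>)" by blast
    have fc: "f \<in> carrier (Bir_proj n)" using f Aut_proj_subset by blast
    note carr = diagonal_aut_carrier[OF \<mu>(1)] almost_diagonal_aut_carrier[OF \<nu>(1)]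
    show False
      using not_conjugate_diagonal_almost_diagonal[OF assms \<mu>(1) \<nu>(1)]
        G.conjugate_in_trans[OF G.conjugate_in_sym[OF \<mu>(2) fc carr(1)] \<nu>(2) carr(1) fc carr(2)] by blast
  qed
  show "\<forall>\<mu> \<in> (torus n :: 'a vec set). \<forall>\<mu>' \<in> torus n.
        (conjugate_in (Bir_proj n) (diagonal_aut n \<mu>) (diagonal_aut n \<mu>')
          \<longleftrightarrow> (\<exists>A\<in>GL_mat n. \<mu>' = monomial_act A \<mu>)) \<and>
        (conjugate_in (Bir_proj n) (diagonal_aut n \<mu>) (diagonal_aut n \<mu>')
          \<longleftrightarrow> (\<exists>A\<in>GL_mat n.
                conj_by (Bir_proj n) (T_map n A) (diagonal_aut n \<mu>) (diagonal_aut n \<mu>')))"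
  proof (intro ballI)
    fix \<mu> \<mu>' :: "'a vec" assume \<mu>: "\<mu> \<in> torus n" "\<mu>' \<in> torus n"
    let ?c = "conjugate_in (Bir_proj n) (diagonal_aut n \<mu>) (diagonal_aut n \<mu>')"
      and ?A = "\<exists>A\<in>GL_mat n. \<mu>' = monomial_act A \<mu>"
      and ?T = "\<exists>A\<in>GL_mat n. conj_by (Bir_proj n) (T_map n A) (diagonal_aut n \<mu>) (diagonal_aut n \<mu>')"
    have "?c \<Longrightarrow> ?A"
      using S1.conjugate_std_imp_torus_equiv[OF \<mu>] unfolding diagonal_aut_std torus_equiv_def by blast
    moreover have "?A \<Longrightarrow> ?T" using conj_by_T_map \<mu>(1) by blast
    moreover have "?T \<Longrightarrow> ?c" unfolding conjugate_in_def using T_map_carrier by blast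
    ultimately show "(?c \<longleftrightarrow> ?A) \<and> (?c \<longleftrightarrow> ?T)" by blast
  qed
  show "\<forall>\<nu> \<in> (torus (n - 1) :: 'a vec set). \<forall>\<nu>' \<in> torus (n - 1).
        (conjugate_in (Bir_proj n) (almost_diagonal_aut n \<nu>) (almost_diagonal_aut n \<nu>')
          \<longleftrightarrow> (\<exists>B\<in>GL_mat (n - 1). \<nu>' = monomial_act B \<nu>)) \<and>
        (conjugate_in (Bir_proj n) (almost_diagonal_aut n \<nu>) (almost_diagonal_aut n \<nu>')
          \<longleftrightarrow> (\<exists>B\<in>GL_mat (n - 1).
                conj_by (Bir_proj n) (S_map n B)
                  (almost_diagonal_aut n \<nu>) (almost_diagonal_aut n \<nu>')))"
  proof (intro ballI)
    fix \<nu> \<nu>' :: "'a vec" assume \<nu>: "\<nu> \<in> torus (n - 1)" "\<nu>' \<in> torus (n - 1)"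
    let ?c = "conjugate_in (Bir_proj n) (almost_diagonal_aut n \<nu>) (almost_diagonal_aut n \<nu>')"
      and ?B = "\<exists>B\<in>GL_mat (n - 1). \<nu>' = monomial_act B \<nu>"
      and ?S = "\<exists>B\<in>GL_mat (n - 1). conj_by (Bir_proj n) (S_map n B) (almost_diagonal_aut n \<nu>) (almost_diagonal_aut n \<nu>')"
    have "?c \<Longrightarrow> ?B"
      using S2.conjugate_std_imp_torus_equiv[OF \<nu>] unfolding almost_diagonal_aut_std torus_equiv_def by blast
    moreover have "?B \<Longrightarrow> ?S" using conj_by_S_map[OF assms] \<nu>(1) by blast
    moreover have "?S \<Longrightarrow> ?c" unfolding conjugate_in_def using S_map_carrier[OF assms] by blast
    ultimately show "(?c \<longleftrightarrow> ?B) \<and> (?c \<longleftrightarrow> ?S)" by blast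
  qed
  show "n > 1 \<longrightarrow> (\<forall>f \<in> (Aut_proj n :: 'a rational_map set). \<forall>g \<in> Aut_proj n.
          group.ord (Bir_proj n) f = group.ord (Bir_proj n) g \<and> group.ord (Bir_proj n) f > 0
          \<longrightarrow> conjugate_in (Bir_proj n) f g)"
    using conjugate_same_finite_order by blast
qed

end
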